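(* Let $R$ be an associative ring with identity. Then $R$ is quasi-Frobenius if and only if $R$ is strongly right ss-injective, $l(J^2)$ is a countably generated left ideal, $S_r$ is essential in $R_R$, and the chain $r(x_1)\subseteq r(x_2x_1)\subseteq\cdots\subseteq r(x_nx_{n-1}\cdots x_1)\subseteq\cdots$ terminates (i.e. is eventually constant) for every infinite sequence $x_1,x_2,\dots$ in $R$.
   Context: Modules are unitary. $S_r=\mathrm{soc}(R_R)$ is the right socle of $R$ and $J$ is the Jacobson radical of $R$. For $X\subseteq R$, $r(X)=\{a\in R: Xa=0\}$ and $l(X)=\{a\in R: aX=0\}$. $R$ is quasi-Frobenius (QF) if it is right (or left) artinian and right (or left) self-injective. A submodule $K$ of a module $N$ is small if $K+L\neq N$ for every proper submodule $L$ of $N$. $R$ is strongly right ss-injective if for every right $R$-module $N$ and every semisimple small submodule $K$ of $N$, every $R$-homomorphism $K\to R_R$ extends to an $R$-homomorphism $N\to R_R$. *)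

theory Defs
  imports "HOL-Algebra.Module" "HOL-Algebra.Ideal_Product" "HOL-Library.Countable_Set"
begin

text \<open>
  Rings are associative with \<open>\<one>\<close>, not necessarily commutative, so the locale \<open>module\<close> of
  HOL-Algebra (which is over a \<open>cring\<close>) does not apply. We keep its record type:
  for a right module \<open>N\<close> the term \<open>r \<odot>\<^bsub>N\<^esub> x\<close> stands for the right action \<open>x r\<close>.
  The library predicate \<open>submodule\<close> does not mention the multiplication of the ring and is used
  unchanged.
\<close>

locale right_module = ring R + N?: abelian_group N
  for R :: "('a, 'b) ring_scheme" and N :: "('a, 'c) module" +
  assumes smult_closed:
      "\<lbrakk>r \<in> carrier R; x \<in> carrier N\<rbrakk> \<Longrightarrow> r \<odot>\<^bsub>N\<^esub> x \<in> carrier N"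
    and smult_ring_add:
      "\<lbrakk>r \<in> carrier R; s \<in> carrier R; x \<in> carrier N\<rbrakk> \<Longrightarrow>
        (r \<oplus>\<^bsub>R\<^esub> s) \<odot>\<^bsub>N\<^esub> x = r \<odot>\<^bsub>N\<^esub> x \<oplus>\<^bsub>N\<^esub> s \<odot>\<^bsub>N\<^esub> x"
    and smult_module_add:
      "\<lbrakk>r \<in> carrier R; x \<in> carrier N; y \<in> carrier N\<rbrakk> \<Longrightarrow>
        r \<odot>\<^bsub>N\<^esub> (x \<oplus>\<^bsub>N\<^esub> y) = r \<odot>\<^bsub>N\<^esub> x \<oplus>\<^bsub>N\<^esub> r \<odot>\<^bsub>N\<^esub> y"
    \<comment> \<open>\<open>x (r s) = (x r) s\<close>\<close>
    and smult_assoc: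
      "\<lbrakk>r \<in> carrier R; s \<in> carrier R; x \<in> carrier N\<rbrakk> \<Longrightarrow>
        (r \<otimes>\<^bsub>R\<^esub> s) \<odot>\<^bsub>N\<^esub> x = s \<odot>\<^bsub>N\<^esub> (r \<odot>\<^bsub>N\<^esub> x)"
    and smult_unit: "x \<in> carrier N \<Longrightarrow> \<one>\<^bsub>R\<^esub> \<odot>\<^bsub>N\<^esub> x = x"

text \<open>The \<open>mult\<close> and \<open>one\<close> fields of a module record carry no meaning.\<close>

definition right_regular :: "('a, 'b) ring_scheme \<Rightarrow> ('a, 'a) module"
  where "right_regular R =
    \<lparr>carrier = carrier R, mult = mult R, one = \<one>\<^bsub>R\<^esub>, zero = \<zero>\<^bsub>R\<^esub>, add = add R,
     smult = (\<lambda>r x. x \<otimes>\<^bsub>R\<^esub> r)\<rparr>"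

text \<open>Left \<open>R\<close>-modules are treated as right modules over the opposite ring.\<close>

definition opposite_ring :: "('a, 'b) ring_scheme \<Rightarrow> ('a, 'b) ring_scheme"
  where "opposite_ring R = R\<lparr>mult := (\<lambda>x y. y \<otimes>\<^bsub>R\<^esub> x)\<rparr>"

definition left_regular :: "('a, 'b) ring_scheme \<Rightarrow> ('a, 'a) module"
  where "left_regular R = right_regular (opposite_ring R)"

abbreviation right_ideal :: "'a set \<Rightarrow> ('a, 'b) ring_scheme \<Rightarrow> bool"
  where "right_ideal I R \<equiv> submodule I R (right_regular R)"

definition right_hom ::
    "('a, 'b) ring_scheme \<Rightarrow> ('a, 'c) module \<Rightarrow> ('a, 'd) module \<Rightarrow> ('c \<Rightarrow> 'd) set"
  where "right_hom R N M =
    {f \<in> hom (add_monoid N) (add_monoid M).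
       \<forall>r\<in>carrier R. \<forall>x\<in>carrier N. f (r \<odot>\<^bsub>N\<^esub> x) = r \<odot>\<^bsub>M\<^esub> f x}"

definition submodule_span :: "('a, 'b) ring_scheme \<Rightarrow> ('a, 'c) module \<Rightarrow> 'c set \<Rightarrow> 'c set"
  where "submodule_span R N X = \<Inter>{H. submodule H R N \<and> X \<subseteq> H}"

definition simple_submodule :: "'c set \<Rightarrow> ('a, 'b) ring_scheme \<Rightarrow> ('a, 'c) module \<Rightarrow> bool"
  where "simple_submodule S R N \<longleftrightarrow>
    submodule S R N \<and> S \<noteq> {\<zero>\<^bsub>N\<^esub>} \<and>
    (\<forall>H. submodule H R N \<and> H \<subseteq> S \<longrightarrow> H = {\<zero>\<^bsub>N\<^esub>} \<or> H = S)"

definition socle :: "('a, 'b) ring_scheme \<Rightarrow> ('a, 'c) module \<Rightarrow> 'c set"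
  where "socle R N = submodule_span R N (\<Union>{S. simple_submodule S R N})"

definition semisimple_module :: "('a, 'b) ring_scheme \<Rightarrow> ('a, 'c) module \<Rightarrow> bool"
  where "semisimple_module R N \<longleftrightarrow> socle R N = carrier N"

definition small_submodule :: "'c set \<Rightarrow> ('a, 'b) ring_scheme \<Rightarrow> ('a, 'c) module \<Rightarrow> bool"
  where "small_submodule K R N \<longleftrightarrow>
    submodule K R N \<and>
    (\<forall>L. submodule L R N \<and> L \<noteq> carrier N \<longrightarrow> K <+>\<^bsub>N\<^esub> L \<noteq> carrier N)"

definition essential_submodule :: "'c set \<Rightarrow> ('a, 'b) ring_scheme \<Rightarrow> ('a, 'c) module \<Rightarrow> bool"
  where "essential_submodule E R N \<longleftrightarrow>
    submodule E R N \<and>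
    (\<forall>L. submodule L R N \<and> L \<noteq> {\<zero>\<^bsub>N\<^esub>} \<longrightarrow> E \<inter> L \<noteq> {\<zero>\<^bsub>N\<^esub>})"

definition countably_generated :: "'c set \<Rightarrow> ('a, 'b) ring_scheme \<Rightarrow> ('a, 'c) module \<Rightarrow> bool"
  where "countably_generated H R N \<longleftrightarrow>
    (\<exists>X. countable X \<and> X \<subseteq> carrier N \<and> H = submodule_span R N X)"

definition artinian_module :: "('a, 'b) ring_scheme \<Rightarrow> ('a, 'c) module \<Rightarrow> bool"
  where "artinian_module R N \<longleftrightarrow>
    (\<forall>H :: nat \<Rightarrow> 'c set.
       (\<forall>n. submodule (H n) R N) \<and> (\<forall>n. H (Suc n) \<subseteq> H n) \<longrightarrow> (\<exists>m. \<forall>n\<ge>m. H n = H m))"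

definition extends_to ::
    "('a, 'b) ring_scheme \<Rightarrow> 'c set \<Rightarrow> ('a, 'c) module \<Rightarrow> ('a, 'd) module \<Rightarrow> bool"
  where "extends_to R K N M \<longleftrightarrow>
    (\<forall>f \<in> right_hom R (N\<lparr>carrier := K\<rparr>) M. \<exists>g \<in> right_hom R N M. \<forall>x\<in>K. g x = f x)"

text \<open>
  A definition in HOL cannot quantify over all types, so a condition on all modules \<open>N\<close> refers to
  the modules with carrier in a type \<open>'u\<close>, which is made an explicit argument.
  The type \<open>('a, 'm) universe\<close> below is large enough for both conditions.

  For injectivity of \<open>R\<^sub>R\<close>, Baer's criterion only uses \<open>N = R\<^sub>R\<close>.

  For strong ss-injectivity let \<open>K\<close> be a semisimple small submodule of an arbitrary
  \<open>N\<close> and \<open>f : K \<rightarrow> R\<^sub>R\<close>. Dividing \<open>N\<close> by the kernel of \<open>f\<close> we may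
  assume that \<open>f\<close> is injective. The inclusion of \<open>K\<close> into its injective hull \<open>E(K)\<close> extends to
  \<open>N\<close>, and homomorphisms preserve small submodules, so \<open>K\<close> is small in \<open>E(K)\<close> and it suffices to
  extend \<open>f\<close> to \<open>E(K)\<close>. As \<open>K\<close> embeds into \<open>R\<^sub>R\<close>, the module \<open>E(K)\<close> embeds into every injective
  module containing \<open>R\<^sub>R\<close>, for instance into the group of additive maps from \<open>R\<close> to the
  divisible hull of \<open>(R, +)\<close>, which injects into \<open>('a \<times> nat) set\<close>.

  The variable \<open>'m\<close> lets the carriers come from any type whatsoever.
\<close>

type_synonym ('a, 'm) universe = "'m + ('a \<times> nat) set set"

definition injective_module ::
    "'u itself \<Rightarrow> ('a, 'b) ring_scheme \<Rightarrow> ('a, 'd) module \<Rightarrow> bool"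
  where "injective_module U R M \<longleftrightarrow>
    (\<forall>(N :: ('a, 'u) module) K. right_module R N \<and> submodule K R N \<longrightarrow> extends_to R K N M)"

definition strongly_right_ss_injective :: "'u itself \<Rightarrow> ('a, 'b) ring_scheme \<Rightarrow> bool"
  where "strongly_right_ss_injective U R \<longleftrightarrow>
    (\<forall>(N :: ('a, 'u) module) K.
       right_module R N \<and> small_submodule K R N \<and> semisimple_module R (N\<lparr>carrier := K\<rparr>) \<longrightarrow>
       extends_to R K N (right_regular R))"

definition right_artinian :: "('a, 'b) ring_scheme \<Rightarrow> bool"
  where "right_artinian R \<longleftrightarrow> artinian_module R (right_regular R)"

definition right_self_injective :: "'u itself \<Rightarrow> ('a, 'b) ring_scheme \<Rightarrow> bool"
  where "right_self_injective U R \<longleftrightarrow> injective_module U R (right_regular R)"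

definition quasi_frobenius :: "'u itself \<Rightarrow> ('a, 'b) ring_scheme \<Rightarrow> bool"
  where "quasi_frobenius U R \<longleftrightarrow>
    (right_artinian R \<or> right_artinian (opposite_ring R)) \<and>
    (right_self_injective U R \<or> right_self_injective U (opposite_ring R))"

definition maximal_right_ideal :: "'a set \<Rightarrow> ('a, 'b) ring_scheme \<Rightarrow> bool"
  where "maximal_right_ideal I R \<longleftrightarrow>
    right_ideal I R \<and> I \<noteq> carrier R \<and>
    (\<forall>H. right_ideal H R \<and> I \<subseteq> H \<longrightarrow> H = I \<or> H = carrier R)"

text \<open>The intersection with \<open>carrier R\<close> only matters for the zero ring.\<close>

definition jacobson_radical :: "('a, 'b) ring_scheme \<Rightarrow> 'a set"
  where "jacobson_radical R = carrier R \<inter> \<Inter>{I. maximal_right_ideal I R}"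

definition right_annihilator :: "('a, 'b) ring_scheme \<Rightarrow> 'a set \<Rightarrow> 'a set"
  where "right_annihilator R X = {a \<in> carrier R. \<forall>x\<in>X. x \<otimes>\<^bsub>R\<^esub> a = \<zero>\<^bsub>R\<^esub>}"

definition left_annihilator :: "('a, 'b) ring_scheme \<Rightarrow> 'a set \<Rightarrow> 'a set"
  where "left_annihilator R X = {a \<in> carrier R. \<forall>x\<in>X. a \<otimes>\<^bsub>R\<^esub> x = \<zero>\<^bsub>R\<^esub>}"

text \<open>\<open>left_product R x n = x\<^sub>n x\<^sub>n\<^sub>-\<^sub>1 \<cdots> x\<^sub>0\<close>; sequences are indexed from \<open>0\<close>.\<close>

primrec left_product :: "('a, 'b) ring_scheme \<Rightarrow> (nat \<Rightarrow> 'a) \<Rightarrow> nat \<Rightarrow> 'a"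
  where
    "left_product R x 0 = x 0"
  | "left_product R x (Suc n) = x (Suc n) \<otimes>\<^bsub>R\<^esub> left_product R x n"

end

theory Submission
  imports Defs
begin

text \<open>
  Write \<open>J\<close> for the radical, \<open>r\<close> and \<open>l\<close> for annihilators.

  A quasi-Frobenius ring or its opposite is right self-injective and artinian on one side. Such a ring
  satisfies \<open>r(l(T)) = T\<close> for right ideals \<open>T\<close>, because it is a Kasch ring. Together with
  \<open>l(r(L)) = L\<close> for finitely generated left ideals \<open>L\<close> and the Hopkins--Levitzki theorem this
  transfers all chain conditions to both sides, and Ikeda and Nakayama's argument then gives
  self-injectivity on the other side.

  Conversely, the chain condition excludes infinite sets of orthogonal idempotents, so homomorphisms from
  right ideals inside \<open>S\<^sub>r\<close> into \<open>R\<close> are left multiplications. Hence \<open>J = l(S\<^sub>r)\<close>, which is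
  T-nilpotent by the chain condition, and \<open>R/J\<close> is semisimple. In any module \<open>N\<close> the submodule
  \<open>N J\<close> is then small and \<open>N/N J\<close> is semisimple, so homomorphisms to \<open>R\<close> from any submodule of
  the socle of \<open>N\<close> extend to \<open>N\<close>. Since \<open>S\<^sub>r\<close> is essential, \<open>R\<close> is right self-injective.
  If \<open>J/J\<^sup>2\<close> were not finitely generated, a diagonal construction would produce an element of
  \<open>l(J\<^sup>2) \<cong> Hom(J/J\<^sup>2, R)\<close> (modulo \<open>l(J)\<close>) outside of a countable union of finitely
  generated left ideals. Hence \<open>J\<close> is finitely generated as a right ideal, and T-nilpotence makes \<open>R\<close>
  right artinian.
\<close>

text \<open>Quantification over modules is confined to a few places. Injectivity is carried as
  \<open>baer_injective\<close>, which mentions right ideals only and hence no universe; the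
  hypotheses on modules are applied to a copy of \<open>R\<close> and to one quotient of
  \<open>R \<oplus> R\<close>, both realised inside the universe. The ring \<open>R/J\<close> is
  replaced by congruences and by right ideals containing \<open>J\<close>.

  The obstacle in the converse is that ss-injectivity only sees small semisimple submodules while
  Baer's criterion asks about every right ideal \<open>T\<close>. A homomorphism on \<open>T\<close>
  is therefore not extended directly. It serves as gluing data for a module in which a copy of the
  socle is a semisimple submodule, and a map that is invertible modulo \<open>J\<close> suffices to
  read off the multiplier.

  The obstacle in the Kasch property is that no composition length is available: with
  \<open>S = l(J)\<close> the equality \<open>l(S) = J\<close> is direct, whereas
  \<open>r(S) = J\<close> needs an indirect argument with chains.

  The elements of \<open>l(J\<^sup>2)\<close> act on \<open>J/J\<^sup>2\<close> as its dual, so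
  finite generation is first proved modulo \<open>J\<^sup>2\<close>; T-nilpotence lifts the
  generators to \<open>J\<close>.\<close>

lemma opposite_ring_simps [simp]:
  "carrier (opposite_ring R) = carrier R" "zero (opposite_ring R) = zero R"
  "one (opposite_ring R) = one R" "add (opposite_ring R) = add R"
  "x \<otimes>\<^bsub>opposite_ring R\<^esub> y = y \<otimes>\<^bsub>R\<^esub> x" "opposite_ring (opposite_ring R) = R"
  by (simp_all add: opposite_ring_def)

lemma opposite_ring_minus [simp]:
  "a_inv (opposite_ring R) = a_inv R" "a_minus (opposite_ring R) = a_minus R"
  by (simp_all add: a_inv_def a_minus_def m_inv_def fun_eq_iff)

lemma right_regular_simps [simp]:
  "carrier (right_regular R) = carrier R" "zero (right_regular R) = zero R"
  "add (right_regular R) = add R" "r \<odot>\<^bsub>right_regular R\<^esub> x = x \<otimes>\<^bsub>R\<^esub> r"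
  by (simp_all add: right_regular_def)

lemma right_regular_minus [simp]:
  "a_inv (right_regular R) = a_inv R" "a_minus (right_regular R) = a_minus R"
  by (simp_all add: a_inv_def a_minus_def m_inv_def fun_eq_iff)

lemma (in abelian_group) minus_eq_zero_iff [simp]:
  assumes "x \<in> carrier G" "y \<in> carrier G"
  shows "x \<ominus> y = \<zero> \<longleftrightarrow> x = y"
  using assms by (metis a_minus_def a_inv_closed minus_equality minus_minus r_neg)

lemma (in abelian_group)
  assumes "x \<in> carrier G" "y \<in> carrier G"
  shows add_minus_cancel_right: "x \<oplus> y \<ominus> y = x"
    and add_minus_cancel_left: "y \<oplus> x \<ominus> y = x"
    and minus_add_cancel: "(x \<ominus> y) \<oplus> y = x"
  using assms by (simp_all add: a_minus_def a_assoc r_neg l_neg a_comm[of y x])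

text \<open>The left-handed theory consists of the right-handed facts instantiated at the opposite
  ring; this makes those instantiations possible.\<close>

lemma (in ring) ring_opposite: "ring (opposite_ring R)"
  by (rule ringI; (intro abelian_groupI monoidI)?)
    (auto simp: ring_simprules intro: a_assoc l_neg a_comm)

lemma (in ring) right_module_right_regular: "right_module R (right_regular R)"
proof -
  have "abelian_group (right_regular R)"
    by (rule abelian_groupI) (auto simp: ring_simprules intro: l_neg)
  then show ?thesis
    by (intro right_module.intro right_module_axioms.intro ring_axioms)
      (auto simp: ring_simprules)
qed

abbreviation left_ideal :: "'a set \<Rightarrow> ('a, 'b) ring_scheme \<Rightarrow> bool"
  where "left_ideal I R \<equiv> right_ideal I (opposite_ring R)"

abbreviation span :: "('a, 'b) ring_scheme \<Rightarrow> 'a set \<Rightarrow> 'a set"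
  where "span R \<equiv> submodule_span R (right_regular R)"

subsection \<open>Submodules\<close>

context right_module
begin

lemmas R_simprules = ring.ring_simprules[OF ring_axioms]
lemmas R_closed = ring.ring_simprules(1-6)[OF ring_axioms]

lemma smult_zero_left: "x \<in> carrier N \<Longrightarrow> \<zero>\<^bsub>R\<^esub> \<odot>\<^bsub>N\<^esub> x = \<zero>\<^bsub>N\<^esub>"
  using smult_ring_add[of "\<zero>\<^bsub>R\<^esub>" "\<zero>\<^bsub>R\<^esub>" x] smult_closed[of "\<zero>\<^bsub>R\<^esub>" x]
  by (simp add: N.add.r_cancel_one')

lemma smult_zero_right: "r \<in> carrier R \<Longrightarrow> r \<odot>\<^bsub>N\<^esub> \<zero>\<^bsub>N\<^esub> = \<zero>\<^bsub>N\<^esub>"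
  using smult_module_add[of r "\<zero>\<^bsub>N\<^esub>" "\<zero>\<^bsub>N\<^esub>"] smult_closed[of r "\<zero>\<^bsub>N\<^esub>"]
  by (simp add: N.add.r_cancel_one')

lemma smult_minus_left:
  assumes "r \<in> carrier R" "x \<in> carrier N"
  shows "(\<ominus>\<^bsub>R\<^esub> r) \<odot>\<^bsub>N\<^esub> x = \<ominus>\<^bsub>N\<^esub> (r \<odot>\<^bsub>N\<^esub> x)"
proof -
  have "(\<ominus>\<^bsub>R\<^esub> r) \<odot>\<^bsub>N\<^esub> x \<oplus>\<^bsub>N\<^esub> r \<odot>\<^bsub>N\<^esub> x = \<zero>\<^bsub>N\<^esub>"
    using assms smult_ring_add[of "\<ominus>\<^bsub>R\<^esub> r" r x] by (simp add: R_simprules smult_zero_left)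
  then show ?thesis
    using assms by (intro N.minus_equality[symmetric]) (auto intro: smult_closed R_simprules)
qed

text \<open>Negatives are covered because \<open>\<ominus> x\<close> is the action of
  \<open>\<ominus> \<one>\<close> on \<open>x\<close>.\<close>

lemma submoduleI:
  assumes "H \<subseteq> carrier N" "\<zero>\<^bsub>N\<^esub> \<in> H"
    and "\<And>x y. \<lbrakk>x \<in> H; y \<in> H\<rbrakk> \<Longrightarrow> x \<oplus>\<^bsub>N\<^esub> y \<in> H"
    and smult: "\<And>r x. \<lbrakk>r \<in> carrier R; x \<in> H\<rbrakk> \<Longrightarrow> r \<odot>\<^bsub>N\<^esub> x \<in> H"
  shows "submodule H R N"
proof -
  have "\<ominus>\<^bsub>N\<^esub> x \<in> H" if "x \<in> H" for x
    using that smult[of "\<ominus>\<^bsub>R\<^esub> \<one>\<^bsub>R\<^esub>" x] assms(1) by (auto simp: smult_minus_left smult_unit subset_iff)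
  then show ?thesis
    using assms
    by (intro submodule.intro submodule_axioms.intro subgroup.intro)
      (auto simp: a_inv_def)
qed

lemma
  assumes "submodule H R N"
  shows submodule_carrier: "H \<subseteq> carrier N"
    and submodule_zero: "\<zero>\<^bsub>N\<^esub> \<in> H"
    and submodule_add: "\<And>x y. \<lbrakk>x \<in> H; y \<in> H\<rbrakk> \<Longrightarrow> x \<oplus>\<^bsub>N\<^esub> y \<in> H"
    and submodule_smult: "\<And>r x. \<lbrakk>r \<in> carrier R; x \<in> H\<rbrakk> \<Longrightarrow> r \<odot>\<^bsub>N\<^esub> x \<in> H"
    and submodule_minus: "\<And>x. x \<in> H \<Longrightarrow> \<ominus>\<^bsub>N\<^esub> x \<in> H"
    and submodule_diff: "\<And>x y. \<lbrakk>x \<in> H; y \<in> H\<rbrakk> \<Longrightarrow> x \<ominus>\<^bsub>N\<^esub> y \<in> H"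
proof -
  interpret H: submodule H R N by fact
  show "H \<subseteq> carrier N" "\<zero>\<^bsub>N\<^esub> \<in> H"
    using H.subset H.one_closed by auto
  show add: "x \<oplus>\<^bsub>N\<^esub> y \<in> H" if "x \<in> H" "y \<in> H" for x y
    using H.m_closed[OF that] by simp
  show "r \<odot>\<^bsub>N\<^esub> x \<in> H" if "r \<in> carrier R" "x \<in> H" for r x
    using that by simp
  show neg: "\<ominus>\<^bsub>N\<^esub> x \<in> H" if "x \<in> H" for x
    using H.m_inv_closed[OF that] by (simp add: a_inv_def)
  show "x \<ominus>\<^bsub>N\<^esub> y \<in> H" if "x \<in> H" "y \<in> H" for x y
    using add neg that by (simp add: a_minus_def)
qed

lemma submodule_of_carrier: "submodule (carrier N) R N"
  by (rule submoduleI) (auto intro: smult_closed)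

lemma submodule_of_zero: "submodule {\<zero>\<^bsub>N\<^esub>} R N"
  by (rule submoduleI) (auto simp: smult_zero_right)

lemma submodule_Inter:
  assumes "\<H> \<noteq> {}" "\<And>H. H \<in> \<H> \<Longrightarrow> submodule H R N"
  shows "submodule (\<Inter>\<H>) R N"
proof (rule submoduleI)
  show "\<Inter>\<H> \<subseteq> carrier N" using assms submodule_carrier by blast
  show "\<zero>\<^bsub>N\<^esub> \<in> \<Inter>\<H>" using assms(2) submodule_zero by auto
  show "x \<oplus>\<^bsub>N\<^esub> y \<in> \<Inter>\<H>" if "x \<in> \<Inter>\<H>" "y \<in> \<Inter>\<H>" for x y
    using that assms(2) submodule_add by auto
  show "r \<odot>\<^bsub>N\<^esub> x \<in> \<Inter>\<H>" if "r \<in> carrier R" "x \<in> \<Inter>\<H>" for r x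
    using that assms(2) submodule_smult by auto
qed

lemma submodule_Int: "submodule H R N \<Longrightarrow> submodule K R N \<Longrightarrow> submodule (H \<inter> K) R N"
  using submodule_Inter[of "{H, K}"] by auto

lemma submodule_Union_chain:
  assumes "\<H> \<noteq> {}" "\<And>H. H \<in> \<H> \<Longrightarrow> submodule H R N"
    and chain: "\<And>H K. H \<in> \<H> \<Longrightarrow> K \<in> \<H> \<Longrightarrow> \<exists>L\<in>\<H>. H \<subseteq> L \<and> K \<subseteq> L"
  shows "submodule (\<Union>\<H>) R N"
proof (rule submoduleI)
  show "x \<oplus>\<^bsub>N\<^esub> y \<in> \<Union>\<H>" if xy: "x \<in> \<Union>\<H>" "y \<in> \<Union>\<H>" for x y
  proof -
    obtain H K where "H \<in> \<H>" "K \<in> \<H>" "x \<in> H" "y \<in> K" using xy by blast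
    then obtain L where "L \<in> \<H>" "x \<in> L" "y \<in> L" using chain by blast
    then show ?thesis using assms(2) submodule_add by blast
  qed
  show "\<Union>\<H> \<subseteq> carrier N" using assms(2) submodule_carrier by blast
  show "\<zero>\<^bsub>N\<^esub> \<in> \<Union>\<H>" using assms(1,2) submodule_zero by auto
  show "r \<odot>\<^bsub>N\<^esub> x \<in> \<Union>\<H>" if "r \<in> carrier R" "x \<in> \<Union>\<H>" for r x
    using that assms(2) submodule_smult by (meson UnionE UnionI)
qed

lemma submodule_UN_mono:
  fixes H :: "nat \<Rightarrow> 'c set"
  assumes "\<And>n. submodule (H n) R N" "mono H"
  shows "submodule (\<Union>n. H n) R N"
proof (rule submodule_Union_chain)
  show "\<exists>L\<in>range H. A \<subseteq> L \<and> B \<subseteq> L" if "A \<in> range H" "B \<in> range H" for A B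
  proof -
    obtain i j where "A = H i" "B = H j" using \<open>A \<in> range H\<close> \<open>B \<in> range H\<close> by blast
    then have "A \<subseteq> H (max i j)" "B \<subseteq> H (max i j)" using monoD[OF assms(2)] by auto
    then show ?thesis by blast
  qed
qed (use assms in auto)

lemma mem_sum_iff: "x \<in> H <+>\<^bsub>N\<^esub> K \<longleftrightarrow> (\<exists>h\<in>H. \<exists>k\<in>K. x = h \<oplus>\<^bsub>N\<^esub> k)"
  by (auto simp: set_add_def')

lemma submodule_sum:
  assumes H: "submodule H R N" and K: "submodule K R N"
  shows "submodule (H <+>\<^bsub>N\<^esub> K) R N"
proof (rule submoduleI)
  note c = subsetD[OF submodule_carrier[OF H]] subsetD[OF submodule_carrier[OF K]]
  show "H <+>\<^bsub>N\<^esub> K \<subseteq> carrier N" using c by (auto simp: mem_sum_iff)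
  show "\<zero>\<^bsub>N\<^esub> \<in> H <+>\<^bsub>N\<^esub> K"
    using submodule_zero[OF H] submodule_zero[OF K] by (force simp: mem_sum_iff)
  show "x \<oplus>\<^bsub>N\<^esub> y \<in> H <+>\<^bsub>N\<^esub> K" if xy: "x \<in> H <+>\<^bsub>N\<^esub> K" "y \<in> H <+>\<^bsub>N\<^esub> K" for x y
  proof -
    obtain h k h' k' where e: "h \<in> H" "k \<in> K" "x = h \<oplus>\<^bsub>N\<^esub> k" "h' \<in> H" "k' \<in> K" "y = h' \<oplus>\<^bsub>N\<^esub> k'"
      using xy by (auto simp: mem_sum_iff)
    then have "x \<oplus>\<^bsub>N\<^esub> y = (h \<oplus>\<^bsub>N\<^esub> h') \<oplus>\<^bsub>N\<^esub> (k \<oplus>\<^bsub>N\<^esub> k')"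
      using c by (simp add: N.a_ac)
    then show ?thesis using e submodule_add[OF H] submodule_add[OF K] unfolding mem_sum_iff by blast
  qed
  show "r \<odot>\<^bsub>N\<^esub> x \<in> H <+>\<^bsub>N\<^esub> K" if r: "r \<in> carrier R" and x: "x \<in> H <+>\<^bsub>N\<^esub> K" for r x
  proof -
    obtain h k where "h \<in> H" "k \<in> K" "x = h \<oplus>\<^bsub>N\<^esub> k" using x by (auto simp: mem_sum_iff)
    then show ?thesis using r smult_module_add c submodule_smult[OF H] submodule_smult[OF K]
      unfolding mem_sum_iff by metis
  qed
qed

lemma sum_upper:
  assumes H: "submodule H R N" and K: "submodule K R N"
  shows "H \<subseteq> H <+>\<^bsub>N\<^esub> K" "K \<subseteq> H <+>\<^bsub>N\<^esub> K"
proof -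
  have "h \<in> H <+>\<^bsub>N\<^esub> K" if "h \<in> H" for h
    unfolding mem_sum_iff using that submodule_zero[OF K] submodule_carrier[OF H]
    by (intro bexI[of _ h] bexI[of _ "\<zero>\<^bsub>N\<^esub>"]) (auto simp: subset_iff)
  then show "H \<subseteq> H <+>\<^bsub>N\<^esub> K" by blast
  have "k \<in> H <+>\<^bsub>N\<^esub> K" if "k \<in> K" for k
    unfolding mem_sum_iff using that submodule_zero[OF H] submodule_carrier[OF K]
    by (intro bexI[of _ "\<zero>\<^bsub>N\<^esub>"] bexI[of _ k]) (auto simp: subset_iff)
  then show "K \<subseteq> H <+>\<^bsub>N\<^esub> K" by blast
qed

lemma sum_least:
  assumes "submodule L R N" "H \<subseteq> L" "K \<subseteq> L"
  shows "H <+>\<^bsub>N\<^esub> K \<subseteq> L"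
  using assms(2,3) submodule_add[OF assms(1)] by (auto simp: mem_sum_iff subset_iff)

lemma submodule_span_submodule: "X \<subseteq> carrier N \<Longrightarrow> submodule (submodule_span R N X) R N"
  unfolding submodule_span_def using submodule_of_carrier by (intro submodule_Inter) auto

lemma span_upper: "X \<subseteq> submodule_span R N X"
  by (auto simp: submodule_span_def)

lemma span_least: "submodule H R N \<Longrightarrow> X \<subseteq> H \<Longrightarrow> submodule_span R N X \<subseteq> H"
  by (auto simp: submodule_span_def)

lemma span_mono: "X \<subseteq> Y \<Longrightarrow> submodule_span R N X \<subseteq> submodule_span R N Y"
  by (auto simp: submodule_span_def)

definition cyclic :: "'c \<Rightarrow> 'c set"
  where "cyclic x = {r \<odot>\<^bsub>N\<^esub> x | r. r \<in> carrier R}"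

lemma submodule_cyclic:
  assumes x: "x \<in> carrier N"
  shows "submodule (cyclic x) R N"
proof (rule submoduleI)
  show "\<zero>\<^bsub>N\<^esub> \<in> cyclic x" unfolding cyclic_def using smult_zero_left[OF x] zero_closed by force
  show "y \<oplus>\<^bsub>N\<^esub> z \<in> cyclic x" if yz: "y \<in> cyclic x" "z \<in> cyclic x" for y z
  proof -
    obtain r s where "r \<in> carrier R" "s \<in> carrier R" "y = r \<odot>\<^bsub>N\<^esub> x" "z = s \<odot>\<^bsub>N\<^esub> x"
      using yz by (auto simp: cyclic_def)
    then have "y \<oplus>\<^bsub>N\<^esub> z = (r \<oplus>\<^bsub>R\<^esub> s) \<odot>\<^bsub>N\<^esub> x" "r \<oplus>\<^bsub>R\<^esub> s \<in> carrier R"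
      using x by (auto simp: smult_ring_add R_simprules)
    then show ?thesis unfolding cyclic_def by blast
  qed
  show "r \<odot>\<^bsub>N\<^esub> y \<in> cyclic x" if r: "r \<in> carrier R" and y: "y \<in> cyclic x" for r y
  proof -
    obtain s where "s \<in> carrier R" "y = s \<odot>\<^bsub>N\<^esub> x"
      using y by (auto simp: cyclic_def)
    then have "r \<odot>\<^bsub>N\<^esub> y = (s \<otimes>\<^bsub>R\<^esub> r) \<odot>\<^bsub>N\<^esub> x" "s \<otimes>\<^bsub>R\<^esub> r \<in> carrier R"
      using x r by (auto simp: smult_assoc)
    then show ?thesis unfolding cyclic_def by blast
  qed
qed (use smult_closed x in \<open>auto simp: cyclic_def\<close>)

lemma cyclic_self: "x \<in> carrier N \<Longrightarrow> x \<in> cyclic x"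
  unfolding cyclic_def using smult_unit one_closed by force

lemma right_module_restrict:
  assumes H: "submodule H R N"
  shows "right_module R (N\<lparr>carrier := H\<rparr>)"
proof -
  note c = subsetD[OF submodule_carrier[OF H]]
  have "abelian_group (N\<lparr>carrier := H\<rparr>)"
  proof (rule abelian_groupI)
    show "\<exists>y\<in>carrier (N\<lparr>carrier := H\<rparr>). y \<oplus>\<^bsub>N\<lparr>carrier := H\<rparr>\<^esub> x = \<zero>\<^bsub>N\<lparr>carrier := H\<rparr>\<^esub>"
      if "x \<in> carrier (N\<lparr>carrier := H\<rparr>)" for x
      using that submodule_minus[OF H] c N.l_neg by auto
  qed (use c submodule_add[OF H] submodule_zero[OF H] in \<open>auto simp: N.a_ac\<close>)
  then show ?thesis
    using submodule_smult[OF H] c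
    by (intro right_module.intro right_module_axioms.intro ring_axioms)
      (auto simp: smult_ring_add smult_module_add smult_assoc smult_unit)
qed

lemma submodule_restrict_iff:
  assumes H: "submodule H R N"
  shows "submodule K R (N\<lparr>carrier := H\<rparr>) \<longleftrightarrow> submodule K R N \<and> K \<subseteq> H"
proof -
  interpret H: right_module R "N\<lparr>carrier := H\<rparr>" by (rule right_module_restrict[OF H])
  show ?thesis
  proof
    assume K: "submodule K R (N\<lparr>carrier := H\<rparr>)"
    have "K \<subseteq> H" using H.submodule_carrier[OF K] by simp
    moreover have "submodule K R N"
      using \<open>K \<subseteq> H\<close> submodule_carrier[OF H] H.submodule_zero[OF K] H.submodule_add[OF K]
        H.submodule_smult[OF K] by (intro submoduleI) auto
    ultimately show "submodule K R N \<and> K \<subseteq> H" by blast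
  next
    assume "submodule K R N \<and> K \<subseteq> H"
    then show "submodule K R (N\<lparr>carrier := H\<rparr>)"
      using submodule_zero[of K] submodule_add[of K] submodule_smult[of K]
      by (intro H.submoduleI) auto
  qed
qed

text \<open>Zorn's lemma in a form that serves three purposes: \<open>X = {\<one>}\<close> gives
  maximal right ideals, the nonzero elements over \<open>\<zero>\<close> in a direct sum give
  maximal partial homomorphisms, and a submodule as \<open>X\<close> gives relative
  complements.\<close>

lemma maximal_submodule_exists:
  assumes H: "submodule H R N" and X: "H \<inter> X \<subseteq> H0"
  shows "\<exists>B. submodule B R N \<and> H \<subseteq> B \<and> B \<inter> X \<subseteq> H0 \<and>
    (\<forall>C. submodule C R N \<longrightarrow> B \<subseteq> C \<longrightarrow> C \<inter> X \<subseteq> H0 \<longrightarrow> C = B)"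
proof -
  let ?A = "{B. submodule B R N \<and> H \<subseteq> B \<and> B \<inter> X \<subseteq> H0}"
  have "\<exists>M\<in>?A. \<forall>Y\<in>?A. M \<subseteq> Y \<longrightarrow> Y = M"
  proof (rule subset_Zorn_nonempty)
    show "?A \<noteq> {}" using H X by blast
    show "\<Union>\<C> \<in> ?A" if C: "\<C> \<noteq> {}" "subset.chain ?A \<C>" for \<C>
    proof -
      have sub: "\<And>Y. Y \<in> \<C> \<Longrightarrow> submodule Y R N \<and> H \<subseteq> Y \<and> Y \<inter> X \<subseteq> H0"
        and ch: "\<And>Y Z. Y \<in> \<C> \<Longrightarrow> Z \<in> \<C> \<Longrightarrow> Y \<subseteq> Z \<or> Z \<subseteq> Y"
        using C(2) unfolding subset_chain_def by blast+
      have "submodule (\<Union>\<C>) R N"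
      proof (rule submodule_Union_chain)
        show "\<exists>L\<in>\<C>. Y \<subseteq> L \<and> Z \<subseteq> L" if "Y \<in> \<C>" "Z \<in> \<C>" for Y Z
          using ch[OF that] that by blast
      qed (use C(1) sub in auto)
      moreover have "H \<subseteq> \<Union>\<C>" "\<Union>\<C> \<inter> X \<subseteq> H0" using C(1) sub by blast+
      ultimately show ?thesis by blast
    qed
  qed
  then obtain B where B: "B \<in> ?A" "\<forall>Y\<in>?A. B \<subseteq> Y \<longrightarrow> Y = B" by blast
  then have "\<forall>C. submodule C R N \<longrightarrow> B \<subseteq> C \<longrightarrow> C \<inter> X \<subseteq> H0 \<longrightarrow> C = B" by auto
  then show ?thesis using B(1) by auto
qed

end

subsection \<open>Homomorphisms and graphs\<close>

lemma right_hom_iff: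
  "f \<in> right_hom R N M \<longleftrightarrow>
    (\<forall>x\<in>carrier N. f x \<in> carrier M) \<and>
    (\<forall>x\<in>carrier N. \<forall>y\<in>carrier N. f (x \<oplus>\<^bsub>N\<^esub> y) = f x \<oplus>\<^bsub>M\<^esub> f y) \<and>
    (\<forall>r\<in>carrier R. \<forall>x\<in>carrier N. f (r \<odot>\<^bsub>N\<^esub> x) = r \<odot>\<^bsub>M\<^esub> f x)"
  by (auto simp: right_hom_def hom_def)

lemma
  assumes "f \<in> right_hom R N M"
  shows right_hom_closed: "\<And>x. x \<in> carrier N \<Longrightarrow> f x \<in> carrier M"
    and right_hom_add: "\<And>x y. \<lbrakk>x \<in> carrier N; y \<in> carrier N\<rbrakk> \<Longrightarrow> f (x \<oplus>\<^bsub>N\<^esub> y) = f x \<oplus>\<^bsub>M\<^esub> f y"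
    and right_hom_smult: "\<And>r x. \<lbrakk>r \<in> carrier R; x \<in> carrier N\<rbrakk> \<Longrightarrow> f (r \<odot>\<^bsub>N\<^esub> x) = r \<odot>\<^bsub>M\<^esub> f x"
  using assms by (auto simp: right_hom_iff)

lemma right_hom_restrict:
  "f \<in> right_hom R N M \<Longrightarrow> K \<subseteq> carrier N \<Longrightarrow> f \<in> right_hom R (N\<lparr>carrier := K\<rparr>) M"
  by (auto simp: right_hom_iff subset_iff)

lemma right_hom_zero:
  assumes "right_module R N" "right_module R M" "f \<in> right_hom R N M"
  shows "f \<zero>\<^bsub>N\<^esub> = \<zero>\<^bsub>M\<^esub>"
proof -
  interpret N: right_module R N by fact
  interpret M: right_module R M by fact
  have "f (\<zero>\<^bsub>R\<^esub> \<odot>\<^bsub>N\<^esub> \<zero>\<^bsub>N\<^esub>) = \<zero>\<^bsub>R\<^esub> \<odot>\<^bsub>M\<^esub> f \<zero>\<^bsub>N\<^esub>"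
    using right_hom_smult[OF assms(3)] by (simp add: N.R_simprules)
  then show ?thesis
    using right_hom_closed[OF assms(3), of "\<zero>\<^bsub>N\<^esub>"] by (simp add: N.smult_zero_left M.smult_zero_left)
qed

definition module_sum :: "('a, 'c) module \<Rightarrow> ('a, 'd) module \<Rightarrow> ('a, 'c \<times> 'd) module"
  where "module_sum N M =
    \<lparr>carrier = carrier N \<times> carrier M, mult = undefined, one = undefined, zero = (\<zero>\<^bsub>N\<^esub>, \<zero>\<^bsub>M\<^esub>),
     add = (\<lambda>p q. (fst p \<oplus>\<^bsub>N\<^esub> fst q, snd p \<oplus>\<^bsub>M\<^esub> snd q)),
     smult = (\<lambda>r p. (r \<odot>\<^bsub>N\<^esub> fst p, r \<odot>\<^bsub>M\<^esub> snd p))\<rparr>"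

lemma module_sum_simps [simp]:
  "carrier (module_sum N M) = carrier N \<times> carrier M"
  "zero (module_sum N M) = (\<zero>\<^bsub>N\<^esub>, \<zero>\<^bsub>M\<^esub>)"
  "p \<oplus>\<^bsub>module_sum N M\<^esub> q = (fst p \<oplus>\<^bsub>N\<^esub> fst q, snd p \<oplus>\<^bsub>M\<^esub> snd q)"
  "r \<odot>\<^bsub>module_sum N M\<^esub> p = (r \<odot>\<^bsub>N\<^esub> fst p, r \<odot>\<^bsub>M\<^esub> snd p)"
  by (simp_all add: module_sum_def)

lemma right_module_sum:
  assumes "right_module R N" "right_module R M"
  shows "right_module R (module_sum N M)"
proof -
  interpret N: right_module R N by fact
  interpret M: right_module R M by fact
  have "abelian_group (module_sum N M)"
  proof (rule abelian_groupI)
    show "\<exists>y\<in>carrier (module_sum N M). y \<oplus>\<^bsub>module_sum N M\<^esub> x = \<zero>\<^bsub>module_sum N M\<^esub>"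
      if "x \<in> carrier (module_sum N M)" for x
      using that N.N.l_neg M.N.l_neg
      by (intro bexI[of _ "(\<ominus>\<^bsub>N\<^esub> fst x, \<ominus>\<^bsub>M\<^esub> snd x)"]) auto
  qed (auto simp: N.N.a_ac M.N.a_ac)
  then show ?thesis
    by (intro right_module.intro right_module_axioms.intro N.ring_axioms)
      (auto simp: N.smult_closed M.smult_closed N.smult_ring_add M.smult_ring_add N.smult_module_add
        M.smult_module_add N.smult_assoc M.smult_assoc N.smult_unit M.smult_unit)
qed

lemma module_sum_minus:
  assumes "right_module R N" "right_module R M" "p \<in> carrier (module_sum N M)" "q \<in> carrier (module_sum N M)"
  shows "p \<ominus>\<^bsub>module_sum N M\<^esub> q = (fst p \<ominus>\<^bsub>N\<^esub> fst q, snd p \<ominus>\<^bsub>M\<^esub> snd q)"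
proof -
  interpret N: right_module R N by fact
  interpret M: right_module R M by fact
  interpret S: right_module R "module_sum N M" by (rule right_module_sum) fact+
  have "\<ominus>\<^bsub>module_sum N M\<^esub> q = (\<ominus>\<^bsub>N\<^esub> fst q, \<ominus>\<^bsub>M\<^esub> snd q)"
    using assms(4) by (intro S.N.minus_equality) (auto simp: N.N.l_neg M.N.l_neg)
  then show ?thesis by (simp add: a_minus_def)
qed

text \<open>Building a homomorphism as a submodule of the direct sum reduces well-definedness to the
  fibre over zero, since two values at one point differ by an element of that fibre. On a sum
  \<open>A + B\<close> the values can thus be prescribed without choosing decompositions.\<close>

lemma hom_of_graph:
  assumes "right_module R N" "right_module R M"
    and G: "submodule G R (module_sum N M)" and fn: "\<And>y. (\<zero>\<^bsub>N\<^esub>, y) \<in> G \<Longrightarrow> y = \<zero>\<^bsub>M\<^esub>"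
  shows "submodule (fst ` G) R N"
    and "\<exists>f. f \<in> right_hom R (N\<lparr>carrier := fst ` G\<rparr>) M \<and> (\<forall>x y. (x, y) \<in> G \<longrightarrow> f x = y)"
proof -
  interpret N: right_module R N by fact
  interpret M: right_module R M by fact
  interpret S: right_module R "module_sum N M" by (rule right_module_sum) fact+
  have c: "x \<in> carrier N" "y \<in> carrier M" if "(x, y) \<in> G" for x y
    using S.submodule_carrier[OF G] that by auto
  have add: "(x \<oplus>\<^bsub>N\<^esub> x', y \<oplus>\<^bsub>M\<^esub> y') \<in> G" if "(x, y) \<in> G" "(x', y') \<in> G" for x y x' y'
    using S.submodule_add[OF G that] by simp
  have smult: "(r \<odot>\<^bsub>N\<^esub> x, r \<odot>\<^bsub>M\<^esub> y) \<in> G" if "r \<in> carrier R" "(x, y) \<in> G" for r x y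
    using S.submodule_smult[OF G that] by simp
  have uniq: "y = y'" if "(x, y) \<in> G" "(x, y') \<in> G" for x y y'
  proof -
    have "\<ominus>\<^bsub>R\<^esub> \<one>\<^bsub>R\<^esub> \<in> carrier R" by (simp add: N.R_simprules)
    then have "(\<zero>\<^bsub>N\<^esub>, y \<oplus>\<^bsub>M\<^esub> \<ominus>\<^bsub>M\<^esub> y') \<in> G"
      using add[OF that(1) smult[OF _ that(2)], of "\<ominus>\<^bsub>R\<^esub> \<one>\<^bsub>R\<^esub>"] c[OF that(1)] c[OF that(2)]
      by (simp add: N.smult_minus_left M.smult_minus_left N.smult_unit M.smult_unit N.N.r_neg N.R_simprules)
    then have "y \<oplus>\<^bsub>M\<^esub> \<ominus>\<^bsub>M\<^esub> y' = \<zero>\<^bsub>M\<^esub>" by (rule fn)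
    then show ?thesis using c[OF that(1)] c[OF that(2)]
      by (metis M.N.a_inv_closed M.N.minus_equality M.N.minus_minus)
  qed
  define f where "f x = (THE y. (x, y) \<in> G)" for x
  have f: "f x = y" if "(x, y) \<in> G" for x y
    unfolding f_def using that uniq by (intro the_equality) auto
  show "submodule (fst ` G) R N"
  proof (rule N.submoduleI)
    show "fst ` G \<subseteq> carrier N" using c by auto
    show "\<zero>\<^bsub>N\<^esub> \<in> fst ` G" using S.submodule_zero[OF G] by force
    show "x \<oplus>\<^bsub>N\<^esub> y \<in> fst ` G" if "x \<in> fst ` G" "y \<in> fst ` G" for x y
      using that add by force
    show "r \<odot>\<^bsub>N\<^esub> x \<in> fst ` G" if "r \<in> carrier R" "x \<in> fst ` G" for r x
      using that smult by force
  qed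
  have "f \<in> right_hom R (N\<lparr>carrier := fst ` G\<rparr>) M"
    unfolding right_hom_iff using f add smult c by fastforce
  then show "\<exists>f. f \<in> right_hom R (N\<lparr>carrier := fst ` G\<rparr>) M \<and> (\<forall>x y. (x, y) \<in> G \<longrightarrow> f x = y)"
    using f by blast
qed

lemma submodule_graph:
  assumes "right_module R N" "right_module R M" and K: "submodule K R N"
    and f: "f \<in> right_hom R (N\<lparr>carrier := K\<rparr>) M"
  shows "submodule {(x, f x) | x. x \<in> K} R (module_sum N M)"
proof -
  interpret N: right_module R N by fact
  interpret M: right_module R M by fact
  interpret S: right_module R "module_sum N M" by (rule right_module_sum) fact+
  have "f \<zero>\<^bsub>N\<^esub> = \<zero>\<^bsub>M\<^esub>"
    using right_hom_zero[OF N.right_module_restrict[OF K] assms(2) f] by simp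
  then show ?thesis
    using N.submodule_carrier[OF K] N.submodule_zero[OF K] N.submodule_add[OF K] N.submodule_smult[OF K]
      right_hom_closed[OF f] right_hom_add[OF f] right_hom_smult[OF f]
    by (intro S.submoduleI) auto
qed

subsection \<open>Images of modules in other types\<close>

text \<open>
  The quotient of \<open>N\<close> by a submodule, realised in an arbitrary type: \<open>q\<close> is any map that identifies
  two elements exactly if they are congruent.
\<close>

definition image_module :: "('c \<Rightarrow> 'u) \<Rightarrow> ('a, 'c) module \<Rightarrow> ('a, 'u) module"
  where "image_module q N =
    \<lparr>carrier = q ` carrier N, mult = undefined, one = undefined, zero = q \<zero>\<^bsub>N\<^esub>,
     add = (\<lambda>X Y. q (inv_into (carrier N) q X \<oplus>\<^bsub>N\<^esub> inv_into (carrier N) q Y)),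
     smult = (\<lambda>r X. q (r \<odot>\<^bsub>N\<^esub> inv_into (carrier N) q X))\<rparr>"

text \<open>The operations of \<open>image_module\<close> use representatives picked by
  \<open>inv_into\<close>. These differ from the given ones by elements of \<open>H\<close>, hence
  so do sums and multiples, and \<open>q\<close> does not see the difference.\<close>

lemma
  assumes "right_module R N" and H: "submodule H R N"
    and q: "\<And>x y. \<lbrakk>x \<in> carrier N; y \<in> carrier N\<rbrakk> \<Longrightarrow> q x = q y \<longleftrightarrow> x \<ominus>\<^bsub>N\<^esub> y \<in> H"
  shows right_module_image: "right_module R (image_module q N)"
    and right_hom_image: "q \<in> right_hom R N (image_module q N)"
proof -
  interpret N: right_module R N by fact
  let ?i = "inv_into (carrier N) q" and ?M = "image_module q N"
  have carrier: "carrier ?M = q ` carrier N" and zero: "\<zero>\<^bsub>?M\<^esub> = q \<zero>\<^bsub>N\<^esub>"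
    by (simp_all add: image_module_def)
  have i: "?i (q x) \<in> carrier N" "?i (q x) \<ominus>\<^bsub>N\<^esub> x \<in> H" if "x \<in> carrier N" for x
  proof -
    show *: "?i (q x) \<in> carrier N" using that by (simp add: inv_into_into)
    show "?i (q x) \<ominus>\<^bsub>N\<^esub> x \<in> H"
      using that q[OF * that] by (simp add: f_inv_into_f)
  qed
  have add: "q x \<oplus>\<^bsub>?M\<^esub> q y = q (x \<oplus>\<^bsub>N\<^esub> y)" if xy: "x \<in> carrier N" "y \<in> carrier N" for x y
  proof -
    have "(?i (q x) \<oplus>\<^bsub>N\<^esub> ?i (q y)) \<ominus>\<^bsub>N\<^esub> (x \<oplus>\<^bsub>N\<^esub> y) = (?i (q x) \<ominus>\<^bsub>N\<^esub> x) \<oplus>\<^bsub>N\<^esub> (?i (q y) \<ominus>\<^bsub>N\<^esub> y)"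
      using i xy by (simp add: a_minus_def N.N.minus_add N.N.a_ac)
    then have "q (?i (q x) \<oplus>\<^bsub>N\<^esub> ?i (q y)) = q (x \<oplus>\<^bsub>N\<^esub> y)"
      using i xy N.submodule_add[OF H] by (subst q) auto
    then show ?thesis by (simp add: image_module_def)
  qed
  have smult: "r \<odot>\<^bsub>?M\<^esub> q x = q (r \<odot>\<^bsub>N\<^esub> x)" if r: "r \<in> carrier R" and x: "x \<in> carrier N" for r x
  proof -
    have "r \<odot>\<^bsub>N\<^esub> (\<ominus>\<^bsub>N\<^esub> x) = \<ominus>\<^bsub>N\<^esub> (r \<odot>\<^bsub>N\<^esub> x)"
      using r x by (metis N.N.a_inv_closed N.N.minus_equality N.N.l_neg N.smult_closed N.smult_module_add N.smult_zero_right)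
    then have "r \<odot>\<^bsub>N\<^esub> ?i (q x) \<ominus>\<^bsub>N\<^esub> r \<odot>\<^bsub>N\<^esub> x = r \<odot>\<^bsub>N\<^esub> (?i (q x) \<ominus>\<^bsub>N\<^esub> x)"
      using i x r by (simp add: a_minus_def N.smult_module_add)
    then have "q (r \<odot>\<^bsub>N\<^esub> ?i (q x)) = q (r \<odot>\<^bsub>N\<^esub> x)"
      using i x r N.submodule_smult[OF H] N.smult_closed by (subst q) auto
    then show ?thesis by (simp add: image_module_def)
  qed
  have "abelian_group ?M"
  proof (rule abelian_groupI)
    show "\<exists>Y\<in>carrier ?M. Y \<oplus>\<^bsub>?M\<^esub> X = \<zero>\<^bsub>?M\<^esub>" if "X \<in> carrier ?M" for X
    proof -
      obtain x where x: "x \<in> carrier N" "X = q x" using \<open>X \<in> carrier ?M\<close> carrier by auto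
      have "q (\<ominus>\<^bsub>N\<^esub> x) \<oplus>\<^bsub>?M\<^esub> X = \<zero>\<^bsub>?M\<^esub>" using x by (simp add: add zero N.N.l_neg)
      then show ?thesis using x carrier by (intro bexI[of _ "q (\<ominus>\<^bsub>N\<^esub> x)"]) auto
    qed
  qed (auto simp: carrier zero add N.N.a_ac intro: imageI)
  then show "right_module R ?M"
    by (intro right_module.intro right_module_axioms.intro N.ring_axioms)
      (auto simp: carrier add smult N.smult_closed N.smult_ring_add N.smult_module_add
        N.smult_assoc N.smult_unit N.R_simprules intro: imageI)
  show "q \<in> right_hom R N ?M"
    by (auto simp: right_hom_iff carrier add smult)
qed

subsection \<open>One-sided ideals\<close>

lemma set_add_right_regular [simp]: "set_add (right_regular R) = set_add R"
  by (simp add: fun_eq_iff set_add_def')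

lemma set_add_opposite [simp]: "set_add (opposite_ring R) = set_add R"
  by (simp add: fun_eq_iff set_add_def')

context ring
begin

lemmas right_idealI = right_module.submoduleI[OF right_module_right_regular, simplified]
lemmas right_ideal_carrier = right_module.submodule_carrier[OF right_module_right_regular, simplified]
lemmas right_ideal_zero = right_module.submodule_zero[OF right_module_right_regular, simplified]
lemmas right_ideal_add = right_module.submodule_add[OF right_module_right_regular, simplified]
lemmas right_ideal_mult = right_module.submodule_smult[OF right_module_right_regular, simplified]
lemmas right_ideal_minus = right_module.submodule_minus[OF right_module_right_regular, simplified]
lemmas right_ideal_diff = right_module.submodule_diff[OF right_module_right_regular, simplified]
lemmas right_ideal_one_sided = right_ideal_zero right_ideal_add right_ideal_mult right_ideal_minus right_ideal_diff
lemmas right_ideal_of_carrier = right_module.submodule_of_carrier[OF right_module_right_regular, simplified]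
lemmas right_ideal_of_zero = right_module.submodule_of_zero[OF right_module_right_regular, simplified]
lemmas right_ideal_Int = right_module.submodule_Int[OF right_module_right_regular]
lemmas right_ideal_Inter = right_module.submodule_Inter[OF right_module_right_regular]
lemmas right_ideal_UN_mono = right_module.submodule_UN_mono[OF right_module_right_regular]
lemmas right_ideal_sum = right_module.submodule_sum[OF right_module_right_regular, simplified]
lemmas right_ideal_sum_upper = right_module.sum_upper[OF right_module_right_regular, simplified]
lemmas right_ideal_sum_least = right_module.sum_least[OF right_module_right_regular, simplified]
lemmas mem_sum_iff = right_module.mem_sum_iff[OF right_module_right_regular, simplified]
lemmas right_ideal_span = right_module.submodule_span_submodule[OF right_module_right_regular, simplified]
lemmas right_span_upper = right_module.span_upper[OF right_module_right_regular]
lemmas right_span_least = right_module.span_least[OF right_module_right_regular]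
lemmas right_span_mono = right_module.span_mono[OF right_module_right_regular]
lemmas maximal_right_ideal_exists = right_module.maximal_submodule_exists[OF right_module_right_regular]

lemmas left_idealI = ring.right_idealI[OF ring_opposite, simplified]
lemmas left_ideal_carrier = ring.right_ideal_carrier[OF ring_opposite, simplified]
lemmas left_ideal_zero = ring.right_ideal_zero[OF ring_opposite, simplified]
lemmas left_ideal_add = ring.right_ideal_add[OF ring_opposite, simplified]
lemmas left_ideal_mult = ring.right_ideal_mult[OF ring_opposite, simplified]
lemmas left_ideal_minus = ring.right_ideal_minus[OF ring_opposite, simplified]
lemmas left_ideal_diff = ring.right_ideal_diff[OF ring_opposite, simplified]

lemma right_ideal_principal:
  assumes "a \<in> carrier R"
  shows "right_ideal {a \<otimes> r | r. r \<in> carrier R} R"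
proof -
  interpret N: right_module R "right_regular R" by (rule right_module_right_regular)
  show ?thesis using N.submodule_cyclic[of a] assms by (simp add: N.cyclic_def)
qed

lemmas left_ideal_principal = ring.right_ideal_principal[OF ring_opposite, simplified]

lemma right_ideal_right_annihilator:
  assumes "X \<subseteq> carrier R"
  shows "right_ideal (right_annihilator R X) R"
  using assms
  by (intro right_idealI) (auto simp: right_annihilator_def r_distr m_assoc[symmetric] subset_iff)

end

lemma left_annihilator_opposite [simp]: "left_annihilator (opposite_ring R) = right_annihilator R"
  and right_annihilator_opposite [simp]: "right_annihilator (opposite_ring R) = left_annihilator R"
  by (simp_all add: fun_eq_iff left_annihilator_def right_annihilator_def)

context ring
begin

lemmas left_ideal_left_annihilator = ring.right_ideal_right_annihilator[OF ring_opposite, simplified]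

lemma left_ideal_right_annihilator:
  assumes X: "right_ideal X R"
  shows "left_ideal (right_annihilator R X) R"
  using right_ideal_carrier[OF X] right_ideal_mult[OF X]
  by (intro left_idealI) (auto simp: right_annihilator_def r_distr m_assoc[symmetric] subset_iff)

lemmas right_ideal_left_annihilator = ring.left_ideal_right_annihilator[OF ring_opposite, simplified]

end

lemma
  assumes "right_module R N" "right_module R M" and f: "f \<in> right_hom R N M"
  shows submodule_hom_image: "submodule H R N \<Longrightarrow> submodule (f ` H) R M"
    and submodule_hom_preimage: "submodule L R M \<Longrightarrow> submodule {x \<in> carrier N. f x \<in> L} R N"
proof -
  interpret N: right_module R N by fact
  interpret M: right_module R M by fact
  note f0 = right_hom_zero[OF assms]
  note fh = right_hom_add[OF f] right_hom_smult[OF f]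
  show "submodule (f ` H) R M" if H: "submodule H R N"
  proof (rule M.submoduleI)
    note c = subsetD[OF N.submodule_carrier[OF H]]
    show "f ` H \<subseteq> carrier M" using right_hom_closed[OF f] c by auto
    show "\<zero>\<^bsub>M\<^esub> \<in> f ` H" using f0 N.submodule_zero[OF H] by force
    show "x \<oplus>\<^bsub>M\<^esub> y \<in> f ` H" if "x \<in> f ` H" "y \<in> f ` H" for x y
      using that c N.submodule_add[OF H] by (auto simp: fh[symmetric])
    show "r \<odot>\<^bsub>M\<^esub> x \<in> f ` H" if "r \<in> carrier R" "x \<in> f ` H" for r x
      using that c N.submodule_smult[OF H] by (auto simp: fh[symmetric])
  qed
  show "submodule {x \<in> carrier N. f x \<in> L} R N" if L: "submodule L R M"
    using f0 fh right_hom_closed[OF f] M.submodule_zero[OF L] M.submodule_add[OF L] M.submodule_smult[OF L] N.smult_closed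
    by (intro N.submoduleI) auto
qed

subsection \<open>The socle\<close>

text \<open>A submodule of the image is the image of its preimage in \<open>P\<close>, and
  injectivity on \<open>P\<close> rules out that the image is zero.\<close>

lemma simple_submodule_image:
  assumes "right_module R N" "right_module R M" and f: "f \<in> right_hom R N M"
    and inj: "inj_on f P" and P: "simple_submodule P R N"
  shows "simple_submodule (f ` P) R M"
proof -
  interpret N: right_module R N by fact
  interpret M: right_module R M by fact
  have sP: "submodule P R N" and P0: "P \<noteq> {\<zero>\<^bsub>N\<^esub>}"
    and Ps: "\<And>H. submodule H R N \<Longrightarrow> H \<subseteq> P \<Longrightarrow> H = {\<zero>\<^bsub>N\<^esub>} \<or> H = P"
    using P by (auto simp: simple_submodule_def)
  note f0 = right_hom_zero[OF assms(1-3)]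
  have "f ` P \<noteq> {\<zero>\<^bsub>M\<^esub>}"
  proof
    assume "f ` P = {\<zero>\<^bsub>M\<^esub>}"
    then have "x = \<zero>\<^bsub>N\<^esub>" if "x \<in> P" for x
      using f0 that N.submodule_zero[OF sP] by (intro inj_onD[OF inj]) auto
    then show False using P0 N.submodule_zero[OF sP] by blast
  qed
  moreover have "H = {\<zero>\<^bsub>M\<^esub>} \<or> H = f ` P" if H: "submodule H R M" "H \<subseteq> f ` P" for H
  proof -
    define K where "K = P \<inter> {x \<in> carrier N. f x \<in> H}"
    have "H = f ` K"
      using H(2) N.submodule_carrier[OF sP] by (auto simp: K_def)
    moreover have "submodule K R N"
      unfolding K_def by (intro N.submodule_Int sP submodule_hom_preimage[OF assms(1-3)] H)
    then have "K = {\<zero>\<^bsub>N\<^esub>} \<or> K = P" by (intro Ps) (auto simp: K_def)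
    ultimately show ?thesis using f0 by auto
  qed
  ultimately show ?thesis
    using submodule_hom_image[OF assms(1-3) sP] by (auto simp: simple_submodule_def)
qed

context right_module
begin

lemma submodule_socle: "submodule (socle R N) R N"
proof -
  have "P \<subseteq> carrier N" if "simple_submodule P R N" for P
    using that by (intro submodule_carrier) (simp add: simple_submodule_def)
  then show ?thesis
    unfolding socle_def by (intro submodule_span_submodule) blast
qed

lemma simple_subset_socle: "simple_submodule P R N \<Longrightarrow> P \<subseteq> socle R N"
  unfolding socle_def by (rule subset_trans[OF _ span_upper]) blast

lemma socle_least:
  assumes "submodule L R N" "\<And>P. simple_submodule P R N \<Longrightarrow> P \<subseteq> L"
  shows "socle R N \<subseteq> L"
  unfolding socle_def by (rule span_least[OF assms(1)]) (use assms(2) in blast)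

lemma simple_submodule_restrict_iff:
  assumes H: "submodule H R N"
  shows "simple_submodule S R (N\<lparr>carrier := H\<rparr>) \<longleftrightarrow> simple_submodule S R N \<and> S \<subseteq> H"
  unfolding simple_submodule_def submodule_restrict_iff[OF H] by auto

text \<open>Let \<open>s\<close> be the socle of \<open>H\<close> and \<open>B\<close> maximal with
  \<open>B \<inter> H = 0\<close>. For a simple \<open>P\<close> the intersection
  \<open>P' = (P + B) \<inter> H\<close> is zero, and then \<open>P\<close> lies in \<open>B\<close>
  by maximality, or it is simple with \<open>P\<close> inside \<open>P' + B\<close>. So the whole
  socle lies in \<open>s + B\<close>, and intersecting with \<open>H\<close> leaves
  \<open>H = s\<close>.\<close>

lemma semisimple_of_subset_socle:
  assumes H: "submodule H R N" and Hs: "H \<subseteq> socle R N"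
  shows "semisimple_module R (N\<lparr>carrier := H\<rparr>)"
proof -
  define s where "s = socle R (N\<lparr>carrier := H\<rparr>)"
  interpret H: right_module R "N\<lparr>carrier := H\<rparr>" by (rule right_module_restrict[OF H])
  have s: "submodule s R N" "s \<subseteq> H"
    using H.submodule_socle unfolding s_def submodule_restrict_iff[OF H] by auto
  have simple_s: "P \<subseteq> s" if "simple_submodule P R N" "P \<subseteq> H" for P
    unfolding s_def using that by (intro H.simple_subset_socle) (simp add: simple_submodule_restrict_iff[OF H])
  obtain B where B: "submodule B R N" "B \<inter> H \<subseteq> {\<zero>\<^bsub>N\<^esub>}"
    and Bmax: "\<forall>C. submodule C R N \<longrightarrow> B \<subseteq> C \<longrightarrow> C \<inter> H \<subseteq> {\<zero>\<^bsub>N\<^esub>} \<longrightarrow> C = B"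
    using maximal_submodule_exists[OF submodule_of_zero Int_lower1[of _ H]] by blast
  note c = subsetD[OF submodule_carrier[OF H]] subsetD[OF submodule_carrier[OF B(1)]]
  have "P \<subseteq> s <+>\<^bsub>N\<^esub> B" if P: "simple_submodule P R N" for P
  proof -
    define P' where "P' = (P <+>\<^bsub>N\<^esub> B) \<inter> H"
    have sP: "submodule P R N" and Ps: "\<And>L. submodule L R N \<Longrightarrow> L \<subseteq> P \<Longrightarrow> L = {\<zero>\<^bsub>N\<^esub>} \<or> L = P"
      using P by (auto simp: simple_submodule_def)
    note cP = subsetD[OF submodule_carrier[OF sP]]
    have sP': "submodule P' R N" unfolding P'_def by (intro submodule_Int submodule_sum sP B H)
    \<comment> \<open>A nonzero \<open>h = p + b\<close> in \<open>Q\<close> has nonzero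
      \<open>p\<close> because \<open>B\<close> meets \<open>H\<close> trivially, and
      \<open>p = h - b\<close> lies in \<open>Q + B\<close>. Simplicity of \<open>P\<close> does the
      rest.\<close>
    have *: "P \<subseteq> Q <+>\<^bsub>N\<^esub> B" if Q: "submodule Q R N" "Q \<subseteq> P'" "Q \<noteq> {\<zero>\<^bsub>N\<^esub>}" for Q
    proof -
      obtain h where h: "h \<in> Q" "h \<noteq> \<zero>\<^bsub>N\<^esub>" using Q submodule_zero by blast
      then obtain p b where pb: "p \<in> P" "b \<in> B" "h = p \<oplus>\<^bsub>N\<^esub> b" "h \<in> H"
        using subsetD[OF Q(2), of h] by (auto simp: P'_def mem_sum_iff)
      have "p \<noteq> \<zero>\<^bsub>N\<^esub>"
        using pb h c B(2) by auto
      moreover have "p = h \<oplus>\<^bsub>N\<^esub> \<ominus>\<^bsub>N\<^esub> b"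
        using pb c cP by (simp add: N.a_assoc N.r_neg)
      then have "p \<in> Q <+>\<^bsub>N\<^esub> B"
        using h submodule_minus[OF B(1) pb(2)] by (auto simp: mem_sum_iff)
      ultimately have "P \<inter> (Q <+>\<^bsub>N\<^esub> B) \<noteq> {\<zero>\<^bsub>N\<^esub>}" using pb by blast
      then have "P \<inter> (Q <+>\<^bsub>N\<^esub> B) = P"
        using Ps[of "P \<inter> (Q <+>\<^bsub>N\<^esub> B)"] submodule_Int[OF sP submodule_sum[OF Q(1) B(1)]] by blast
      then show ?thesis by blast
    qed
    show ?thesis
    proof (cases "P' = {\<zero>\<^bsub>N\<^esub>}")
      case True
      then have "P <+>\<^bsub>N\<^esub> B = B"
        using Bmax[rule_format, OF submodule_sum[OF sP B(1)] sum_upper(2)[OF sP B(1)]] by (auto simp: P'_def)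
      then show ?thesis using sum_upper[OF sP B(1)] sum_upper[OF s(1) B(1)] by blast
    next
      case False
      \<comment> \<open>Any \<open>x = p + b\<close> in \<open>P'\<close> is compared with the
        \<open>q\<close> from \<open>p = q + b'\<close>: the difference \<open>x - q\<close> lies in
        \<open>B\<close> and in \<open>H\<close>.\<close>
      have "Q = P'" if Q: "submodule Q R N" "Q \<subseteq> P'" "Q \<noteq> {\<zero>\<^bsub>N\<^esub>}" for Q
      proof -
        have "x \<in> Q" if x: "x \<in> P'" for x
        proof -
          obtain p b where pb: "p \<in> P" "b \<in> B" "x = p \<oplus>\<^bsub>N\<^esub> b" "x \<in> H"
            using x by (auto simp: P'_def mem_sum_iff)
          obtain q b' where qb: "q \<in> Q" "b' \<in> B" "p = q \<oplus>\<^bsub>N\<^esub> b'"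
            using subsetD[OF *[OF Q] pb(1)] unfolding mem_sum_iff by blast
          have qH: "q \<in> H" using qb Q by (auto simp: P'_def)
          have "x \<ominus>\<^bsub>N\<^esub> q = b' \<oplus>\<^bsub>N\<^esub> b"
            using pb(3) qb(3) c(1)[OF qH] c(2)[OF pb(2)] c(2)[OF qb(2)]
            by (simp add: a_minus_def N.a_ac N.r_neg N.r_neg1 N.r_neg2)
          then have "x \<ominus>\<^bsub>N\<^esub> q \<in> B \<inter> H"
            using submodule_add[OF B(1) qb(2) pb(2)] submodule_diff[OF H pb(4) qH] by simp
          then have "x \<ominus>\<^bsub>N\<^esub> q = \<zero>\<^bsub>N\<^esub>" using B(2) by blast
          then have "x = q" using c(1)[OF pb(4)] c(1)[OF qH] by simp
          then show ?thesis using qb by simp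
        qed
        then show ?thesis using Q(2) by blast
      qed
      then have "simple_submodule P' R N"
        using sP' False by (auto simp: simple_submodule_def)
      then have "P' \<subseteq> s" by (intro simple_s) (auto simp: P'_def)
      then show ?thesis using *[OF sP' subset_refl False] by (force simp: mem_sum_iff)
    qed
  qed
  then have all: "socle R N \<subseteq> s <+>\<^bsub>N\<^esub> B"
    by (intro socle_least submodule_sum s B)
  have "y \<in> s" if y: "y \<in> H" for y
  proof -
    obtain h b where hb: "h \<in> s" "b \<in> B" "y = h \<oplus>\<^bsub>N\<^esub> b" using all Hs y by (force simp: mem_sum_iff)
    then have hH: "h \<in> H" using s by blast
    have "y \<ominus>\<^bsub>N\<^esub> h = b"
      using hb(3) c(1)[OF hH] c(2)[OF hb(2)] by (simp add: a_minus_def N.a_ac N.r_neg N.r_neg1 N.r_neg2)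
    then have "b \<in> B \<inter> H" using hb(2) submodule_diff[OF H y hH] by simp
    then have "b = \<zero>\<^bsub>N\<^esub>" using B(2) by blast
    then show ?thesis using hb c(1)[OF hH] by simp
  qed
  then have "s = H" using s by blast
  then show ?thesis by (simp add: semisimple_module_def s_def)
qed

end

lemma socle_image:
  assumes "right_module R N" "right_module R M" and f: "f \<in> right_hom R N M" and inj: "inj_on f (carrier N)"
  shows "f ` socle R N \<subseteq> socle R M"
proof -
  interpret N: right_module R N by fact
  interpret M: right_module R M by fact
  have "socle R N \<subseteq> {x \<in> carrier N. f x \<in> socle R M}"
  proof (rule N.socle_least[OF submodule_hom_preimage[OF assms(1-3) M.submodule_socle]])
    fix P assume P: "simple_submodule P R N"
    then have c: "P \<subseteq> carrier N" using N.submodule_carrier by (auto simp: simple_submodule_def)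
    then have "simple_submodule (f ` P) R M"
      using inj inj_on_subset by (intro simple_submodule_image[OF assms(1-3) _ P]) blast
    then show "P \<subseteq> {x \<in> carrier N. f x \<in> socle R M}" using c M.simple_subset_socle by blast
  qed
  then show ?thesis by blast
qed

subsection \<open>Baer's criterion\<close>

text \<open>An extension to all of \<open>R\<close> is determined by its value at
  \<open>\<one>\<close>, so Baer's test for injectivity of the right regular module takes this form.
  No module type occurs in it.\<close>

definition baer_injective :: "('a, 'b) ring_scheme \<Rightarrow> bool"
  where "baer_injective R \<longleftrightarrow>
    (\<forall>T f. right_ideal T R \<and> f \<in> right_hom R ((right_regular R)\<lparr>carrier := T\<rparr>) (right_regular R) \<longrightarrow>
      (\<exists>c\<in>carrier R. \<forall>t\<in>T. f t = c \<otimes>\<^bsub>R\<^esub> t))"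

lemma (in ring) submodule_pairsI:
  assumes "G \<subseteq> carrier R \<times> carrier R" "(\<zero>, \<zero>) \<in> G"
    and "\<And>x y x' y'. \<lbrakk>(x, y) \<in> G; (x', y') \<in> G\<rbrakk> \<Longrightarrow> (x \<oplus> x', y \<oplus> y') \<in> G"
    and "\<And>x y r. \<lbrakk>(x, y) \<in> G; r \<in> carrier R\<rbrakk> \<Longrightarrow> (x \<otimes> r, y \<otimes> r) \<in> G"
  shows "submodule G R (module_sum (right_regular R) (right_regular R))"
  using assms
  by (intro right_module.submoduleI[OF right_module_sum[OF right_module_right_regular right_module_right_regular]]) auto

text \<open>The graph form allows relations such as \<open>{(x r + t, k r)}\<close> to be used as
  homomorphisms directly.\<close>

lemma (in ring) baer_injectiveD:
  assumes "baer_injective R" and G: "G \<subseteq> carrier R \<times> carrier R" "(\<zero>, \<zero>) \<in> G"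
    "\<And>x y x' y'. \<lbrakk>(x, y) \<in> G; (x', y') \<in> G\<rbrakk> \<Longrightarrow> (x \<oplus> x', y \<oplus> y') \<in> G"
    "\<And>x y r. \<lbrakk>(x, y) \<in> G; r \<in> carrier R\<rbrakk> \<Longrightarrow> (x \<otimes> r, y \<otimes> r) \<in> G"
    and "\<And>y. (\<zero>, y) \<in> G \<Longrightarrow> y = \<zero>"
  shows "\<exists>c\<in>carrier R. \<forall>x y. (x, y) \<in> G \<longrightarrow> y = c \<otimes> x"
proof -
  obtain f where f: "f \<in> right_hom R ((right_regular R)\<lparr>carrier := fst ` G\<rparr>) (right_regular R)"
      "\<forall>x y. (x, y) \<in> G \<longrightarrow> f x = y" and "right_ideal (fst ` G) R"
    using hom_of_graph[OF right_module_right_regular right_module_right_regular submodule_pairsI[OF G]] assms(6)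
    by auto
  then obtain c where "c \<in> carrier R" "\<forall>t\<in>fst ` G. f t = c \<otimes> t"
    using assms(1) unfolding baer_injective_def by blast
  then show ?thesis using f(2) by (intro bexI[of _ c]) force+
qed

text \<open>Baer's argument on graphs: a maximal graph extending that of \<open>f\<close> has full
  domain, since a missing element could be adjoined.\<close>

lemma baer_injective_extends:
  assumes R: "baer_injective R" and N: "right_module R N" and K: "submodule K R N"
  shows "extends_to R K N (right_regular R)"
proof -
  interpret N: right_module R N by fact
  note RR = N.right_module_right_regular
  note S = right_module_sum[OF N RR]
  interpret S: right_module R "module_sum N (right_regular R)" by (rule S)
  show ?thesis unfolding extends_to_def
  proof
    fix f assume f: "f \<in> right_hom R (N\<lparr>carrier := K\<rparr>) (right_regular R)"
    \<comment> \<open>For a submodule of the sum, avoiding \<open>?X\<close> means being the graph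
      of a partial homomorphism.\<close>
    let ?G = "{(x, f x) | x. x \<in> K}" and ?X = "{(\<zero>\<^bsub>N\<^esub>, y) | y. y \<noteq> \<zero>\<^bsub>R\<^esub>}"
    have f0: "f \<zero>\<^bsub>N\<^esub> = \<zero>\<^bsub>R\<^esub>"
      using right_hom_zero[OF N.right_module_restrict[OF K] RR f] by simp
    have GX: "?G \<inter> ?X \<subseteq> {}" using f0 by auto
    obtain B where B: "submodule B R (module_sum N (right_regular R))" "?G \<subseteq> B" "B \<inter> ?X \<subseteq> {}"
      and Bmax: "\<forall>C. submodule C R (module_sum N (right_regular R)) \<longrightarrow> B \<subseteq> C \<longrightarrow> C \<inter> ?X \<subseteq> {} \<longrightarrow> C = B"
      using S.maximal_submodule_exists[OF submodule_graph[OF N RR K f] GX] by (elim exE conjE)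
    have fn: "y = \<zero>\<^bsub>R\<^esub>" if "(\<zero>\<^bsub>N\<^esub>, y) \<in> B" for y using B(3) that by blast
    have cB: "x \<in> carrier N" "y \<in> carrier R" if "(x, y) \<in> B" for x y
      using S.submodule_carrier[OF B(1)] that by auto
    have addB: "(x \<oplus>\<^bsub>N\<^esub> x', y \<oplus>\<^bsub>R\<^esub> y') \<in> B" if "(x, y) \<in> B" "(x', y') \<in> B" for x y x' y'
      using S.submodule_add[OF B(1) that] by simp
    have smultB: "(r \<odot>\<^bsub>N\<^esub> x, y \<otimes>\<^bsub>R\<^esub> r) \<in> B" if "r \<in> carrier R" "(x, y) \<in> B" for r x y
      using S.submodule_smult[OF B(1) that] by simp
    have "fst ` B = carrier N"
    proof (rule ccontr)
      assume "fst ` B \<noteq> carrier N"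
      then obtain n where n: "n \<in> carrier N" "n \<notin> fst ` B" using cB by fastforce
      \<comment> \<open>The graph of \<open>r \<mapsto>\<close> value at \<open>n r\<close>, on the
        right ideal of those \<open>r\<close> that bring \<open>n\<close> into the domain. Its
        multiplier \<open>c\<close> is a consistent value at \<open>n\<close>.\<close>
      let ?T = "{(r, y). r \<in> carrier R \<and> (r \<odot>\<^bsub>N\<^esub> n, y) \<in> B}"
      have "\<exists>c\<in>carrier R. \<forall>r y. (r, y) \<in> ?T \<longrightarrow> y = c \<otimes>\<^bsub>R\<^esub> r"
      proof (rule N.baer_injectiveD[OF R, of ?T])
        show "(\<zero>\<^bsub>R\<^esub>, \<zero>\<^bsub>R\<^esub>) \<in> ?T"
          using S.submodule_zero[OF B(1)] n by (simp add: N.smult_zero_left N.R_simprules)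
        show "(x \<oplus>\<^bsub>R\<^esub> x', y \<oplus>\<^bsub>R\<^esub> y') \<in> ?T" if "(x, y) \<in> ?T" "(x', y') \<in> ?T" for x y x' y'
          using that addB n by (auto simp: N.smult_ring_add N.R_closed)
        show "(x \<otimes>\<^bsub>R\<^esub> r, y \<otimes>\<^bsub>R\<^esub> r) \<in> ?T" if "(x, y) \<in> ?T" "r \<in> carrier R" for x y r
          using that smultB n by (auto simp: N.smult_assoc N.R_closed)
        show "y = \<zero>\<^bsub>R\<^esub>" if "(\<zero>\<^bsub>R\<^esub>, y) \<in> ?T" for y
          using that fn n by (auto simp: N.smult_zero_left)
      qed (use cB in auto)
      then obtain c where c: "c \<in> carrier R" "\<And>r y. (r, y) \<in> ?T \<Longrightarrow> y = c \<otimes>\<^bsub>R\<^esub> r" by blast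
      \<comment> \<open>The multiples of \<open>(n, c)\<close>. By the choice of \<open>c\<close>
        they agree with \<open>B\<close> wherever both are defined, so the sum is still a
        graph.\<close>
      let ?C = "{(r \<odot>\<^bsub>N\<^esub> n, c \<otimes>\<^bsub>R\<^esub> r) | r. r \<in> carrier R}"
      have C: "submodule ?C R (module_sum N (right_regular R))"
        using S.submodule_cyclic[of "(n, c)"] n c by (simp add: S.cyclic_def)
      have "(B <+>\<^bsub>module_sum N (right_regular R)\<^esub> ?C) \<inter> ?X \<subseteq> {}"
      proof
        fix z assume "z \<in> (B <+>\<^bsub>module_sum N (right_regular R)\<^esub> ?C) \<inter> ?X"
        then obtain b v r w where z: "(b, v) \<in> B" "r \<in> carrier R" "b \<oplus>\<^bsub>N\<^esub> r \<odot>\<^bsub>N\<^esub> n = \<zero>\<^bsub>N\<^esub>"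
          "v \<oplus>\<^bsub>R\<^esub> c \<otimes>\<^bsub>R\<^esub> r = w" "w \<noteq> \<zero>\<^bsub>R\<^esub>"
          by (auto simp: S.mem_sum_iff)
        have "(\<ominus>\<^bsub>R\<^esub> \<one>\<^bsub>R\<^esub>) \<odot>\<^bsub>N\<^esub> b = r \<odot>\<^bsub>N\<^esub> n"
          using z cB[OF z(1)] n
          by (metis N.N.minus_equality N.N.a_comm N.smult_closed N.smult_minus_left N.smult_unit N.one_closed)
        moreover have "((\<ominus>\<^bsub>R\<^esub> \<one>\<^bsub>R\<^esub>) \<odot>\<^bsub>N\<^esub> b, v \<otimes>\<^bsub>R\<^esub> (\<ominus>\<^bsub>R\<^esub> \<one>\<^bsub>R\<^esub>)) \<in> B"
          by (intro smultB z) (simp add: N.R_simprules)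
        ultimately have "v \<otimes>\<^bsub>R\<^esub> (\<ominus>\<^bsub>R\<^esub> \<one>\<^bsub>R\<^esub>) = c \<otimes>\<^bsub>R\<^esub> r"
          using z by (intro c(2)) auto
        then have "c \<otimes>\<^bsub>R\<^esub> r = \<ominus>\<^bsub>R\<^esub> v" using cB[OF z(1)] by (simp add: N.R_simprules)
        then have "v \<oplus>\<^bsub>R\<^esub> c \<otimes>\<^bsub>R\<^esub> r = \<zero>\<^bsub>R\<^esub>" using cB[OF z(1)] by (simp add: N.R_simprules)
        then show "z \<in> {}" using z by simp
      qed
      then have "B <+>\<^bsub>module_sum N (right_regular R)\<^esub> ?C = B"
        by (intro Bmax[rule_format] S.submodule_sum S.sum_upper B C)
      then have "?C \<subseteq> B" using S.sum_upper(2)[OF B(1) C] by simp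
      moreover have "(n, c) \<in> ?C"
        using n c by (intro CollectI exI[of _ "\<one>\<^bsub>R\<^esub>"]) (simp add: N.smult_unit)
      ultimately show False using n by force
    qed
    then obtain g where "g \<in> right_hom R (N\<lparr>carrier := carrier N\<rparr>) (right_regular R)"
        "\<forall>x y. (x, y) \<in> B \<longrightarrow> g x = y"
      using hom_of_graph(2)[OF N RR B(1)] fn by auto
    moreover have "(x, f x) \<in> B" if "x \<in> K" for x using B(2) that by blast
    ultimately show "\<exists>g\<in>right_hom R N (right_regular R). \<forall>x\<in>K. g x = f x"
      by (intro bexI[of _ g]) (auto simp: right_hom_iff)
  qed
qed

lemma baer_imp_injective: "baer_injective R \<Longrightarrow> right_self_injective U R"
  by (auto simp: right_self_injective_def injective_module_def intro: baer_injective_extends)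

lemma (in ring) right_hom_of_ring:
  assumes N: "right_module R N" and g: "g \<in> right_hom R (right_regular R) N" and r: "r \<in> carrier R"
  shows "g r = r \<odot>\<^bsub>N\<^esub> g \<one>"
  using right_hom_smult[OF g, of r \<one>] r by simp

text \<open>Provides a copy of \<open>R\<close> with carrier in the universe, so that the hypotheses
  on modules there can be tested on the regular module.\<close>

definition embed_ring :: "'a \<Rightarrow> ('a, 'm) universe"
  where "embed_ring a = Inr {{(a, 0)}}"

lemma inj_embed_ring: "inj embed_ring"
  by (auto simp: embed_ring_def inj_def)

lemma (in ring)
  fixes M :: "('a, ('a, 'm) universe) module"
  defines "M \<equiv> image_module embed_ring (right_regular R)"
  shows right_module_embed_ring: "right_module R M"
    and right_hom_embed_ring: "embed_ring \<in> right_hom R (right_regular R) M"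
    and carrier_embed_ring: "carrier M = embed_ring ` carrier R"
proof -
  have q: "embed_ring x = (embed_ring y :: ('a, 'm) universe) \<longleftrightarrow> x \<ominus>\<^bsub>right_regular R\<^esub> y \<in> {\<zero>\<^bsub>right_regular R\<^esub>}"
    if "x \<in> carrier (right_regular R)" "y \<in> carrier (right_regular R)" for x y
    using that inj_embed_ring[THEN inj_eq, of x y] by auto
  note * = right_module_right_regular right_module.submodule_of_zero[OF right_module_right_regular] q
  show "right_module R M" unfolding M_def by (rule right_module_image[OF *])
  show "embed_ring \<in> right_hom R (right_regular R) M" unfolding M_def by (rule right_hom_image[OF *])
  show "carrier M = embed_ring ` carrier R" by (simp add: M_def image_module_def)
qed

text \<open>Transport back from the copy: an extension \<open>g\<close> is determined by its value
  at the image of \<open>\<one>\<close>, and that value is the multiplier.\<close>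

lemma (in ring) extends_to_embed_ring:
  assumes T: "right_ideal T R" and f: "f \<in> right_hom R ((right_regular R)\<lparr>carrier := T\<rparr>) (right_regular R)"
    and ext: "extends_to R (embed_ring ` T) (image_module embed_ring (right_regular R) :: ('a, ('a, 'm) universe) module)
      (right_regular R)"
  shows "\<exists>c\<in>carrier R. \<forall>t\<in>T. f t = c \<otimes> t"
proof -
  let ?M = "image_module embed_ring (right_regular R) :: ('a, ('a, 'm) universe) module"
  let ?e = "embed_ring :: 'a \<Rightarrow> ('a, 'm) universe"
  interpret M: right_module R ?M by (rule right_module_embed_ring)
  note e = right_hom_embed_ring[where 'm = 'm]
  note cT = subsetD[OF right_ideal_carrier[OF T]]
  have inv: "inv_into UNIV ?e (?e x) = x" for x by (simp add: inj_embed_ring)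
  have "f \<circ> inv_into UNIV ?e \<in> right_hom R (?M\<lparr>carrier := ?e ` T\<rparr>) (right_regular R)"
    using right_hom_closed[OF f] right_hom_add[OF f] right_hom_smult[OF f]
    by (auto simp: right_hom_iff inv right_hom_add[OF e, symmetric, simplified] cT right_hom_smult[OF e, symmetric, simplified])
  then obtain g where g: "g \<in> right_hom R ?M (right_regular R)" "\<And>x. x \<in> T \<Longrightarrow> g (?e x) = f x"
    using ext inv unfolding extends_to_def by (metis comp_apply image_eqI)
  have "f t = g (?e \<one>) \<otimes> t" if t: "t \<in> T" for t
  proof -
    have "?e t = t \<odot>\<^bsub>?M\<^esub> ?e \<one>"
      by (rule right_hom_of_ring[OF M.right_module_axioms e cT[OF t]])
    then show ?thesis
      using right_hom_smult[OF g(1) cT[OF t], of "?e \<one>"] g(2)[OF t] by (simp add: carrier_embed_ring)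
  qed
  moreover have "g (?e \<one>) \<in> carrier R"
    using right_hom_closed[OF g(1), of "?e \<one>"] by (simp add: carrier_embed_ring)
  ultimately show ?thesis by blast
qed

lemma (in ring) injective_imp_baer:
  assumes "right_self_injective TYPE(('a, 'm) universe) R"
  shows "baer_injective R"
  unfolding baer_injective_def
proof (intro allI impI, elim conjE)
  fix T f assume T: "right_ideal T R" and f: "f \<in> right_hom R ((right_regular R)\<lparr>carrier := T\<rparr>) (right_regular R)"
  let ?M = "image_module embed_ring (right_regular R) :: ('a, ('a, 'm) universe) module"
  have "submodule (embed_ring ` T) R ?M"
    using submodule_hom_image[OF right_module_right_regular right_module_embed_ring right_hom_embed_ring T] .
  then have "extends_to R (embed_ring ` T) ?M (right_regular R)"
    using assms right_module_embed_ring unfolding right_self_injective_def injective_module_def by blast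
  then show "\<exists>c\<in>carrier R. \<forall>t\<in>T. f t = c \<otimes> t" by (rule extends_to_embed_ring[OF T f])
qed

subsection \<open>The Jacobson radical\<close>

text \<open>Without commutativity the right unit law does not follow from the left one, so
  \<open>algebra\<close> receives it as a rule of its own.\<close>

declare (in ring) r_one
  [algebra ring "zero R" "add R" "a_inv R" "a_minus R" "one R" "mult R"]

context ring
begin

lemma right_ideal_eq_carrier: "right_ideal I R \<Longrightarrow> \<one> \<in> I \<Longrightarrow> I = carrier R"
  using right_ideal_mult[of I _ \<one>] right_ideal_carrier[of I] by force

lemma exists_maximal_right_ideal:
  assumes T: "right_ideal T R" and one: "\<one> \<notin> T"
  shows "\<exists>I. maximal_right_ideal I R \<and> T \<subseteq> I"
proof -
  have "T \<inter> {\<one>} \<subseteq> {}" using one by auto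
  then obtain B where B: "right_ideal B R" "T \<subseteq> B" "B \<inter> {\<one>} \<subseteq> {}"
    and Bmax: "\<forall>C. right_ideal C R \<longrightarrow> B \<subseteq> C \<longrightarrow> C \<inter> {\<one>} \<subseteq> {} \<longrightarrow> C = B"
    using maximal_right_ideal_exists[OF T] by metis
  have "maximal_right_ideal B R"
    unfolding maximal_right_ideal_def
  proof (intro conjI allI impI)
    show "B \<noteq> carrier R" using B(3) by auto
    show "H = B \<or> H = carrier R" if "right_ideal H R \<and> B \<subseteq> H" for H
      using that Bmax right_ideal_eq_carrier[of H] by blast
  qed (fact B)
  then show ?thesis using B by blast
qed

lemma right_ideal_jacobson: "right_ideal (jacobson_radical R) R"
proof -
  have "right_ideal (\<Inter>(insert (carrier R) {I. maximal_right_ideal I R})) R"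
    by (rule right_ideal_Inter) (auto simp: maximal_right_ideal_def right_ideal_of_carrier)
  then show ?thesis by (simp add: jacobson_radical_def)
qed

text \<open>If the right ideal generated by \<open>1 - j\<close> were proper, a maximal right ideal
  above it would contain \<open>1 - j\<close> and \<open>j\<close>, hence \<open>1\<close>.\<close>

lemma jacobson_right_inverse:
  assumes j: "j \<in> jacobson_radical R"
  shows "\<exists>u\<in>carrier R. (\<one> \<ominus> j) \<otimes> u = \<one>"
proof (rule ccontr)
  assume *: "\<not> ?thesis"
  let ?T = "{(\<one> \<ominus> j) \<otimes> r | r. r \<in> carrier R}"
  have jc: "j \<in> carrier R" using j by (simp add: jacobson_radical_def)
  then have T: "right_ideal ?T R" by (intro right_ideal_principal) auto
  have "\<one> \<notin> ?T" using * by force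
  then obtain I where I: "maximal_right_ideal I R" "?T \<subseteq> I" using exists_maximal_right_ideal[OF T] by blast
  then have rI: "right_ideal I R" by (simp add: maximal_right_ideal_def)
  have "\<one> \<ominus> j \<in> ?T" using jc by (intro CollectI exI[of _ \<one>]) auto
  then have "\<one> \<ominus> j \<in> I" "j \<in> I" using I j by (auto simp: jacobson_radical_def)
  then have "(\<one> \<ominus> j) \<oplus> j \<in> I" by (rule right_ideal_add[OF rI])
  moreover have "(\<one> \<ominus> j) \<oplus> j = \<one>" using jc by algebra
  ultimately show False using I right_ideal_eq_carrier[OF rI] by (simp add: maximal_right_ideal_def)
qed

text \<open>If a maximal right ideal \<open>I\<close> omits \<open>x\<close>, then
  \<open>1 = t + x r\<close> with \<open>t\<close> in \<open>I\<close>; now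
  \<open>t = 1 - x r\<close> is right invertible, so \<open>I\<close> would be everything.\<close>

lemma jacobsonI:
  assumes x: "x \<in> carrier R" and *: "\<And>r. r \<in> carrier R \<Longrightarrow> \<exists>u\<in>carrier R. (\<one> \<ominus> x \<otimes> r) \<otimes> u = \<one>"
  shows "x \<in> jacobson_radical R"
proof (rule ccontr)
  assume "x \<notin> jacobson_radical R"
  then obtain I where I: "maximal_right_ideal I R" "x \<notin> I" using x by (auto simp: jacobson_radical_def)
  then have rI: "right_ideal I R" by (simp add: maximal_right_ideal_def)
  let ?X = "{x \<otimes> r | r. r \<in> carrier R}"
  note X = right_ideal_principal[OF x]
  have xX: "x \<in> ?X" using x by (intro CollectI exI[of _ \<one>]) auto
  have "I <+> ?X = I \<or> I <+> ?X = carrier R"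
    using I(1) right_ideal_sum[OF rI X] right_ideal_sum_upper[OF rI X]
    by (simp add: maximal_right_ideal_def)
  then have "\<one> \<in> I <+> ?X"
    using I(2) xX right_ideal_sum_upper(2)[OF rI X] by auto
  then obtain t r where t: "t \<in> I" "r \<in> carrier R" "\<one> = t \<oplus> x \<otimes> r" by (auto simp: mem_sum_iff)
  have "t \<in> carrier R" using t right_ideal_carrier[OF rI] by auto
  then have "\<one> \<ominus> x \<otimes> r = t" using t x by algebra
  then obtain u where "u \<in> carrier R" "t \<otimes> u = \<one>" using *[OF t(2)] by auto
  then have "\<one> \<in> I" using right_ideal_mult[OF rI] t by metis
  then show False using I right_ideal_eq_carrier[OF rI] by (simp add: maximal_right_ideal_def)
qed

lemma left_ideal_jacobson: "left_ideal (jacobson_radical R) R"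
proof (rule left_idealI)
  let ?J = "jacobson_radical R"
  note J = right_ideal_carrier[OF right_ideal_jacobson] right_ideal_one_sided[OF right_ideal_jacobson]
  show "?J \<subseteq> carrier R" "\<zero> \<in> ?J" "\<And>x y. x \<in> ?J \<Longrightarrow> y \<in> ?J \<Longrightarrow> x \<oplus> y \<in> ?J" using J by auto
  show "a \<otimes> j \<in> ?J" if a: "a \<in> carrier R" and j: "j \<in> ?J" for a j
  proof (rule jacobsonI)
    have jc: "j \<in> carrier R" using j J by auto
    then show "a \<otimes> j \<in> carrier R" using a by simp
    fix r assume r: "r \<in> carrier R"
    let ?y = "j \<otimes> r"
    have y: "?y \<otimes> a \<in> ?J" using J r a j by simp
    then obtain v where v: "v \<in> carrier R" "(\<one> \<ominus> ?y \<otimes> a) \<otimes> v = \<one>" using jacobson_right_inverse by blast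
    have yc: "?y \<in> carrier R" using jc r by simp
    \<comment> \<open>If \<open>v\<close> is a right inverse of \<open>1 - y a\<close>, then
      \<open>1 + a v y\<close> is a right inverse of \<open>1 - a y\<close>.\<close>
    have "(\<one> \<ominus> a \<otimes> ?y) \<otimes> (\<one> \<oplus> a \<otimes> (v \<otimes> ?y)) = \<one> \<ominus> a \<otimes> ?y \<oplus> a \<otimes> (((\<one> \<ominus> ?y \<otimes> a) \<otimes> v) \<otimes> ?y)"
      using a v(1) yc by algebra
    also have "\<dots> = \<one>" using a v yc by (simp, algebra)
    finally show "\<exists>u\<in>carrier R. (\<one> \<ominus> a \<otimes> j \<otimes> r) \<otimes> u = \<one>"
      using a v yc jc r by (intro bexI[of _ "\<one> \<oplus> a \<otimes> (v \<otimes> ?y)"]) (auto simp: m_assoc)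
  qed
qed

text \<open>The right inverse \<open>u\<close> equals \<open>1 + j u\<close>, which is right
  invertible for the same reason. So \<open>u\<close> is invertible and its inverse must be
  \<open>1 - j\<close>.\<close>

lemma jacobson_unit:
  assumes j: "j \<in> jacobson_radical R"
  shows "\<exists>u\<in>carrier R. (\<one> \<ominus> j) \<otimes> u = \<one> \<and> u \<otimes> (\<one> \<ominus> j) = \<one>"
proof -
  note J = right_ideal_carrier[OF right_ideal_jacobson] right_ideal_one_sided[OF right_ideal_jacobson]
  have jc: "j \<in> carrier R" using j J by auto
  obtain u where u: "u \<in> carrier R" "(\<one> \<ominus> j) \<otimes> u = \<one>" using jacobson_right_inverse[OF j] by blast
  have "\<ominus> (j \<otimes> u) \<in> jacobson_radical R" using J u j by simp
  then obtain w where w: "w \<in> carrier R" "(\<one> \<ominus> (\<ominus> (j \<otimes> u))) \<otimes> w = \<one>" using jacobson_right_inverse by blast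
  have "(\<one> \<ominus> (\<ominus> (j \<otimes> u))) = (\<one> \<ominus> j) \<otimes> u \<oplus> j \<otimes> u" unfolding u(2) using jc u(1) by algebra
  also have "\<dots> = u" using jc u(1) by algebra
  finally have uw: "u \<otimes> w = \<one>" using w by simp
  have "w = ((\<one> \<ominus> j) \<otimes> u) \<otimes> w" using w u by simp
  also have "\<dots> = (\<one> \<ominus> j) \<otimes> (u \<otimes> w)" using jc u(1) w(1) by algebra
  also have "\<dots> = \<one> \<ominus> j" using uw jc by simp
  finally show ?thesis using u uw by blast
qed

end

subsection \<open>Rings that are semisimple modulo a two-sided ideal\<close>

text \<open>Two one-sided conditions, so that invariance under passage to the opposite ring is
  immediate; the link to the library notion is \<open>two_sided_ideal_iff_ideal\<close>.\<close>

definition two_sided_ideal :: "'a set \<Rightarrow> ('a, 'b) ring_scheme \<Rightarrow> bool"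
  where "two_sided_ideal J R \<longleftrightarrow> right_ideal J R \<and> left_ideal J R"

text \<open>Computations in \<open>R/J\<close> are done on representatives with this relation,
  without forming the quotient ring.\<close>

definition ring_cong :: "('a, 'b) ring_scheme \<Rightarrow> 'a set \<Rightarrow> 'a \<Rightarrow> 'a \<Rightarrow> bool"
  where "ring_cong R J x y \<longleftrightarrow> x \<in> carrier R \<and> y \<in> carrier R \<and> x \<ominus>\<^bsub>R\<^esub> y \<in> J"

text \<open>
  Every right ideal of \<open>R/J\<close> is generated by an idempotent, i.e. is a direct summand.
\<close>

definition semisimple_modulo :: "('a, 'b) ring_scheme \<Rightarrow> 'a set \<Rightarrow> bool"
  where "semisimple_modulo R J \<longleftrightarrow>
    (\<forall>C. right_ideal C R \<and> J \<subseteq> C \<longrightarrow> (\<exists>e\<in>C. \<forall>c\<in>C. c \<ominus>\<^bsub>R\<^esub> e \<otimes>\<^bsub>R\<^esub> c \<in> J))"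

lemma two_sided_ideal_opposite [simp]: "two_sided_ideal J (opposite_ring R) \<longleftrightarrow> two_sided_ideal J R"
  by (auto simp: two_sided_ideal_def)

lemma ring_cong_opposite [simp]: "ring_cong (opposite_ring R) J = ring_cong R J"
  by (simp add: fun_eq_iff ring_cong_def)

lemma (in ring) two_sided_jacobson: "two_sided_ideal (jacobson_radical R) R"
  by (simp add: two_sided_ideal_def right_ideal_jacobson left_ideal_jacobson)

section \<open>Congruence arithmetic modulo a two-sided ideal\<close>

context ring
begin

lemma
  assumes "two_sided_ideal J R"
  shows two_sided_ideal_carrier: "J \<subseteq> carrier R"
    and two_sided_ideal_zero: "\<zero> \<in> J"
    and two_sided_ideal_add: "\<And>x y. x \<in> J \<Longrightarrow> y \<in> J \<Longrightarrow> x \<oplus> y \<in> J"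
    and two_sided_ideal_minus: "\<And>x. x \<in> J \<Longrightarrow> \<ominus> x \<in> J"
    and two_sided_ideal_diff: "\<And>x y. x \<in> J \<Longrightarrow> y \<in> J \<Longrightarrow> x \<ominus> y \<in> J"
    and two_sided_ideal_multr: "\<And>x r. r \<in> carrier R \<Longrightarrow> x \<in> J \<Longrightarrow> x \<otimes> r \<in> J"
    and two_sided_ideal_multl: "\<And>x r. r \<in> carrier R \<Longrightarrow> x \<in> J \<Longrightarrow> r \<otimes> x \<in> J"
  using assms right_ideal_carrier right_ideal_one_sided left_ideal_mult
  by (auto simp: two_sided_ideal_def)

lemma ring_cong_carrier: "ring_cong R J x y \<Longrightarrow> x \<in> carrier R" "ring_cong R J x y \<Longrightarrow> y \<in> carrier R"
  by (simp_all add: ring_cong_def)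

context
  fixes J
  assumes J: "two_sided_ideal J R"
begin

lemma ring_cong_refl: "x \<in> carrier R \<Longrightarrow> ring_cong R J x x"
  using two_sided_ideal_zero[OF J] by (simp add: ring_cong_def a_minus_def r_neg)

lemma ring_cong_sym: "ring_cong R J x y \<Longrightarrow> ring_cong R J y x"
proof -
  assume "ring_cong R J x y"
  then have c: "x \<in> carrier R" "y \<in> carrier R" and "x \<ominus> y \<in> J" by (auto simp: ring_cong_def)
  then have "\<ominus> (x \<ominus> y) \<in> J" using two_sided_ideal_minus[OF J] by blast
  moreover have "\<ominus> (x \<ominus> y) = y \<ominus> x" using c by algebra
  ultimately show ?thesis using c by (simp add: ring_cong_def)
qed

lemma ring_cong_trans [trans]: "ring_cong R J x y \<Longrightarrow> ring_cong R J y z \<Longrightarrow> ring_cong R J x z"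
proof -
  assume *: "ring_cong R J x y" "ring_cong R J y z"
  then have c: "x \<in> carrier R" "y \<in> carrier R" "z \<in> carrier R" by (auto simp: ring_cong_def)
  have "(x \<ominus> y) \<oplus> (y \<ominus> z) \<in> J" using * two_sided_ideal_add[OF J] by (auto simp: ring_cong_def)
  moreover have "(x \<ominus> y) \<oplus> (y \<ominus> z) = x \<ominus> z" using c by algebra
  ultimately show ?thesis using c by (simp add: ring_cong_def)
qed

lemma ring_cong_add: "ring_cong R J x y \<Longrightarrow> ring_cong R J x' y' \<Longrightarrow> ring_cong R J (x \<oplus> x') (y \<oplus> y')"
proof -
  assume *: "ring_cong R J x y" "ring_cong R J x' y'"
  then have c: "x \<in> carrier R" "y \<in> carrier R" "x' \<in> carrier R" "y' \<in> carrier R" by (auto simp: ring_cong_def)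
  have "(x \<ominus> y) \<oplus> (x' \<ominus> y') \<in> J" using * two_sided_ideal_add[OF J] by (auto simp: ring_cong_def)
  moreover have "(x \<ominus> y) \<oplus> (x' \<ominus> y') = (x \<oplus> x') \<ominus> (y \<oplus> y')" using c by algebra
  ultimately show ?thesis using c by (simp add: ring_cong_def)
qed

lemma ring_cong_mult: "ring_cong R J x y \<Longrightarrow> ring_cong R J x' y' \<Longrightarrow> ring_cong R J (x \<otimes> x') (y \<otimes> y')"
proof -
  assume *: "ring_cong R J x y" "ring_cong R J x' y'"
  then have c: "x \<in> carrier R" "y \<in> carrier R" "x' \<in> carrier R" "y' \<in> carrier R" by (auto simp: ring_cong_def)
  have "(x \<ominus> y) \<otimes> x' \<oplus> y \<otimes> (x' \<ominus> y') \<in> J"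
    using * c two_sided_ideal_add[OF J] two_sided_ideal_multr[OF J] two_sided_ideal_multl[OF J]
    by (auto simp: ring_cong_def)
  moreover have "(x \<ominus> y) \<otimes> x' \<oplus> y \<otimes> (x' \<ominus> y') = x \<otimes> x' \<ominus> y \<otimes> y'" using c by algebra
  ultimately show ?thesis using c by (simp add: ring_cong_def)
qed

lemma ring_cong_minus: "ring_cong R J x y \<Longrightarrow> ring_cong R J (\<ominus> x) (\<ominus> y)"
  using ring_cong_mult[OF ring_cong_refl[of "\<ominus> \<one>"], of x y] by (auto simp: l_minus ring_cong_def)

lemma ring_cong_diff: "ring_cong R J x y \<Longrightarrow> ring_cong R J x' y' \<Longrightarrow> ring_cong R J (x \<ominus> x') (y \<ominus> y')"
  using ring_cong_add ring_cong_minus by (simp add: a_minus_def)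

lemma ring_cong_zero_iff: "ring_cong R J x \<zero> \<longleftrightarrow> x \<in> J"
  using two_sided_ideal_carrier[OF J] by (auto simp: ring_cong_def a_minus_def)

lemma ring_cong_mem: "ring_cong R J x y \<Longrightarrow> y \<in> J \<Longrightarrow> x \<in> J"
  using ring_cong_zero_iff ring_cong_trans by blast

end

end

section \<open>Regularity, chain conditions and left-right symmetry of \<open>R/J\<close>\<close>

context ring
begin

context
  fixes J
  assumes J: "two_sided_ideal J R"
begin

lemmas J_carrier = subsetD[OF two_sided_ideal_carrier[OF J]]
lemmas J_closed = two_sided_ideal_zero[OF J] two_sided_ideal_add[OF J] two_sided_ideal_minus[OF J]
  two_sided_ideal_diff[OF J] two_sided_ideal_multr[OF J] two_sided_ideal_multl[OF J]

lemma right_ideal_cong_mem: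
  assumes "right_ideal C R" "J \<subseteq> C" "ring_cong R J x y" "y \<in> C"
  shows "x \<in> C"
proof -
  have "x = (x \<ominus> y) \<oplus> y" using assms(3) by (simp add: ring_cong_def) algebra
  moreover have "x \<ominus> y \<in> C" using assms(2,3) by (auto simp: ring_cong_def)
  ultimately show ?thesis using right_ideal_add[OF assms(1)] assms(4) by metis
qed

text \<open>The set is \<open>aR + J\<close>, to which \<open>semisimple_modulo\<close> can be
  applied.\<close>

lemma right_ideal_add_principal:
  assumes "a \<in> carrier R"
  shows "right_ideal {x \<in> carrier R. \<exists>r\<in>carrier R. ring_cong R J x (a \<otimes> r)} R"
proof (rule right_idealI)
  show "\<zero> \<in> {x \<in> carrier R. \<exists>r\<in>carrier R. ring_cong R J x (a \<otimes> r)}"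
    using assms ring_cong_refl[OF J, of \<zero>] by (auto intro!: bexI[of _ \<zero>])
  show "x \<oplus> y \<in> {x \<in> carrier R. \<exists>r\<in>carrier R. ring_cong R J x (a \<otimes> r)}"
    if xy: "x \<in> {x \<in> carrier R. \<exists>r\<in>carrier R. ring_cong R J x (a \<otimes> r)}"
      "y \<in> {x \<in> carrier R. \<exists>r\<in>carrier R. ring_cong R J x (a \<otimes> r)}" for x y
  proof -
    obtain r s where "r \<in> carrier R" "s \<in> carrier R" "ring_cong R J x (a \<otimes> r)" "ring_cong R J y (a \<otimes> s)"
      using xy by auto
    then have "ring_cong R J (x \<oplus> y) (a \<otimes> (r \<oplus> s))" "r \<oplus> s \<in> carrier R"
      using ring_cong_add[OF J] assms by (auto simp: r_distr)
    then show ?thesis using xy by blast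
  qed
  show "x \<otimes> s \<in> {x \<in> carrier R. \<exists>r\<in>carrier R. ring_cong R J x (a \<otimes> r)}"
    if s: "s \<in> carrier R" and x: "x \<in> {x \<in> carrier R. \<exists>r\<in>carrier R. ring_cong R J x (a \<otimes> r)}" for s x
  proof -
    obtain r where "r \<in> carrier R" "ring_cong R J x (a \<otimes> r)" using x by auto
    then have "ring_cong R J (x \<otimes> s) (a \<otimes> (r \<otimes> s))" "r \<otimes> s \<in> carrier R"
      using ring_cong_mult[OF J _ ring_cong_refl[OF J s]] assms s by (auto simp flip: m_assoc)
    then show ?thesis using x s by blast
  qed
qed auto

text \<open>\<open>R/J\<close> is von Neumann regular: the idempotent generator \<open>e\<close> of
  \<open>aR + J\<close> satisfies \<open>e \<equiv> a c\<close> for some \<open>c\<close>, and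
  \<open>a \<equiv> e a \<equiv> a c a\<close>.\<close>

lemma semisimple_regular:
  assumes ss: "semisimple_modulo R J" and a: "a \<in> carrier R"
  shows "\<exists>c\<in>carrier R. ring_cong R J (a \<otimes> c \<otimes> a) a"
proof -
  let ?C = "{x \<in> carrier R. \<exists>r\<in>carrier R. ring_cong R J x (a \<otimes> r)}"
  have "J \<subseteq> ?C"
  proof
    fix j assume "j \<in> J"
    then have "ring_cong R J j (a \<otimes> \<zero>)" using a by (simp add: ring_cong_zero_iff[OF J])
    then show "j \<in> ?C" using ring_cong_carrier by blast
  qed
  then obtain e where e: "e \<in> ?C" "\<forall>c\<in>?C. c \<ominus> e \<otimes> c \<in> J"
    using ss[unfolded semisimple_modulo_def, rule_format, OF conjI, OF right_ideal_add_principal[OF a]] by blast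
  then obtain c where c: "c \<in> carrier R" "ring_cong R J e (a \<otimes> c)" by blast
  have "a \<in> ?C"
    using a ring_cong_refl[OF J a] by (intro CollectI conjI bexI[of _ \<one>]) simp_all
  then have "a \<ominus> e \<otimes> a \<in> J" using e(2) by blast
  then have "ring_cong R J a (e \<otimes> a)" using e(1) a by (simp add: ring_cong_def)
  also have "ring_cong R J (e \<otimes> a) (a \<otimes> c \<otimes> a)"
    by (intro ring_cong_mult[OF J] ring_cong_refl[OF J] a c)
  finally (ring_cong_trans[OF J]) show ?thesis using c ring_cong_sym[OF J] by blast
qed

text \<open>The union of the chain is generated modulo \<open>J\<close> by a single
  \<open>e\<close>, which already lies in some \<open>H m\<close>.\<close>

lemma semisimple_acc:
  assumes ss: "semisimple_modulo R J" and H: "\<And>n. right_ideal (H n) R" "\<And>n. J \<subseteq> H n" "mono H"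
  shows "\<exists>m::nat. \<forall>n\<ge>m. H n = H m"
proof -
  have U: "right_ideal (\<Union>n. H n) R" by (intro right_ideal_UN_mono H)
  moreover have "J \<subseteq> (\<Union>n. H n)" using H(2) by blast
  ultimately obtain e where e: "e \<in> (\<Union>n. H n)" "\<forall>c\<in>(\<Union>n. H n). c \<ominus> e \<otimes> c \<in> J"
    using ss unfolding semisimple_modulo_def by blast
  then obtain m where m: "e \<in> H m" by blast
  have "x \<in> H m" if x: "x \<in> H n" for n x
  proof -
    have "x \<in> carrier R" "e \<in> carrier R" using x m right_ideal_carrier[OF H(1)] by blast+
    then show ?thesis
      using x e m by (intro right_ideal_cong_mem[OF H(1,2), of x "e \<otimes> x"] right_ideal_mult[OF H(1)])
        (auto simp: ring_cong_def)
  qed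
  then show ?thesis using monoD[OF H(3)] by blast
qed

text \<open>The element \<open>y = (1 - e) c\<close> is nonzero modulo \<open>J\<close> and
  annihilated by \<open>e\<close> from the left. A quasi-inverse \<open>d\<close> of
  \<open>y\<close> turns it into an idempotent.\<close>

lemma regular_orthogonal_idempotent:
  assumes reg: "\<And>a. a \<in> carrier R \<Longrightarrow> \<exists>c\<in>carrier R. ring_cong R J (a \<otimes> c \<otimes> a) a"
    and C: "right_ideal C R" and e: "e \<in> C" "ring_cong R J (e \<otimes> e) e"
    and c: "c \<in> C" "c \<ominus> e \<otimes> c \<notin> J"
  shows "\<exists>g\<in>C. g \<notin> J \<and> ring_cong R J (g \<otimes> g) g \<and> ring_cong R J (e \<otimes> g) \<zero> \<and> ring_cong R J (g \<otimes> e) \<zero>"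
proof -
  note C' = right_ideal_one_sided[OF C]
  define y where "y = c \<ominus> e \<otimes> c"
  have ec: "e \<in> carrier R" "c \<in> carrier R" using e c right_ideal_carrier[OF C] by auto
  then have yC: "y \<in> C" and yc: "y \<in> carrier R" using C' e c by (auto simp: y_def)
  obtain d where d: "d \<in> carrier R" "ring_cong R J (y \<otimes> d \<otimes> y) y" using reg[OF yc] by blast
  \<comment> \<open>\<open>y d\<close> is idempotent modulo \<open>J\<close> and annihilated by
    \<open>e\<close> from the left; the factor \<open>1 - e\<close> on the right gives orthogonality
    on the other side. As \<open>g y \<equiv> y\<close>, the result is not in
    \<open>J\<close>.\<close>
  define g where "g = y \<otimes> d \<ominus> y \<otimes> d \<otimes> e"
  have gC: "g \<in> C" and gc: "g \<in> carrier R" using C' yC d ec yc by (auto simp: g_def)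
  have ey: "ring_cong R J (e \<otimes> y) \<zero>"
  proof -
    have "e \<otimes> y = e \<otimes> c \<ominus> e \<otimes> e \<otimes> c" unfolding y_def using ec by algebra
    also have "ring_cong R J \<dots> (e \<otimes> c \<ominus> e \<otimes> c)"
      by (intro ring_cong_diff[OF J] ring_cong_mult[OF J] ring_cong_refl[OF J] ec e m_closed)
    also have "e \<otimes> c \<ominus> e \<otimes> c = \<zero>" using ec by algebra
    finally show ?thesis .
  qed
  have ge: "ring_cong R J (g \<otimes> e) \<zero>"
  proof -
    have "g \<otimes> e = y \<otimes> d \<otimes> e \<ominus> y \<otimes> d \<otimes> (e \<otimes> e)" unfolding g_def using ec yc d(1) by algebra
    also have "ring_cong R J \<dots> (y \<otimes> d \<otimes> e \<ominus> y \<otimes> d \<otimes> e)"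
      by (intro ring_cong_diff[OF J] ring_cong_mult[OF J] ring_cong_refl[OF J] ec e m_closed yc d)
    also have "y \<otimes> d \<otimes> e \<ominus> y \<otimes> d \<otimes> e = \<zero>" using ec yc d(1) by algebra
    finally show ?thesis .
  qed
  have eg: "ring_cong R J (e \<otimes> g) \<zero>"
  proof -
    have "e \<otimes> g = (e \<otimes> y) \<otimes> (d \<ominus> d \<otimes> e)" unfolding g_def using ec yc d(1) by algebra
    also have "ring_cong R J \<dots> (\<zero> \<otimes> (d \<ominus> d \<otimes> e))"
      using d(1) ec by (intro ring_cong_mult[OF J ey] ring_cong_refl[OF J]) auto
    also have "\<zero> \<otimes> (d \<ominus> d \<otimes> e) = \<zero>" using d(1) ec by simp
    finally show ?thesis .
  qed
  have gy: "ring_cong R J (g \<otimes> y) y"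
  proof -
    have "g \<otimes> y = y \<otimes> d \<otimes> y \<ominus> y \<otimes> d \<otimes> (e \<otimes> y)" unfolding g_def using ec yc d(1) by algebra
    also have "ring_cong R J \<dots> (y \<ominus> y \<otimes> d \<otimes> \<zero>)"
      by (intro ring_cong_diff[OF J] ring_cong_mult[OF J] ring_cong_refl[OF J] ey d m_closed yc)
    also have "y \<ominus> y \<otimes> d \<otimes> \<zero> = y" using yc d(1) by algebra
    finally show ?thesis .
  qed
  have "ring_cong R J (g \<otimes> g) g"
  proof -
    have "g \<otimes> g = (g \<otimes> y) \<otimes> (d \<ominus> d \<otimes> e)"
      by (subst (2) g_def) (use ec yc gc d(1) in algebra)
    also have "ring_cong R J \<dots> (y \<otimes> (d \<ominus> d \<otimes> e))"
      using d(1) ec by (intro ring_cong_mult[OF J gy] ring_cong_refl[OF J]) auto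
    also have "y \<otimes> (d \<ominus> d \<otimes> e) = g" unfolding g_def using ec yc d(1) by algebra
    finally show ?thesis .
  qed
  moreover have "g \<notin> J"
  proof
    assume "g \<in> J"
    then have "g \<otimes> y \<in> J" using J_closed yc by simp
    then show False using ring_cong_mem[OF J ring_cong_sym[OF J gy]] c y_def by blast
  qed
  ultimately show ?thesis using gC eg ge by blast
qed

text \<open>\<open>f n\<close> is the sum of the first \<open>n\<close> idempotents
  \<open>g\<close>. Only regularity is assumed, so the lemma also applies where semisimplicity is
  still to be proved by contradiction.\<close>

lemma orthogonal_idempotent_sequence:
  assumes reg: "\<And>a. a \<in> carrier R \<Longrightarrow> \<exists>c\<in>carrier R. ring_cong R J (a \<otimes> c \<otimes> a) a"
    and C: "right_ideal C R" and no: "\<And>e. e \<in> C \<Longrightarrow> \<exists>c\<in>C. c \<ominus> e \<otimes> c \<notin> J"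
  shows "\<exists>f g. f 0 = \<zero> \<and> (\<forall>n. f n \<in> C \<and> g n \<in> C \<and> g n \<notin> J \<and> ring_cong R J (g n \<otimes> g n) (g n) \<and>
    ring_cong R J (f n \<otimes> g n) \<zero> \<and> ring_cong R J (g n \<otimes> f n) \<zero> \<and> f (Suc n) = f n \<oplus> g n)"
proof -
  note Cc = subsetD[OF right_ideal_carrier[OF C]]
  define P where "P e \<longleftrightarrow> e \<in> C \<and> ring_cong R J (e \<otimes> e) e" for e
  define Q where "Q e e' \<longleftrightarrow> (\<exists>g. g \<in> C \<and> g \<notin> J \<and> ring_cong R J (g \<otimes> g) g \<and> ring_cong R J (e \<otimes> g) \<zero> \<and>
    ring_cong R J (g \<otimes> e) \<zero> \<and> e' = e \<oplus> g)" for e e'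
  have "\<exists>f. \<forall>n::nat. (P (f n) \<and> (n = 0 \<longrightarrow> f n = \<zero>)) \<and> Q (f n) (f (Suc n))"
  proof (rule dependent_nat_choice)
    show "\<exists>e. P e \<and> (0 = 0 \<longrightarrow> e = \<zero>)"
      unfolding P_def using right_ideal_zero[OF C] ring_cong_refl[OF J] by (intro exI[of _ \<zero>]) auto
    fix e and n :: nat assume "P e \<and> (n = 0 \<longrightarrow> e = \<zero>)"
    then have e: "e \<in> C" "ring_cong R J (e \<otimes> e) e" by (auto simp: P_def)
    obtain c where "c \<in> C" "c \<ominus> e \<otimes> c \<notin> J" using no[OF e(1)] by blast
    then obtain g where g: "g \<in> C" "g \<notin> J" "ring_cong R J (g \<otimes> g) g" "ring_cong R J (e \<otimes> g) \<zero>"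
      "ring_cong R J (g \<otimes> e) \<zero>"
      using regular_orthogonal_idempotent[OF reg C e] by blast
    have c: "e \<in> carrier R" "g \<in> carrier R" using e g Cc by auto
    have "(e \<oplus> g) \<otimes> (e \<oplus> g) = (e \<otimes> e \<oplus> e \<otimes> g) \<oplus> (g \<otimes> e \<oplus> g \<otimes> g)" using c by algebra
    also have "ring_cong R J \<dots> ((e \<oplus> \<zero>) \<oplus> (\<zero> \<oplus> g))" by (intro ring_cong_add[OF J] e g)
    finally have "ring_cong R J ((e \<oplus> g) \<otimes> (e \<oplus> g)) (e \<oplus> g)" using c by simp
    moreover have "e \<oplus> g \<in> C" by (rule right_ideal_add[OF C e(1) g(1)])
    ultimately show "\<exists>e'. (P e' \<and> (Suc n = 0 \<longrightarrow> e' = \<zero>)) \<and> Q e e'" unfolding P_def Q_def using g by blast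
  qed
  then obtain f where f: "\<And>n. P (f n)" "f 0 = \<zero>" and Q: "\<forall>n. Q (f n) (f (Suc n))" by blast
  have "\<exists>g. \<forall>n. g n \<in> C \<and> g n \<notin> J \<and> ring_cong R J (g n \<otimes> g n) (g n) \<and> ring_cong R J (f n \<otimes> g n) \<zero> \<and>
    ring_cong R J (g n \<otimes> f n) \<zero> \<and> f (Suc n) = f n \<oplus> g n"
    using choice[OF Q[unfolded Q_def]] .
  then show ?thesis using f unfolding P_def by blast
qed

end

text \<open>Regularity is left-right symmetric. A left ideal without idempotent generator yields
  infinitely many orthogonal idempotents, and these contradict the ascending chain condition for
  right ideals above \<open>J\<close>.\<close>

lemma semisimple_opposite:
  assumes J: "two_sided_ideal J R" and ss: "semisimple_modulo R J"
  shows "semisimple_modulo (opposite_ring R) J"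
  unfolding semisimple_modulo_def
proof (intro allI impI, rule ccontr)
  fix L assume L: "left_ideal L R \<and> J \<subseteq> L"
  assume "\<not> (\<exists>e\<in>L. \<forall>c\<in>L. c \<ominus>\<^bsub>opposite_ring R\<^esub> e \<otimes>\<^bsub>opposite_ring R\<^esub> c \<in> J)"
  then have no: "\<exists>c\<in>L. c \<ominus> c \<otimes> e \<notin> J" if "e \<in> L" for e using that by auto
  note Lc = subsetD[OF left_ideal_carrier[OF conjunct1[OF L]]]
  interpret O: ring "opposite_ring R" by (rule ring_opposite)
  have reg: "\<exists>c\<in>carrier R. ring_cong R J (a \<otimes> (c \<otimes> a)) a" if "a \<in> carrier R" for a
    using semisimple_regular[OF J ss that] that by (auto simp: m_assoc)
  have "\<exists>f g. f 0 = \<zero> \<and> (\<forall>n. f n \<in> L \<and> g n \<in> L \<and> g n \<notin> J \<and> ring_cong R J (g n \<otimes> g n) (g n) \<and>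
    ring_cong R J (g n \<otimes> f n) \<zero> \<and> ring_cong R J (f n \<otimes> g n) \<zero> \<and> f (Suc n) = f n \<oplus> g n)"
    using O.orthogonal_idempotent_sequence[of J L] J L reg no by simp
  then obtain f g where fL: "\<And>n. f n \<in> L" and g: "\<And>n. g n \<in> L" "\<And>n. g n \<notin> J"
    "\<And>n. ring_cong R J (g n \<otimes> g n) (g n)" "\<And>n. ring_cong R J (f n \<otimes> g n) \<zero>"
    "\<And>n. ring_cong R J (g n \<otimes> f n) \<zero>" "\<And>n. f (Suc n) = f n \<oplus> g n" by blast
  have gc: "g n \<in> carrier R" for n using g(1) Lc by blast
  \<comment> \<open>The right ideal fixed by \<open>f n\<close> modulo \<open>J\<close>. It grows
    with \<open>n\<close> because \<open>g n\<close> annihilates it, and \<open>g n\<close> itself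
    enters exactly at the next stage.\<close>
  define H where "H n = {x \<in> carrier R. ring_cong R J (f n \<otimes> x) x}" for n
  have fc: "f n \<in> carrier R" for n using fL Lc by blast
  have Hr: "right_ideal (H n) R" for n
  proof (rule right_idealI)
    show "x \<oplus> y \<in> H n" if "x \<in> H n" "y \<in> H n" for x y
      using that ring_cong_add[OF J] fc by (auto simp: H_def r_distr)
    show "x \<otimes> r \<in> H n" if "r \<in> carrier R" "x \<in> H n" for x r
      using that ring_cong_mult[OF J _ ring_cong_refl[OF J, of r]] fc by (auto simp: H_def simp flip: m_assoc)
  qed (use fc ring_cong_refl[OF J] in \<open>auto simp: H_def\<close>)
  have HJ: "J \<subseteq> H n" for n
    using J_carrier[OF J] J_closed[OF J] fc by (auto simp: H_def ring_cong_def)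
  have step: "H n \<subseteq> H (Suc n)" "\<exists>g\<in>H (Suc n). g \<notin> H n" for n
  proof -
    show "H n \<subseteq> H (Suc n)"
    proof
      fix x assume x: "x \<in> H n"
      then have xc: "x \<in> carrier R" and fx: "ring_cong R J (f n \<otimes> x) x" by (auto simp: H_def)
      have "ring_cong R J (g n \<otimes> x) (g n \<otimes> (f n \<otimes> x))"
        by (intro ring_cong_mult[OF J ring_cong_refl[OF J gc] ring_cong_sym[OF J fx]])
      also have "g n \<otimes> (f n \<otimes> x) = (g n \<otimes> f n) \<otimes> x" using gc[of n] xc fc[of n] by algebra
      also have "ring_cong R J \<dots> (\<zero> \<otimes> x)" by (intro ring_cong_mult[OF J g(5)] ring_cong_refl[OF J xc])
      finally (ring_cong_trans[OF J]) have "ring_cong R J (g n \<otimes> x) \<zero>" using xc by simp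
      then have "ring_cong R J (f n \<otimes> x \<oplus> g n \<otimes> x) (x \<oplus> \<zero>)" by (intro ring_cong_add[OF J] fx)
      then show "x \<in> H (Suc n)" using xc gc fc g(6) by (simp add: H_def l_distr)
    qed
    have "ring_cong R J (f n \<otimes> g n \<oplus> g n \<otimes> g n) (\<zero> \<oplus> g n)" by (intro ring_cong_add[OF J] g)
    then have "g n \<in> H (Suc n)" using gc fc g(6) by (simp add: H_def l_distr)
    moreover have "g n \<notin> H n"
    proof
      assume "g n \<in> H n"
      then have "ring_cong R J (g n) (f n \<otimes> g n)" using ring_cong_sym[OF J] by (simp add: H_def)
      then have "ring_cong R J (g n) \<zero>" using ring_cong_trans[OF J] g(4) by blast
      then show False using g(2) ring_cong_zero_iff[OF J] by blast
    qed
    ultimately show "\<exists>g\<in>H (Suc n). g \<notin> H n" by blast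
  qed
  have "\<exists>m. \<forall>n\<ge>m. H n = H m"
    using step(1) by (intro semisimple_acc[OF J ss Hr HJ]) (simp add: mono_iff_le_Suc)
  then show False using step(2) by (metis le_SucI order_refl)
qed

text \<open>Passing to left annihilators modulo \<open>J\<close> turns a descending chain of right
  ideals into an ascending chain of left ideals, which stabilises by symmetry.\<close>

lemma semisimple_dcc:
  assumes J: "two_sided_ideal J R" and ss: "semisimple_modulo R J"
    and H: "\<And>n. right_ideal (H n) R" "\<And>n. J \<subseteq> H n" "\<And>n. H (Suc n) \<subseteq> H n"
  shows "\<exists>m::nat. \<forall>n\<ge>m. H n = H m"
proof -
  interpret O: ring "opposite_ring R" by (rule ring_opposite)
  note Hc = subsetD[OF right_ideal_carrier[OF H(1)]]
  define D where "D n = {x \<in> carrier R. \<forall>h\<in>H n. x \<otimes> h \<in> J}" for n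
  have "\<exists>m. \<forall>n\<ge>m. D n = D m"
  proof (rule O.semisimple_acc)
    show "left_ideal (D n) R" for n
      using Hc[of _ n] J_closed[OF J] by (intro left_idealI) (auto simp: D_def l_distr m_assoc)
    show "J \<subseteq> D n" for n using Hc[of _ n] J_closed[OF J] J_carrier[OF J] by (auto simp: D_def)
    show "mono D" using H(3) by (force simp: mono_iff_le_Suc D_def)
    show "semisimple_modulo (opposite_ring R) J" by (rule semisimple_opposite[OF J ss])
  qed (simp add: J)
  then obtain m where m: "D n = D m" if "n \<ge> m" for n by blast
  have "H n = H m" if n: "n \<ge> m" for n
  proof
    show "H n \<subseteq> H m" using lift_Suc_antimono_le[of H, OF H(3) n] .
    obtain e where e: "e \<in> H n" "\<forall>c\<in>H n. c \<ominus> e \<otimes> c \<in> J"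
      using ss H unfolding semisimple_modulo_def by blast
    have ec: "e \<in> carrier R" using e Hc by blast
    have "(\<one> \<ominus> e) \<otimes> c = c \<ominus> e \<otimes> c" if "c \<in> carrier R" for c using that ec by algebra
    \<comment> \<open>With \<open>e\<close> generating \<open>H n\<close> modulo \<open>J\<close>,
      the element \<open>1 - e\<close> annihilates \<open>H n\<close> and therefore the larger
      \<open>H m\<close>, which means \<open>h \<equiv> e h\<close> there.\<close>
    then have "\<one> \<ominus> e \<in> D m" using e(2) ec Hc m[OF n, symmetric] by (auto simp: D_def)
    then have *: "h \<ominus> e \<otimes> h \<in> J" if "h \<in> H m" for h
      using that Hc[OF that] ec by (auto simp: D_def l_distr a_minus_def l_minus)
    show "H m \<subseteq> H n"
    proof
      fix h assume h: "h \<in> H m"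
      then have "ring_cong R J h (e \<otimes> h)" using * Hc[OF h] ec by (simp add: ring_cong_def)
      then show "h \<in> H n"
        by (rule right_ideal_cong_mem[OF J H(1,2)]) (rule right_ideal_mult[OF H(1) Hc[OF h] e(1)])
    qed
  qed
  then show ?thesis by blast
qed

end

lemma dcc_imp_minimal:
  assumes A: "A \<in> F"
    and dcc: "\<And>f. (\<And>n::nat. f n \<in> F) \<Longrightarrow> (\<And>n. f (Suc n) \<subseteq> f n) \<Longrightarrow> \<exists>m. \<forall>n\<ge>m. f n = f m"
  shows "\<exists>M\<in>F. \<forall>X\<in>F. X \<subseteq> M \<longrightarrow> X = M"
proof (rule ccontr)
  assume *: "\<not> ?thesis"
  have "\<exists>f. \<forall>n::nat. f n \<in> F \<and> f (Suc n) \<subset> f n"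
  proof (rule dependent_nat_choice)
    show "\<exists>x. x \<in> F" using A by blast
    show "\<exists>y. y \<in> F \<and> y \<subset> x" if "x \<in> F" for x
    proof -
      have "\<not> (\<forall>X\<in>F. X \<subseteq> x \<longrightarrow> X = x)" using * \<open>x \<in> F\<close> by auto
      then show ?thesis by (auto simp: psubset_eq)
    qed
  qed
  then obtain f where f: "\<And>n::nat. f n \<in> F" "\<And>n. f (Suc n) \<subset> f n" by blast
  have "\<exists>m. \<forall>n\<ge>m. f n = f m"
  proof (rule dcc)
    show "f n \<in> F" "f (Suc n) \<subseteq> f n" for n using f[of n] by simp_all
  qed
  then obtain m where "\<forall>n\<ge>m. f n = f m" by blast
  then have "f (Suc m) = f m" using le_SucI[OF order_refl, of m] by blast
  then show False using f(2)[of m] by blast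
qed

subsection \<open>Annihilators in right self-injective rings\<close>

context ring
begin

context
  assumes baer: "baer_injective R"
begin

text \<open>By \<open>ann\<close> the assignment \<open>x r + t \<mapsto> k r\<close> is well
  defined on \<open>xR + T\<close>; its multiplier kills \<open>T\<close> and sends \<open>x\<close>
  to \<open>k\<close>.\<close>

lemma baer_principal_modulo:
  assumes T: "right_ideal T R" and x: "x \<in> carrier R" and k: "k \<in> carrier R"
    and ann: "\<And>r. r \<in> carrier R \<Longrightarrow> x \<otimes> r \<in> T \<Longrightarrow> k \<otimes> r = \<zero>"
  shows "\<exists>c\<in>left_annihilator R T. k = c \<otimes> x"
proof -
  note Tc = subsetD[OF right_ideal_carrier[OF T]]
  let ?G = "{(x \<otimes> r \<oplus> t, k \<otimes> r) | r t. r \<in> carrier R \<and> t \<in> T}"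
  have "\<exists>c\<in>carrier R. \<forall>u y. (u, y) \<in> ?G \<longrightarrow> y = c \<otimes> u"
  proof (rule baer_injectiveD[OF baer, of ?G])
    show "(u \<oplus> u', y \<oplus> y') \<in> ?G" if uy: "(u, y) \<in> ?G" "(u', y') \<in> ?G" for u y u' y'
    proof -
      obtain r t r' t' where e: "r \<in> carrier R" "t \<in> T" "r' \<in> carrier R" "t' \<in> T"
        "u = x \<otimes> r \<oplus> t" "y = k \<otimes> r" "u' = x \<otimes> r' \<oplus> t'" "y' = k \<otimes> r'" using uy by auto
      then have "u \<oplus> u' = x \<otimes> (r \<oplus> r') \<oplus> (t \<oplus> t')" "y \<oplus> y' = k \<otimes> (r \<oplus> r')"
        using Tc x k by (simp_all add: a_ac r_distr)
      moreover have "r \<oplus> r' \<in> carrier R" "t \<oplus> t' \<in> T" using e right_ideal_add[OF T] by auto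
      ultimately show ?thesis by blast
    qed
    show "(u \<otimes> s, y \<otimes> s) \<in> ?G" if uy: "(u, y) \<in> ?G" and s: "s \<in> carrier R" for u y s
    proof -
      obtain r t where e: "r \<in> carrier R" "t \<in> T" "u = x \<otimes> r \<oplus> t" "y = k \<otimes> r" using uy by auto
      then have "u \<otimes> s = x \<otimes> (r \<otimes> s) \<oplus> t \<otimes> s" "y \<otimes> s = k \<otimes> (r \<otimes> s)"
        using Tc x k s by (simp_all add: l_distr m_assoc)
      moreover have "r \<otimes> s \<in> carrier R" "t \<otimes> s \<in> T" using e s right_ideal_mult[OF T] by auto
      ultimately show ?thesis by blast
    qed
    show "(\<zero>, \<zero>) \<in> ?G" using x k right_ideal_zero[OF T] by (intro CollectI exI[of _ \<zero>]) simp
    show "?G \<subseteq> carrier R \<times> carrier R" using x k Tc by auto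
    show "y = \<zero>" if y: "(\<zero>, y) \<in> ?G" for y
    proof -
      obtain r t where e: "r \<in> carrier R" "t \<in> T" "\<zero> = x \<otimes> r \<oplus> t" "y = k \<otimes> r" using y by auto
      then have "\<ominus> t = x \<otimes> r" using x Tc by (intro minus_equality) auto
      then have "x \<otimes> r \<in> T" using e right_ideal_minus[OF T] by metis
      then show ?thesis using e ann by simp
    qed
  qed
  then obtain c where c: "c \<in> carrier R" "\<And>u y. (u, y) \<in> ?G \<Longrightarrow> y = c \<otimes> u" by blast
  have "c \<otimes> t = \<zero>" if "t \<in> T" for t
  proof -
    have "(t, \<zero>) \<in> ?G" using that x k Tc by (intro CollectI exI[of _ \<zero>] exI[of _ t]) simp
    then have "\<zero> = c \<otimes> t" by (rule c(2))
    then show ?thesis by simp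
  qed
  moreover have "(x, k) \<in> ?G"
    using x k right_ideal_zero[OF T] by (intro CollectI exI[of _ \<one>] exI[of _ \<zero>]) simp
  then have "k = c \<otimes> x" by (rule c(2))
  ultimately show ?thesis using c(1) by (intro bexI[of _ c]) (auto simp: left_annihilator_def)
qed

lemma baer_principal:
  assumes "a \<in> carrier R" "b \<in> carrier R"
    and "\<And>x. x \<in> carrier R \<Longrightarrow> a \<otimes> x = \<zero> \<Longrightarrow> b \<otimes> x = \<zero>"
  shows "\<exists>c\<in>carrier R. b = c \<otimes> a"
  using baer_principal_modulo[OF right_ideal_of_zero assms(1,2)] assms(3) by (auto simp: left_annihilator_def)

text \<open>Since \<open>x\<close> kills \<open>A \<inter> B\<close>, the assignment
  \<open>a + b \<mapsto> x a\<close> is well defined on \<open>A + B\<close>. Its multiplier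
  \<open>c\<close> kills \<open>B\<close>, and \<open>x - c\<close> kills \<open>A\<close>.\<close>

lemma baer_left_annihilator_Int:
  assumes A: "right_ideal A R" and B: "right_ideal B R"
    and x: "x \<in> left_annihilator R (A \<inter> B)"
  shows "\<exists>y\<in>left_annihilator R A. \<exists>z\<in>left_annihilator R B. x = y \<oplus> z"
proof -
  note Ac = subsetD[OF right_ideal_carrier[OF A]] and Bc = subsetD[OF right_ideal_carrier[OF B]]
  have xc: "x \<in> carrier R" and xAB: "\<And>t. t \<in> A \<Longrightarrow> t \<in> B \<Longrightarrow> x \<otimes> t = \<zero>"
    using x by (auto simp: left_annihilator_def)
  let ?G = "{(a \<oplus> b, x \<otimes> a) | a b. a \<in> A \<and> b \<in> B}"
  have "\<exists>c\<in>carrier R. \<forall>u y. (u, y) \<in> ?G \<longrightarrow> y = c \<otimes> u"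
  proof (rule baer_injectiveD[OF baer, of ?G])
    show "(u \<oplus> u', y \<oplus> y') \<in> ?G" if uy: "(u, y) \<in> ?G" "(u', y') \<in> ?G" for u y u' y'
    proof -
      obtain a b a' b' where e: "a \<in> A" "b \<in> B" "a' \<in> A" "b' \<in> B" "u = a \<oplus> b" "y = x \<otimes> a"
        "u' = a' \<oplus> b'" "y' = x \<otimes> a'" using uy by auto
      then have "u \<oplus> u' = (a \<oplus> a') \<oplus> (b \<oplus> b')" "y \<oplus> y' = x \<otimes> (a \<oplus> a')"
        using Ac Bc xc by (simp_all add: a_ac r_distr)
      then show ?thesis using e right_ideal_add[OF A] right_ideal_add[OF B] by blast
    qed
    show "(u \<otimes> s, y \<otimes> s) \<in> ?G" if uy: "(u, y) \<in> ?G" and s: "s \<in> carrier R" for u y s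
    proof -
      obtain a b where e: "a \<in> A" "b \<in> B" "u = a \<oplus> b" "y = x \<otimes> a" using uy by auto
      then have "u \<otimes> s = a \<otimes> s \<oplus> b \<otimes> s" "y \<otimes> s = x \<otimes> (a \<otimes> s)"
        using Ac Bc xc s by (simp_all add: l_distr m_assoc)
      then show ?thesis using e s right_ideal_mult[OF A] right_ideal_mult[OF B] by blast
    qed
    show "(\<zero>, \<zero>) \<in> ?G" using xc right_ideal_zero[OF A] right_ideal_zero[OF B]
      by (intro CollectI exI[of _ \<zero>]) simp
    show "?G \<subseteq> carrier R \<times> carrier R" using xc Ac Bc by auto
    show "y = \<zero>" if y: "(\<zero>, y) \<in> ?G" for y
    proof -
      obtain a b where e: "a \<in> A" "b \<in> B" "\<zero> = a \<oplus> b" "y = x \<otimes> a" using y by auto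
      then have "b \<oplus> a = \<zero>" using Ac Bc by (metis a_comm)
      then have "\<ominus> b = a" using e Ac Bc by (metis minus_equality minus_minus)
      then have "a \<in> B" using e right_ideal_minus[OF B] by metis
      then show ?thesis using e xAB by simp
    qed
  qed
  then obtain c where c: "c \<in> carrier R" "\<And>u y. (u, y) \<in> ?G \<Longrightarrow> y = c \<otimes> u" by blast
  have cb: "c \<otimes> b = \<zero>" if "b \<in> B" for b
  proof -
    have "(b, \<zero>) \<in> ?G" using that xc Bc right_ideal_zero[OF A] by (intro CollectI exI[of _ \<zero>] exI[of _ b]) simp
    then have "\<zero> = c \<otimes> b" by (rule c(2))
    then show ?thesis by simp
  qed
  have ca: "c \<otimes> a = x \<otimes> a" if "a \<in> A" for a
  proof -
    have "(a, x \<otimes> a) \<in> ?G" using that Ac right_ideal_zero[OF B] by (intro CollectI exI[of _ a] exI[of _ \<zero>]) simp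
    then have "x \<otimes> a = c \<otimes> a" by (rule c(2))
    then show ?thesis by simp
  qed
  have "x \<ominus> c \<in> left_annihilator R A"
    unfolding left_annihilator_def
  proof (intro CollectI conjI ballI)
    fix a assume a: "a \<in> A"
    have "(x \<ominus> c) \<otimes> a = x \<otimes> a \<ominus> c \<otimes> a" using xc c(1) Ac[OF a] by algebra
    then show "(x \<ominus> c) \<otimes> a = \<zero>" using ca[OF a] xc Ac[OF a] by simp
  qed (use xc c(1) in simp)
  moreover have "c \<in> left_annihilator R B" using c(1) cb by (simp add: left_annihilator_def)
  moreover have "x = (x \<ominus> c) \<oplus> c" using xc c(1) by algebra
  ultimately show ?thesis by blast
qed

text \<open>This is \<open>l(r(F)) \<subseteq> RF\<close> for finite \<open>F\<close>: the
  intersection lemma splits \<open>l(r(a) \<inter> r(F))\<close> into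
  \<open>l(r(a)) + l(r(F))\<close>, and \<open>l(r(a)) = Ra\<close> is the principal case.\<close>

lemma baer_finite_left_annihilator:
  assumes "finite F" "F \<subseteq> carrier R" "b \<in> carrier R"
    and "\<And>x. x \<in> carrier R \<Longrightarrow> (\<And>a. a \<in> F \<Longrightarrow> a \<otimes> x = \<zero>) \<Longrightarrow> b \<otimes> x = \<zero>"
  shows "b \<in> span (opposite_ring R) F"
  using assms
proof (induction F arbitrary: b rule: finite_induct)
  case empty
  \<comment> \<open>For the empty set every element is a solution; \<open>\<one>\<close> forces
    \<open>b = 0\<close>.\<close>
  then have "b \<otimes> \<one> = \<zero>" by blast
  then show ?case using empty ring.right_ideal_span[OF ring_opposite, of "{}"] left_ideal_zero by auto
next
  case (insert a F)
  let ?A = "right_annihilator R {a}" and ?B = "right_annihilator R F"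
  have c: "a \<in> carrier R" "F \<subseteq> carrier R" using insert by auto
  have sp: "left_ideal (span (opposite_ring R) (insert a F)) R"
    using ring.right_ideal_span[OF ring_opposite, of "insert a F"] insert(4) by simp
  note sub = ring.right_span_upper[OF ring_opposite, of "insert a F"]
  have "b \<in> left_annihilator R (?A \<inter> ?B)"
    unfolding left_annihilator_def right_annihilator_def
  proof (intro CollectI conjI ballI)
    fix x assume "x \<in> {x \<in> carrier R. \<forall>y\<in>{a}. y \<otimes> x = \<zero>} \<inter> {x \<in> carrier R. \<forall>y\<in>F. y \<otimes> x = \<zero>}"
    then show "b \<otimes> x = \<zero>" by (intro insert.prems(3)) auto
  qed (rule insert.prems(2))
  then obtain y z where yz: "y \<in> left_annihilator R ?A" "z \<in> left_annihilator R ?B" "b = y \<oplus> z"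
    using baer_left_annihilator_Int right_ideal_right_annihilator c by blast
  obtain d where d: "d \<in> carrier R" "y = d \<otimes> a"
    using baer_principal[OF c(1), of y] yz(1) by (auto simp: left_annihilator_def right_annihilator_def)
  have "z \<in> span (opposite_ring R) F"
    using yz(2) c by (intro insert.IH) (auto simp: left_annihilator_def right_annihilator_def)
  then have "z \<in> span (opposite_ring R) (insert a F)"
    using ring.right_span_mono[OF ring_opposite, of F "insert a F"] by blast
  moreover have "y \<in> span (opposite_ring R) (insert a F)"
    using d sub left_ideal_mult[OF sp] by auto
  ultimately show ?case using yz(3) left_ideal_add[OF sp] by auto
qed

end

end

text \<open>The common setting of both directions. \<open>J\<close> is a parameter because it is the
  radical of the opposite ring when only that ring is known to be right artinian. Essentiality is
  asked of \<open>l(J)\<close> and not of the socle, so that no simple submodules occur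
  here.\<close>

locale self_injective_semilocal = ring R for R (structure) +
  fixes J
  assumes J: "two_sided_ideal J R"
    and ss: "semisimple_modulo R J"
    and baer: "baer_injective R"
    and unit: "j \<in> J \<Longrightarrow> \<exists>u\<in>carrier R. (\<one> \<ominus> j) \<otimes> u = \<one> \<and> u \<otimes> (\<one> \<ominus> j) = \<one>"
    and essential: "b \<in> carrier R \<Longrightarrow> b \<noteq> \<zero> \<Longrightarrow> \<exists>r\<in>carrier R. b \<otimes> r \<noteq> \<zero> \<and> b \<otimes> r \<in> left_annihilator R J"
begin

section \<open>The annihilators of \<open>S = l(J)\<close> and the Kasch property\<close>

abbreviation S where "S \<equiv> left_annihilator R J"

lemmas Jc = J_carrier[OF J]
lemmas Jcl = J_closed[OF J]

lemma right_ideal_J: "right_ideal J R" and left_ideal_J: "left_ideal J R"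
  using J by (auto simp: two_sided_ideal_def)

lemma two_sided_S: "two_sided_ideal S R"
  unfolding two_sided_ideal_def
  using left_ideal_left_annihilator[of J] right_ideal_left_annihilator[OF left_ideal_J] two_sided_ideal_carrier[OF J]
  by blast

lemma S_carrier: "s \<in> S \<Longrightarrow> s \<in> carrier R" and S_J: "s \<in> S \<Longrightarrow> j \<in> J \<Longrightarrow> s \<otimes> j = \<zero>"
  by (auto simp: left_annihilator_def)

text \<open>Packages the complementary idempotent \<open>1 - e\<close> modulo \<open>J\<close>: it
  maps \<open>C\<close> into \<open>J\<close>, and \<open>e (1 - e)\<close> lies in \<open>J\<close>
  as the case \<open>c = e\<close> of the defining property.\<close>

lemma semisimple_complement:
  assumes C: "right_ideal C R" "J \<subseteq> C"
  shows "\<exists>e\<in>C. e \<in> carrier R \<and> (\<forall>c\<in>C. (\<one> \<ominus> e) \<otimes> c \<in> J) \<and> e \<otimes> (\<one> \<ominus> e) \<in> J"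
proof -
  obtain e where e: "e \<in> C" "\<forall>c\<in>C. c \<ominus> e \<otimes> c \<in> J" using ss C unfolding semisimple_modulo_def by blast
  note Cc = subsetD[OF right_ideal_carrier[OF C(1)]]
  have *: "(\<one> \<ominus> e) \<otimes> c = c \<ominus> e \<otimes> c" if "c \<in> C" for c using Cc[OF that] Cc[OF e(1)] by algebra
  have "e \<otimes> (\<one> \<ominus> e) = e \<ominus> e \<otimes> e" using Cc[OF e(1)] by algebra
  then show ?thesis using e * Cc by (intro bexI[of _ e]) auto
qed

text \<open>\<open>S J = 0\<close> holds by definition; this is the other order. The idea is to cut
  \<open>y\<close> down to a complement of \<open>r(a y)\<close>, where \<open>a\<close> becomes
  cancellable on the left, and to use that \<open>1 - b a\<close> is a unit.\<close>

lemma J_mult_S: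
  assumes a: "a \<in> J" and y: "y \<in> S"
  shows "a \<otimes> y = \<zero>"
proof -
  have ac: "a \<in> carrier R" and yc: "y \<in> carrier R" using a y Jc S_carrier by auto
  let ?C = "right_annihilator R {a \<otimes> y}"
  have C: "right_ideal ?C R" using ac yc by (intro right_ideal_right_annihilator) auto
  have "J \<subseteq> ?C" using Jc ac yc S_J[OF y] by (auto simp: right_annihilator_def m_assoc)
  then obtain e where e: "e \<in> ?C" "e \<in> carrier R" "\<And>c. c \<in> ?C \<Longrightarrow> (\<one> \<ominus> e) \<otimes> c \<in> J" "e \<otimes> (\<one> \<ominus> e) \<in> J"
    using semisimple_complement[OF C] by blast
  let ?d = "\<one> \<ominus> e"
  have dc: "?d \<in> carrier R" using e by simp
  \<comment> \<open>If \<open>a y d x = 0\<close>, then \<open>d x\<close> lies in \<open>?C\<close>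
    and, being in the image of the complement, in \<open>J\<close>, which \<open>y\<close>
    annihilates. So \<open>r(a y d) \<subseteq> r(y d)\<close>.\<close>
  have "\<exists>b\<in>carrier R. y \<otimes> ?d = b \<otimes> (a \<otimes> y \<otimes> ?d)"
  proof (rule baer_principal[OF baer])
    fix x assume x: "x \<in> carrier R" "a \<otimes> y \<otimes> ?d \<otimes> x = \<zero>"
    have dx: "?d \<otimes> x \<in> carrier R" using dc x by simp
    have "?d \<otimes> x \<in> ?C" using x ac yc dc by (simp add: right_annihilator_def m_assoc)
    then have "?d \<otimes> (?d \<otimes> x) \<in> J" by (rule e(3))
    moreover have "e \<otimes> ?d \<otimes> x \<in> J" using e(4) x Jcl by simp
    ultimately have "?d \<otimes> (?d \<otimes> x) \<oplus> e \<otimes> ?d \<otimes> x \<in> J" using Jcl by blast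
    moreover have "?d \<otimes> (?d \<otimes> x) \<oplus> e \<otimes> ?d \<otimes> x = ?d \<otimes> x" using e(2) x(1) by algebra
    ultimately have "?d \<otimes> x \<in> J" by simp
    then show "y \<otimes> ?d \<otimes> x = \<zero>" using S_J[OF y] yc dc x by (simp add: m_assoc)
  qed (use ac yc dc in auto)
  then obtain b where b: "b \<in> carrier R" "y \<otimes> ?d = b \<otimes> (a \<otimes> y \<otimes> ?d)" by blast
  \<comment> \<open>From \<open>y d = b a y d\<close> the unit \<open>1 - b a\<close> kills
    \<open>y d\<close>, so \<open>y = y e\<close> and \<open>a y = a y e = 0\<close>.\<close>
  have "b \<otimes> a \<in> J" using Jcl a b by simp
  then obtain u where u: "u \<in> carrier R" "u \<otimes> (\<one> \<ominus> b \<otimes> a) = \<one>" using unit by blast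
  let ?z = "y \<otimes> ?d"
  have zc: "?z \<in> carrier R" using yc dc by simp
  have "(\<one> \<ominus> b \<otimes> a) \<otimes> ?z = ?z \<ominus> b \<otimes> (a \<otimes> y \<otimes> ?d)" using b(1) ac yc dc by algebra
  also have "\<dots> = \<zero>" using b(2) zc by (metis minus_eq_zero_iff)
  finally have "u \<otimes> ((\<one> \<ominus> b \<otimes> a) \<otimes> ?z) = \<zero>" using u by simp
  moreover have "u \<otimes> ((\<one> \<ominus> b \<otimes> a) \<otimes> ?z) = ?z" using u b(1) ac zc by (simp flip: m_assoc)
  ultimately have "?z = \<zero>" by simp
  then have "y \<ominus> y \<otimes> e = \<zero>" using yc e(2) by (simp add: a_minus_def r_distr r_minus)
  then have "y = y \<otimes> e" using yc e(2) by simp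
  then have "a \<otimes> y = a \<otimes> y \<otimes> e" using ac yc e(2) by (metis m_assoc)
  then show ?thesis using e(1) by (simp add: right_annihilator_def)
qed

text \<open>Let \<open>e\<close> generate \<open>l(S)\<close> modulo \<open>J\<close>. Then
  \<open>1 - e\<close> has a left inverse, and \<open>(1 - e) e\<close> in \<open>J\<close> forces
  \<open>e\<close> and all of \<open>l(S)\<close> into \<open>J\<close>.\<close>

lemma left_annihilator_S: "left_annihilator R S = J"
proof
  let ?I = "left_annihilator R S"
  have tS: "right_ideal S R" "left_ideal S R" using two_sided_S by (auto simp: two_sided_ideal_def)
  have I: "right_ideal ?I R" using right_ideal_left_annihilator[OF tS(2)] .
  show JI: "J \<subseteq> ?I" using J_mult_S Jc by (auto simp: left_annihilator_def)
  then obtain e where e: "e \<in> ?I" "e \<in> carrier R" "\<And>c. c \<in> ?I \<Longrightarrow> (\<one> \<ominus> e) \<otimes> c \<in> J"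
    using semisimple_complement[OF I] by blast
  \<comment> \<open>\<open>r(1 - e)\<close> is zero: a nonzero \<open>b = e b\<close> would have a
    nonzero multiple in \<open>S\<close>, which \<open>e\<close> annihilates.\<close>
  have "\<exists>c\<in>carrier R. \<one> = c \<otimes> (\<one> \<ominus> e)"
  proof (rule baer_principal[OF baer])
    fix b assume b: "b \<in> carrier R" "(\<one> \<ominus> e) \<otimes> b = \<zero>"
    have "(\<one> \<ominus> e) \<otimes> b = b \<ominus> e \<otimes> b" using e(2) b(1) by algebra
    then have be: "b = e \<otimes> b" using b e(2) minus_eq_zero_iff[of b "e \<otimes> b"] by simp
    have "b = \<zero>"
    proof (rule ccontr)
      assume "b \<noteq> \<zero>"
      then obtain r where r: "r \<in> carrier R" "b \<otimes> r \<noteq> \<zero>" "b \<otimes> r \<in> S" using essential b by blast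
      have "b \<otimes> r = e \<otimes> (b \<otimes> r)" using be e(2) b r by (metis m_assoc)
      then show False using e(1) r by (simp add: left_annihilator_def)
    qed
    then show "\<one> \<otimes> b = \<zero>" using b by simp
  qed (use e in auto)
  then obtain c where c: "c \<in> carrier R" "\<one> = c \<otimes> (\<one> \<ominus> e)" by blast
  have "c \<otimes> ((\<one> \<ominus> e) \<otimes> e) \<in> J" using e(3)[OF e(1)] c Jcl by simp
  moreover have "c \<otimes> ((\<one> \<ominus> e) \<otimes> e) = (c \<otimes> (\<one> \<ominus> e)) \<otimes> e" using c(1) e(2) by algebra
  ultimately have eJ: "e \<in> J" using c(2) e(2) by simp
  show "?I \<subseteq> J"
  proof
    fix x assume x: "x \<in> ?I"
    then have xc: "x \<in> carrier R" by (simp add: left_annihilator_def)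
    have "(\<one> \<ominus> e) \<otimes> x \<oplus> e \<otimes> x \<in> J" using e(3)[OF x] eJ xc Jcl by simp
    moreover have "(\<one> \<ominus> e) \<otimes> x \<oplus> e \<otimes> x = x" using xc e(2) by algebra
    ultimately show "x \<in> J" by simp
  qed
qed

text \<open>As \<open>V J = 0\<close>, the right annihilators of subsets of \<open>V\<close> contain
  \<open>J\<close>. The descending chain condition gives \<open>r(V) = r(F)\<close> for a finite
  \<open>F\<close>, and double annihilators of finite sets are known.\<close>

lemma left_annihilator_right_annihilator_in_S:
  assumes V: "two_sided_ideal V R" "V \<subseteq> S"
  shows "left_annihilator R (right_annihilator R V) \<subseteq> V"
proof
  fix y assume y: "y \<in> left_annihilator R (right_annihilator R V)"
  note Vc = subsetD[OF two_sided_ideal_carrier[OF V(1)]]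
  let ?F = "{right_annihilator R F | F. finite F \<and> F \<subseteq> V}"
  have "\<exists>M\<in>?F. \<forall>X\<in>?F. X \<subseteq> M \<longrightarrow> X = M"
  proof (rule dcc_imp_minimal)
    show "right_annihilator R {} \<in> ?F" by blast
    fix f :: "nat \<Rightarrow> 'a set" assume f: "\<And>n. f n \<in> ?F" "\<And>n. f (Suc n) \<subseteq> f n"
    show "\<exists>m. \<forall>n\<ge>m. f n = f m"
    proof (rule semisimple_dcc[OF J ss])
      fix n
      obtain F where F: "f n = right_annihilator R F" "F \<subseteq> V" using f(1)[of n] by blast
      show "right_ideal (f n) R" unfolding F(1) using F(2) Vc by (intro right_ideal_right_annihilator) blast
      show "J \<subseteq> f n" unfolding F(1) right_annihilator_def using F(2) V(2) S_J Jc by auto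
      show "f (Suc n) \<subseteq> f n" by (rule f(2))
    qed
  qed
  then obtain M where M: "M \<in> ?F" and Mmin: "\<forall>X\<in>?F. X \<subseteq> M \<longrightarrow> X = M" by (rule bexE)
  from M obtain F where F: "finite F" "F \<subseteq> V" "M = right_annihilator R F" by auto
  have Fann: "v \<otimes> x = \<zero>" if v: "v \<in> V" and x: "x \<in> right_annihilator R F" for v x
  proof -
    have "right_annihilator R (insert v F) = right_annihilator R F"
    proof (rule Mmin[unfolded F(3), rule_format])
      show "right_annihilator R (insert v F) \<in> ?F" using F(1,2) v by auto
      show "right_annihilator R (insert v F) \<subseteq> right_annihilator R F"
        by (auto simp: right_annihilator_def)
    qed
    then show ?thesis using x by (auto simp: right_annihilator_def)
  qed
  have "y \<in> span (opposite_ring R) F"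
  proof (rule baer_finite_left_annihilator[OF baer F(1)])
    show "F \<subseteq> carrier R" using F Vc by blast
    show "y \<in> carrier R" using y by (simp add: left_annihilator_def)
    fix x assume "x \<in> carrier R" "\<And>a. a \<in> F \<Longrightarrow> a \<otimes> x = \<zero>"
    then have "x \<in> right_annihilator R V" using Fann by (auto simp: right_annihilator_def)
    then show "y \<otimes> x = \<zero>" using y by (simp add: left_annihilator_def)
  qed
  moreover have "left_ideal V R" using V by (simp add: two_sided_ideal_def)
  ultimately show "y \<in> V" using F(2) ring.right_span_least[OF ring_opposite, of V F] by blast
qed

text \<open>Choose \<open>e\<close> in \<open>I\<close> with \<open>i \<equiv> i e\<close> for all
  \<open>i\<close> in \<open>I\<close>. Then \<open>(1 - e) S\<close> is killed by \<open>I\<close>,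
  so \<open>x (1 - e)\<close> kills \<open>S\<close> and lies in \<open>l(S) = J\<close>, while
  \<open>x e\<close> lies in \<open>I\<close>.\<close>

lemma left_annihilator_right_annihilator_Int_S:
  assumes I: "two_sided_ideal I R" "J \<subseteq> I"
  shows "left_annihilator R (right_annihilator R I \<inter> S) = I"
proof
  interpret O: ring "opposite_ring R" by (rule ring_opposite)
  note Ic = subsetD[OF two_sided_ideal_carrier[OF I(1)]]
  have lI: "left_ideal I R" using I by (simp add: two_sided_ideal_def)
  show "I \<subseteq> left_annihilator R (right_annihilator R I \<inter> S)"
    using Ic by (auto simp: left_annihilator_def right_annihilator_def)
  obtain e where e: "e \<in> I" "\<forall>i\<in>I. i \<ominus> i \<otimes> e \<in> J"
    using semisimple_opposite[OF J ss] lI I(2) unfolding semisimple_modulo_def by auto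
  have ec: "e \<in> carrier R" using e Ic by blast
  show "left_annihilator R (right_annihilator R I \<inter> S) \<subseteq> I"
  proof
    fix x assume x: "x \<in> left_annihilator R (right_annihilator R I \<inter> S)"
    then have xc: "x \<in> carrier R" by (simp add: left_annihilator_def)
    have "x \<otimes> (\<one> \<ominus> e) \<otimes> s = \<zero>" if s: "s \<in> S" for s
    proof -
      have sc: "s \<in> carrier R" using s S_carrier by blast
      have "(\<one> \<ominus> e) \<otimes> s \<in> S" using two_sided_ideal_multl[OF two_sided_S _ s] ec by simp
      moreover have "i \<otimes> ((\<one> \<ominus> e) \<otimes> s) = \<zero>" if i: "i \<in> I" for i
      proof -
        have "i \<otimes> ((\<one> \<ominus> e) \<otimes> s) = (i \<ominus> i \<otimes> e) \<otimes> s" using Ic[OF i] ec sc by algebra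
        then show ?thesis using J_mult_S e(2) i s by simp
      qed
      ultimately have "(\<one> \<ominus> e) \<otimes> s \<in> right_annihilator R I \<inter> S" using ec sc by (simp add: right_annihilator_def)
      then show ?thesis using x xc ec sc by (simp add: left_annihilator_def m_assoc)
    qed
    then have "x \<otimes> (\<one> \<ominus> e) \<in> left_annihilator R S" using xc ec by (simp add: left_annihilator_def)
    then have "x \<otimes> (\<one> \<ominus> e) \<oplus> x \<otimes> e \<in> I"
      using left_annihilator_S I(2) two_sided_ideal_add[OF I(1)] two_sided_ideal_multl[OF I(1) xc e(1)] by blast
    moreover have "x \<otimes> (\<one> \<ominus> e) \<oplus> x \<otimes> e = x" using xc ec by algebra
    ultimately show "x \<in> I" by simp
  qed
qed

text \<open>
  The operator \<open>I \<mapsto> r(r(I) \<inter> S)\<close> on the two-sided ideals containing \<open>J\<close> is injective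
  and monotone. If it moved \<open>J\<close>, its iterates at \<open>J\<close> would form a strictly increasing sequence.
\<close>

lemma right_annihilator_S: "right_annihilator R S = J"
proof -
  define \<Theta> where "\<Theta> I = right_annihilator R (right_annihilator R I \<inter> S)" for I
  have tV: "two_sided_ideal (right_annihilator R I \<inter> S) R" if I: "two_sided_ideal I R" for I
  proof -
    have "right_ideal I R" "left_ideal I R" "I \<subseteq> carrier R"
      using I two_sided_ideal_carrier by (auto simp: two_sided_ideal_def)
    then show ?thesis
      using two_sided_S right_ideal_right_annihilator left_ideal_right_annihilator
        right_ideal_Int ring.right_ideal_Int[OF ring_opposite]
      unfolding two_sided_ideal_def by metis
  qed
  have t\<Theta>: "two_sided_ideal (\<Theta> I) R" if I: "two_sided_ideal I R" for I
    using tV[OF I] right_ideal_right_annihilator left_ideal_right_annihilator right_ideal_carrier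
    unfolding two_sided_ideal_def \<Theta>_def by metis
  have J\<Theta>: "J \<subseteq> \<Theta> I" for I
    using S_J Jc by (auto simp: \<Theta>_def right_annihilator_def)
  have mono: "\<Theta> I \<subseteq> \<Theta> I'" if "I \<subseteq> I'" for I I'
    using that by (auto simp: \<Theta>_def right_annihilator_def)
  \<comment> \<open>\<open>I\<close> can be recovered from \<open>\<Theta> I\<close> in two steps:
    \<open>l(\<Theta> I) = r(I) \<inter> S\<close>, and
    \<open>l(r(I) \<inter> S) = I\<close>.\<close>
  have inj: "I = I'" if I: "two_sided_ideal I R" "J \<subseteq> I" and I': "two_sided_ideal I' R" "J \<subseteq> I'"
    and eq: "\<Theta> I = \<Theta> I'" for I I'
  proof -
    have V: "right_annihilator R K \<inter> S = left_annihilator R (\<Theta> K)" if K: "two_sided_ideal K R" for K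
    proof
      show "right_annihilator R K \<inter> S \<subseteq> left_annihilator R (\<Theta> K)"
        by (auto simp: \<Theta>_def left_annihilator_def right_annihilator_def)
      show "left_annihilator R (\<Theta> K) \<subseteq> right_annihilator R K \<inter> S"
        unfolding \<Theta>_def by (rule left_annihilator_right_annihilator_in_S[OF tV[OF K]]) simp
    qed
    then show ?thesis
      using left_annihilator_right_annihilator_Int_S I I' eq by metis
  qed
  define H where "H n = (\<Theta> ^^ n) J" for n
  have H: "two_sided_ideal (H n) R" "J \<subseteq> H n" for n
    using J t\<Theta> J\<Theta> by (induction n) (auto simp: H_def)
  have "H n \<subseteq> H (Suc n)" for n
    by (induction n) (use J\<Theta> mono in \<open>auto simp: H_def\<close>)
  then have "mono H" by (simp add: mono_iff_le_Suc)
  then obtain m where "\<forall>n\<ge>m. H n = H m"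
    using semisimple_acc[OF J ss, of H] H by (auto simp: two_sided_ideal_def)
  then have "H (Suc m) = H m" using le_SucI[OF order_refl, of m] by blast
  \<comment> \<open>Injectivity of \<open>\<Theta>\<close> carries the equality
    \<open>H (Suc m) = H m\<close> down to the bottom, where it says
    \<open>\<Theta> J = J\<close>.\<close>
  then have "H (Suc 0) = H 0"
  proof (induction m)
    case (Suc m)
    have "\<Theta> (H (Suc m)) = \<Theta> (H m)" using Suc.prems by (simp add: H_def)
    then show ?case using Suc.IH inj[OF H H] by blast
  qed
  then have "\<Theta> J = J" by (simp add: H_def)
  moreover have "S \<subseteq> right_annihilator R J" using J_mult_S S_carrier by (auto simp: right_annihilator_def)
  ultimately show ?thesis by (simp add: \<Theta>_def inf_absorb2)
qed

text \<open>\<open>M + J\<close> is still proper, since \<open>1 = m + j\<close> would make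
  \<open>m = 1 - j\<close> a unit. With \<open>e\<close> generating \<open>M + J\<close> modulo
  \<open>J\<close>, the element \<open>1 - e\<close> lies outside \<open>J = r(S)\<close>; so some
  \<open>s (1 - e)\<close> is nonzero, and it kills \<open>M\<close> because
  \<open>S J = 0\<close>.\<close>

lemma right_kasch:
  assumes M: "right_ideal M R" and one: "\<one> \<notin> M"
  shows "\<exists>k\<in>carrier R. k \<noteq> \<zero> \<and> (\<forall>m\<in>M. k \<otimes> m = \<zero>)"
proof -
  note Mc = subsetD[OF right_ideal_carrier[OF M]]
  have MJ: "right_ideal (M <+>\<^bsub>R\<^esub> J) R" "M \<subseteq> M <+>\<^bsub>R\<^esub> J" "J \<subseteq> M <+>\<^bsub>R\<^esub> J"
    by (auto intro: right_ideal_sum[OF M right_ideal_J] subsetD[OF right_ideal_sum_upper(1)[OF M right_ideal_J]]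
        subsetD[OF right_ideal_sum_upper(2)[OF M right_ideal_J]])
  have one': "\<one> \<notin> M <+>\<^bsub>R\<^esub> J"
  proof
    assume "\<one> \<in> M <+>\<^bsub>R\<^esub> J"
    then obtain m j where mj: "m \<in> M" "j \<in> J" "\<one> = m \<oplus> j" by (auto simp: mem_sum_iff)
    have "m \<oplus> j \<ominus> j = m" using Mc[OF mj(1)] Jc[OF mj(2)] by algebra
    then have "\<one> \<ominus> j = m" using mj(3) by simp
    then obtain u where "u \<in> carrier R" "m \<otimes> u = \<one>" using unit[OF mj(2)] by blast
    then show False using right_ideal_mult[OF M _ mj(1)] one by metis
  qed
  obtain e where e: "e \<in> M <+>\<^bsub>R\<^esub> J" "e \<in> carrier R" "\<And>c. c \<in> M <+>\<^bsub>R\<^esub> J \<Longrightarrow> (\<one> \<ominus> e) \<otimes> c \<in> J"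
    using semisimple_complement[OF MJ(1,3)] by blast
  have "\<one> \<ominus> e \<notin> J"
  proof
    assume "\<one> \<ominus> e \<in> J"
    then have "(\<one> \<ominus> e) \<oplus> e \<in> M <+>\<^bsub>R\<^esub> J" using right_ideal_add[OF MJ(1)] MJ(3) e(1) by blast
    moreover have "(\<one> \<ominus> e) \<oplus> e = \<one>" using e(2) by algebra
    ultimately show False using one' by simp
  qed
  then obtain s where s: "s \<in> S" "s \<otimes> (\<one> \<ominus> e) \<noteq> \<zero>"
    using right_annihilator_S e(2) by (auto simp: right_annihilator_def)
  have "s \<otimes> (\<one> \<ominus> e) \<otimes> m = \<zero>" if "m \<in> M" for m
    using S_J[OF s(1) e(3)[of m]] that MJ(2) S_carrier[OF s(1)] e(2) Mc by (auto simp: m_assoc)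
  then show ?thesis using s S_carrier e(2) by (intro bexI[of _ "s \<otimes> (\<one> \<ominus> e)"]) auto
qed

text \<open>The right ideal of \<open>r\<close> with \<open>x r\<close> in \<open>T\<close> is
  proper, so a nonzero \<open>k\<close> kills it. Injectivity turns \<open>k\<close> into a
  multiplier that kills \<open>T\<close> and sends \<open>x\<close> to \<open>k\<close>.\<close>

lemma right_ideal_separation:
  assumes T: "right_ideal T R" and x: "x \<in> carrier R" "x \<notin> T"
  shows "\<exists>c\<in>left_annihilator R T. c \<otimes> x \<noteq> \<zero>"
proof -
  let ?M = "{r \<in> carrier R. x \<otimes> r \<in> T}"
  have "right_ideal ?M R"
    using x right_ideal_one_sided[OF T] by (intro right_idealI) (auto simp: r_distr simp flip: m_assoc)
  moreover have "\<one> \<notin> ?M" using x by simp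
  ultimately obtain k where k: "k \<in> carrier R" "k \<noteq> \<zero>" "\<forall>m\<in>?M. k \<otimes> m = \<zero>" using right_kasch by blast
  then show ?thesis using baer_principal_modulo[OF baer T x(1) k(1)] by auto
qed

lemma right_annihilator_left_annihilator:
  assumes T: "right_ideal T R"
  shows "right_annihilator R (left_annihilator R T) = T"
  using right_ideal_separation[OF T] right_ideal_carrier[OF T]
  by (auto simp: right_annihilator_def left_annihilator_def)

end

subsection \<open>T-nilpotent ideals\<close>

text \<open>New factors are put on the left, in the same order as in the chain condition of the
  theorem.\<close>

definition right_T_nilpotent :: "('a, 'b) ring_scheme \<Rightarrow> 'a set \<Rightarrow> bool"
  where "right_T_nilpotent R J \<longleftrightarrow> (\<forall>x. (\<forall>n. x n \<in> J) \<longrightarrow> (\<exists>n. left_product R x n = \<zero>\<^bsub>R\<^esub>))"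

text \<open>Dependent choice whose state is the pair of the last factor and the product so far;
  \<open>P\<close> is an invariant of the product.\<close>

lemma left_product_sequence_exists:
  assumes start: "\<exists>a\<in>A. P a" and step: "\<And>p. P p \<Longrightarrow> \<exists>a\<in>A. P (a \<otimes>\<^bsub>R\<^esub> p)"
  shows "\<exists>x. (\<forall>n. x n \<in> A) \<and> (\<forall>n. P (left_product R x n))"
proof -
  have "\<exists>f. \<forall>n. (fst (f n) \<in> A \<and> P (snd (f n)) \<and> (n = 0 \<longrightarrow> snd (f n) = fst (f n))) \<and>
      snd (f (Suc n)) = fst (f (Suc n)) \<otimes>\<^bsub>R\<^esub> snd (f n)"
  proof (rule dependent_nat_choice)
    obtain a where "a \<in> A" "P a" using start by blast
    then show "\<exists>s. fst s \<in> A \<and> P (snd s) \<and> (0 = 0 \<longrightarrow> snd s = fst s)" by (intro exI[of _ "(a, a)"]) simp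
    fix s and n :: nat assume "fst s \<in> A \<and> P (snd s) \<and> (n = 0 \<longrightarrow> snd s = fst s)"
    then obtain b where "b \<in> A" "P (b \<otimes>\<^bsub>R\<^esub> snd s)" using step by blast
    then show "\<exists>s'. (fst s' \<in> A \<and> P (snd s') \<and> (Suc n = 0 \<longrightarrow> snd s' = fst s')) \<and> snd s' = fst s' \<otimes>\<^bsub>R\<^esub> snd s"
      by (intro exI[of _ "(b, b \<otimes>\<^bsub>R\<^esub> snd s)"]) simp
  qed
  then obtain f where f: "\<And>n. fst (f n) \<in> A" "\<And>n. P (snd (f n))" "snd (f 0) = fst (f 0)"
    "\<And>n. snd (f (Suc n)) = fst (f (Suc n)) \<otimes>\<^bsub>R\<^esub> snd (f n)" by auto
  have "left_product R (\<lambda>n. fst (f n)) n = snd (f n)" for n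
    by (induction n) (simp_all add: f)
  then show ?thesis using f by (intro exI[of _ "\<lambda>n. fst (f n)"]) simp
qed

lemma (in ring) left_product_closed: "(\<And>n. x n \<in> carrier R) \<Longrightarrow> left_product R x n \<in> carrier R"
  by (induction n) auto

context right_module
begin

text \<open>Nakayama's lemma, \<open>H \<subseteq> L + HJ\<close> implies
  \<open>H \<subseteq> L\<close>, with T-nilpotence in place of finite generation. A failure
  produces a sequence in \<open>J\<close> all of whose products move \<open>H\<close> out of
  \<open>L\<close>, so that none of them vanishes.\<close>

lemma T_nilpotent_small:
  assumes J: "right_ideal J R" and nil: "right_T_nilpotent R J"
    and H: "submodule H R N" and L: "submodule L R N"
    and sub: "H \<subseteq> submodule_span R N (L \<union> {a \<odot>\<^bsub>N\<^esub> y | a y. a \<in> J \<and> y \<in> H})"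
  shows "H \<subseteq> L"
proof (rule ccontr)
  assume *: "\<not> H \<subseteq> L"
  note Jc = subsetD[OF right_ideal_carrier[OF J]]
  note Hc = subsetD[OF submodule_carrier[OF H]] and Lc = subsetD[OF submodule_carrier[OF L]]
  define P where "P p \<longleftrightarrow> p \<in> carrier R \<and> (\<exists>y\<in>H. p \<odot>\<^bsub>N\<^esub> y \<notin> L)" for p
  have step: "\<exists>a\<in>J. P (a \<otimes>\<^bsub>R\<^esub> p)" if p: "P p" for p
  proof (rule ccontr)
    assume no: "\<not> (\<exists>a\<in>J. P (a \<otimes>\<^bsub>R\<^esub> p))"
    have pc: "p \<in> carrier R" using p by (simp add: P_def)
    \<comment> \<open>All \<open>z\<close> with \<open>z r p\<close> in \<open>L\<close> for every
      \<open>r\<close>; the factor \<open>r\<close> makes this a submodule. It contains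
      \<open>L\<close> and \<open>HJ\<close> when no \<open>a p\<close> is admissible, hence also
      \<open>H\<close>.\<close>
    let ?Z = "{z \<in> carrier N. \<forall>r\<in>carrier R. (r \<otimes>\<^bsub>R\<^esub> p) \<odot>\<^bsub>N\<^esub> z \<in> L}"
    have Z: "submodule ?Z R N"
    proof (rule submoduleI)
      show "\<zero>\<^bsub>N\<^esub> \<in> ?Z" using pc submodule_zero[OF L] by (simp add: smult_zero_right)
      show "x \<oplus>\<^bsub>N\<^esub> y \<in> ?Z" if "x \<in> ?Z" "y \<in> ?Z" for x y
        using that pc submodule_add[OF L] by (simp add: smult_module_add)
      show "r \<odot>\<^bsub>N\<^esub> x \<in> ?Z" if r: "r \<in> carrier R" and x: "x \<in> ?Z" for r x
      proof -
        have "(s \<otimes>\<^bsub>R\<^esub> p) \<odot>\<^bsub>N\<^esub> (r \<odot>\<^bsub>N\<^esub> x) \<in> L" if s: "s \<in> carrier R" for s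
        proof -
          have "(s \<otimes>\<^bsub>R\<^esub> p) \<odot>\<^bsub>N\<^esub> (r \<odot>\<^bsub>N\<^esub> x) = ((r \<otimes>\<^bsub>R\<^esub> s) \<otimes>\<^bsub>R\<^esub> p) \<odot>\<^bsub>N\<^esub> x"
            using r s x pc by (simp add: smult_assoc m_assoc smult_closed)
          then show ?thesis using x r s by simp
        qed
        then show ?thesis using r x by (simp add: smult_closed)
      qed
    qed auto
    have "a \<odot>\<^bsub>N\<^esub> y \<in> ?Z" if a: "a \<in> J" and y: "y \<in> H" for a y
    proof -
      have "(r \<otimes>\<^bsub>R\<^esub> p) \<odot>\<^bsub>N\<^esub> (a \<odot>\<^bsub>N\<^esub> y) \<in> L" if r: "r \<in> carrier R" for r
      proof -
        have ar: "a \<otimes>\<^bsub>R\<^esub> r \<in> J" using right_ideal_mult[OF J r a] .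
        then have "((a \<otimes>\<^bsub>R\<^esub> r) \<otimes>\<^bsub>R\<^esub> p) \<odot>\<^bsub>N\<^esub> y \<in> L" using no y pc Jc by (auto simp: P_def)
        then show ?thesis using r a y pc Jc Hc by (simp add: smult_assoc m_assoc smult_closed)
      qed
      then show ?thesis using a y Jc Hc smult_closed by simp
    qed
    moreover have "L \<subseteq> ?Z" using Lc pc submodule_smult[OF L] by auto
    ultimately have "H \<subseteq> ?Z" using sub span_least[OF Z, of "L \<union> {a \<odot>\<^bsub>N\<^esub> y | a y. a \<in> J \<and> y \<in> H}"] by blast
    then have "(\<one>\<^bsub>R\<^esub> \<otimes>\<^bsub>R\<^esub> p) \<odot>\<^bsub>N\<^esub> y \<in> L" if "y \<in> H" for y using that one_closed by blast
    then show False using p pc by (auto simp: P_def)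
  qed
  obtain y where "y \<in> H" "y \<notin> L" using * by blast
  then have "P \<one>\<^bsub>R\<^esub>" using Hc by (auto simp: P_def smult_unit)
  then obtain a where "a \<in> J" "P (a \<otimes>\<^bsub>R\<^esub> \<one>\<^bsub>R\<^esub>)" using step by blast
  then have "\<exists>a\<in>J. P a" using Jc by auto
  then obtain x where x: "\<forall>n. x n \<in> J" "\<forall>n. P (left_product R x n)"
    using left_product_sequence_exists[of J P R] step by blast
  then obtain n where "left_product R x n = \<zero>\<^bsub>R\<^esub>" using nil[unfolded right_T_nilpotent_def] by blast
  then have "P \<zero>\<^bsub>R\<^esub>" using x(2) by metis
  then show False using Hc submodule_zero[OF L] by (auto simp: P_def smult_zero_left)
qed

text \<open>Semisimplicity of \<open>N/NJ\<close>, stated without the quotient: \<open>B\<close> is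
  taken maximal with \<open>B \<inter> K\<close> inside \<open>NJ\<close>, and each \<open>m\<close>
  is split as \<open>m (1 - e) + m e\<close> with both parts in \<open>K + B\<close>.\<close>

lemma semisimple_modulo_complement:
  assumes J: "two_sided_ideal J R" and ss: "semisimple_modulo R J" and K: "submodule K R N"
  defines "NJ \<equiv> submodule_span R N {a \<odot>\<^bsub>N\<^esub> y | a y. a \<in> J \<and> y \<in> carrier N}"
  shows "\<exists>B. submodule B R N \<and> NJ \<subseteq> B \<and> B \<inter> K \<subseteq> NJ \<and> K <+>\<^bsub>N\<^esub> B = carrier N"
proof -
  note Jc = J_carrier[OF J]
  have rJ: "right_ideal J R" using J by (simp add: two_sided_ideal_def)
  have gen: "a \<odot>\<^bsub>N\<^esub> y \<in> NJ" if "a \<in> J" "y \<in> carrier N" for a y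
    unfolding NJ_def using that by (intro subsetD[OF span_upper]) auto
  have NJ: "submodule NJ R N" unfolding NJ_def using Jc smult_closed by (intro submodule_span_submodule) auto
  obtain B where B: "submodule B R N" "NJ \<subseteq> B" "B \<inter> K \<subseteq> NJ"
    and Bmax: "\<forall>C. submodule C R N \<longrightarrow> B \<subseteq> C \<longrightarrow> C \<inter> K \<subseteq> NJ \<longrightarrow> C = B"
    using maximal_submodule_exists[OF NJ Int_lower1[of _ K]] by blast
  let ?C = "K <+>\<^bsub>N\<^esub> B"
  have C: "submodule ?C R N" by (rule submodule_sum[OF K B(1)])
  have BC: "B \<subseteq> ?C" "K \<subseteq> ?C" using sum_upper[OF K B(1)] by auto
  have "carrier N \<subseteq> ?C"
  proof
    fix m assume m: "m \<in> carrier N"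
    let ?T = "{r \<in> carrier R. r \<odot>\<^bsub>N\<^esub> m \<in> ?C}"
    have T: "right_ideal ?T R"
      using m submodule_zero[OF C] submodule_add[OF C] submodule_smult[OF C]
      by (intro right_idealI) (auto simp: smult_zero_left smult_ring_add smult_assoc R_closed)
    have "J \<subseteq> ?T" using Jc gen[OF _ m] B(2) BC by blast
    then obtain e where e: "e \<in> ?T" "\<forall>c\<in>?T. c \<ominus>\<^bsub>R\<^esub> e \<otimes>\<^bsub>R\<^esub> c \<in> J"
      using ss[unfolded semisimple_modulo_def, rule_format, OF conjI, OF T] by blast
    have ec: "e \<in> carrier R" using e by simp
    let ?d = "\<one>\<^bsub>R\<^esub> \<ominus>\<^bsub>R\<^esub> e"
    have dc: "?d \<in> carrier R" using ec by (simp add: R_closed)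
    have dm: "?d \<odot>\<^bsub>N\<^esub> m \<in> carrier N" using dc m by (rule smult_closed)
    let ?D = "cyclic (?d \<odot>\<^bsub>N\<^esub> m)"
    have D: "submodule ?D R N" by (rule submodule_cyclic[OF dm])
    \<comment> \<open>This makes \<open>B + m d R\<close> meet \<open>K\<close> only in
      \<open>NJ\<close>: when \<open>m d r\<close> falls into \<open>K + B\<close>, the coefficient
      \<open>d r\<close> is in \<open>J\<close>.\<close>
    have dr: "?d \<otimes>\<^bsub>R\<^esub> r \<in> J" if r: "r \<in> carrier R" "?d \<otimes>\<^bsub>R\<^esub> r \<in> ?T" for r
    proof -
      have "?d \<otimes>\<^bsub>R\<^esub> r \<ominus>\<^bsub>R\<^esub> e \<otimes>\<^bsub>R\<^esub> (?d \<otimes>\<^bsub>R\<^esub> r) \<in> J" using e(2) r(2) by blast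
      moreover have "(e \<ominus>\<^bsub>R\<^esub> e \<otimes>\<^bsub>R\<^esub> e) \<otimes>\<^bsub>R\<^esub> r \<in> J"
        using e r(1) by (intro right_ideal_mult[OF rJ]) auto
      ultimately have "(?d \<otimes>\<^bsub>R\<^esub> r \<ominus>\<^bsub>R\<^esub> e \<otimes>\<^bsub>R\<^esub> (?d \<otimes>\<^bsub>R\<^esub> r)) \<oplus>\<^bsub>R\<^esub> (e \<ominus>\<^bsub>R\<^esub> e \<otimes>\<^bsub>R\<^esub> e) \<otimes>\<^bsub>R\<^esub> r \<in> J"
        by (rule right_ideal_add[OF rJ])
      moreover have "(?d \<otimes>\<^bsub>R\<^esub> r \<ominus>\<^bsub>R\<^esub> e \<otimes>\<^bsub>R\<^esub> (?d \<otimes>\<^bsub>R\<^esub> r)) \<oplus>\<^bsub>R\<^esub> (e \<ominus>\<^bsub>R\<^esub> e \<otimes>\<^bsub>R\<^esub> e) \<otimes>\<^bsub>R\<^esub> r = ?d \<otimes>\<^bsub>R\<^esub> r"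
        using ec r(1) one_closed by algebra
      ultimately show ?thesis by simp
    qed
    have "(B <+>\<^bsub>N\<^esub> ?D) \<inter> K \<subseteq> NJ"
    proof
      fix k assume k: "k \<in> (B <+>\<^bsub>N\<^esub> ?D) \<inter> K"
      then obtain b r where br: "b \<in> B" "r \<in> carrier R" "k = b \<oplus>\<^bsub>N\<^esub> r \<odot>\<^bsub>N\<^esub> (?d \<odot>\<^bsub>N\<^esub> m)"
        by (auto simp: mem_sum_iff cyclic_def)
      have rd: "r \<odot>\<^bsub>N\<^esub> (?d \<odot>\<^bsub>N\<^esub> m) = (?d \<otimes>\<^bsub>R\<^esub> r) \<odot>\<^bsub>N\<^esub> m" using br dc m by (simp add: smult_assoc)
      have bc: "b \<in> carrier N" using br submodule_carrier[OF B(1)] by auto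
      have "(?d \<otimes>\<^bsub>R\<^esub> r) \<odot>\<^bsub>N\<^esub> m \<in> carrier N" using dc br m by (intro smult_closed) auto
      then have "(?d \<otimes>\<^bsub>R\<^esub> r) \<odot>\<^bsub>N\<^esub> m = k \<oplus>\<^bsub>N\<^esub> \<ominus>\<^bsub>N\<^esub> b"
        using br(3) rd bc by (simp add: N.a_ac N.r_neg N.r_neg1 N.r_neg2)
      then have "(?d \<otimes>\<^bsub>R\<^esub> r) \<odot>\<^bsub>N\<^esub> m \<in> ?C"
        using k submodule_minus[OF B(1) br(1)] by (auto simp: mem_sum_iff)
      then have "?d \<otimes>\<^bsub>R\<^esub> r \<in> J" using br(2) dc by (intro dr) auto
      then have "r \<odot>\<^bsub>N\<^esub> (?d \<odot>\<^bsub>N\<^esub> m) \<in> B" using gen[OF _ m] B(2) rd by auto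
      then have "k \<in> B" using br submodule_add[OF B(1)] by simp
      then show "k \<in> NJ" using k B(3) by blast
    qed
    then have "B <+>\<^bsub>N\<^esub> ?D = B"
      by (intro Bmax[rule_format] submodule_sum B D sum_upper)
    then have "?d \<odot>\<^bsub>N\<^esub> m \<in> ?C" using sum_upper(2)[OF B(1) D] cyclic_self[OF dm] BC by blast
    moreover have "e \<odot>\<^bsub>N\<^esub> m \<in> ?C" using e by simp
    moreover have "m = ?d \<odot>\<^bsub>N\<^esub> m \<oplus>\<^bsub>N\<^esub> e \<odot>\<^bsub>N\<^esub> m"
    proof -
      have "?d \<odot>\<^bsub>N\<^esub> m \<oplus>\<^bsub>N\<^esub> e \<odot>\<^bsub>N\<^esub> m = (?d \<oplus>\<^bsub>R\<^esub> e) \<odot>\<^bsub>N\<^esub> m" using dc ec m by (simp add: smult_ring_add)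
      also have "?d \<oplus>\<^bsub>R\<^esub> e = \<one>\<^bsub>R\<^esub>" using ec one_closed by algebra
      finally show ?thesis using m by (simp add: smult_unit)
    qed
    ultimately show "m \<in> ?C" using submodule_add[OF C] by metis
  qed
  then have "?C = carrier N" using submodule_carrier[OF C] by blast
  then show ?thesis using B by blast
qed

end

subsection \<open>Finitely generated T-nilpotent radicals\<close>

primrec word_products :: "('a, 'b) ring_scheme \<Rightarrow> 'a set \<Rightarrow> nat \<Rightarrow> 'a set"
  where
    "word_products R F 0 = {\<one>\<^bsub>R\<^esub>}"
  | "word_products R F (Suc n) = {x \<otimes>\<^bsub>R\<^esub> a | x a. x \<in> word_products R F n \<and> a \<in> F}"

text \<open>The artinian property of the right module \<open>A\<close>, expressed by right ideals of
  \<open>R\<close>, so that no submodule type has to be changed.\<close>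

definition dcc_below :: "('a, 'b) ring_scheme \<Rightarrow> 'a set \<Rightarrow> bool"
  where "dcc_below R A \<longleftrightarrow> (\<forall>H :: nat \<Rightarrow> 'a set.
    (\<forall>n. right_ideal (H n) R \<and> H n \<subseteq> A) \<and> (\<forall>n. H (Suc n) \<subseteq> H n) \<longrightarrow> (\<exists>m. \<forall>n\<ge>m. H n = H m))"

context ring
begin

lemma span_insert_right:
  assumes "x \<in> carrier R" "Y \<subseteq> carrier R" "z \<in> span R (insert x Y)"
  shows "\<exists>w\<in>span R Y. \<exists>a\<in>carrier R. z = w \<oplus> x \<otimes> a"
proof -
  let ?X = "{x \<otimes> r | r. r \<in> carrier R}"
  have sY: "right_ideal (span R Y) R" using right_ideal_span[OF assms(2)] .
  have X: "right_ideal ?X R" using right_ideal_principal[OF assms(1)] .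
  have "x \<in> ?X" using assms(1) by (intro CollectI exI[of _ \<one>]) simp
  then have "insert x Y \<subseteq> span R Y <+>\<^bsub>R\<^esub> ?X"
    using right_ideal_sum_upper[OF sY X] right_span_upper[of Y] by blast
  then have "span R (insert x Y) \<subseteq> span R Y <+>\<^bsub>R\<^esub> ?X"
    by (rule right_span_least[OF right_ideal_sum[OF sY X]])
  then have "z \<in> span R Y <+>\<^bsub>R\<^esub> ?X" using assms(3) by blast
  then obtain w v where "w \<in> span R Y" "v \<in> ?X" "z = w \<oplus> v" unfolding mem_sum_iff by blast
  then show ?thesis by blast
qed

lemmas span_insert_left = ring.span_insert_right[OF ring_opposite, simplified]

lemma word_products_closed: "F \<subseteq> carrier R \<Longrightarrow> w \<in> word_products R F n \<Longrightarrow> w \<in> carrier R"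
  by (induction n arbitrary: w) auto

lemma word_products_split:
  assumes F: "F \<subseteq> carrier R"
  shows "w \<in> word_products R F (m + n) \<Longrightarrow> \<exists>u\<in>word_products R F m. \<exists>v\<in>word_products R F n. w = u \<otimes> v"
proof (induction n arbitrary: w)
  case 0
  then show ?case using word_products_closed[OF F] by (intro bexI[of _ w] bexI[of _ \<one>]) auto
next
  case (Suc n)
  then obtain x a where x: "x \<in> word_products R F (m + n)" "a \<in> F" "w = x \<otimes> a" by auto
  then obtain u v where uv: "u \<in> word_products R F m" "v \<in> word_products R F n" "x = u \<otimes> v" using Suc.IH by blast
  then have "w = u \<otimes> (v \<otimes> a)" using x F word_products_closed[OF F] by (auto simp: m_assoc)
  moreover have "v \<otimes> a \<in> word_products R F (Suc n)" using uv x by auto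
  ultimately show ?case using uv by blast
qed

text \<open>By Koenig's lemma, applied to words growing on the left.\<close>

lemma word_products_vanish:
  assumes F: "finite F" "F \<subseteq> J" and J: "J \<subseteq> carrier R" and nil: "right_T_nilpotent R J"
  shows "\<exists>m. word_products R F m \<subseteq> {\<zero>}"
proof (rule ccontr)
  assume no: "\<not> ?thesis"
  have Fc: "F \<subseteq> carrier R" using F J by blast
  define G where "G p \<longleftrightarrow> p \<in> carrier R \<and> (\<forall>k. \<exists>w\<in>word_products R F k. w \<otimes> p \<noteq> \<zero>)" for p
  have step: "\<exists>a\<in>F. G (a \<otimes> p)" if p: "G p" for p
  proof (rule ccontr)
    assume "\<not> (\<exists>a\<in>F. G (a \<otimes> p))"
    then have "\<forall>a\<in>F. \<exists>k. \<forall>w\<in>word_products R F k. w \<otimes> (a \<otimes> p) = \<zero>"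
      using p Fc by (auto simp: G_def)
    then obtain k where k: "\<And>a w. a \<in> F \<Longrightarrow> w \<in> word_products R F (k a) \<Longrightarrow> w \<otimes> (a \<otimes> p) = \<zero>" by metis
    \<comment> \<open>A uniform length at which every branch has died out; the inserted
      \<open>0\<close> covers an empty \<open>F\<close>.\<close>
    define K where "K = Max (insert 0 (k ` F))"
    have K: "k a \<le> K" if "a \<in> F" for a using F(1) that by (auto simp: K_def intro!: Max_ge)
    have "w \<otimes> p = \<zero>" if w: "w \<in> word_products R F (Suc K)" for w
    proof -
      obtain x a where xa: "x \<in> word_products R F K" "a \<in> F" "w = x \<otimes> a" using w by auto
      have "x \<in> word_products R F ((K - k a) + k a)" using xa(1) K[OF xa(2)] by simp
      then obtain u v where uv: "u \<in> word_products R F (K - k a)" "v \<in> word_products R F (k a)" "x = u \<otimes> v"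
        using word_products_split[OF Fc] by blast
      have c: "u \<in> carrier R" "v \<in> carrier R" "a \<in> carrier R" "p \<in> carrier R"
        using uv xa Fc p word_products_closed[OF Fc] by (auto simp: G_def)
      have "w \<otimes> p = u \<otimes> (v \<otimes> (a \<otimes> p))" using c uv xa by (simp add: m_assoc)
      then show ?thesis using k[OF xa(2) uv(2)] c by simp
    qed
    then show False using p by (auto simp: G_def simp del: word_products.simps)
  qed
  have "G \<one>" unfolding G_def
  proof (intro conjI allI)
    fix k
    obtain w where "w \<in> word_products R F k" "w \<noteq> \<zero>" using no by blast
    then show "\<exists>w\<in>word_products R F k. w \<otimes> \<one> \<noteq> \<zero>" using word_products_closed[OF Fc] by (intro bexI[of _ w]) auto
  qed simp
  then obtain a where a: "a \<in> F" "G (a \<otimes> \<one>)" using step by blast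
  then have "a \<in> carrier R" using Fc by blast
  then have "\<exists>a\<in>F. G a" using a by auto
  then obtain x where x: "\<forall>n. x n \<in> F" "\<forall>n. G (left_product R x n)"
    using left_product_sequence_exists[of F G R] step by blast
  moreover have "\<forall>n. x n \<in> J" using x(1) F(2) by blast
  ultimately obtain n where "left_product R x n = \<zero>" using nil[unfolded right_T_nilpotent_def] by blast
  then have "G \<zero>" using x(2) by metis
  then show False using word_products_closed[OF Fc] by (auto simp: G_def)
qed

lemma dcc_below_mono: "dcc_below R B \<Longrightarrow> A \<subseteq> B \<Longrightarrow> dcc_below R A"
  unfolding dcc_below_def by (meson subset_trans)

text \<open>Both \<open>H n \<inter> A\<close> and \<open>(H n + A) \<inter> B\<close> stabilise,
  and by the modular law they determine \<open>H n\<close> within the chain.\<close>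

lemma dcc_below_sum:
  assumes A: "right_ideal A R" "dcc_below R A" and B: "right_ideal B R" "dcc_below R B"
  shows "dcc_below R (A <+> B)"
  unfolding dcc_below_def
proof (intro allI impI, elim conjE)
  fix H :: "nat \<Rightarrow> 'a set"
  assume H': "\<forall>n. right_ideal (H n) R \<and> H n \<subseteq> A <+>\<^bsub>R\<^esub> B" and dec: "\<forall>n. H (Suc n) \<subseteq> H n"
  have H: "right_ideal (H n) R" "H n \<subseteq> A <+>\<^bsub>R\<^esub> B" for n using H' by auto
  have HA: "right_ideal (H n \<inter> A) R" "right_ideal ((H n <+>\<^bsub>R\<^esub> A) \<inter> B) R" for n
    by (intro right_ideal_Int right_ideal_sum H A B)+
  have decHA: "H (Suc n) <+>\<^bsub>R\<^esub> A \<subseteq> H n <+>\<^bsub>R\<^esub> A" for n using dec unfolding subset_iff mem_sum_iff by blast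
  obtain m1 where m1: "\<forall>n\<ge>m1. H n \<inter> A = H m1 \<inter> A"
    using A(2)[unfolded dcc_below_def, rule_format, of "\<lambda>n. H n \<inter> A"] HA(1) dec by blast
  obtain m2 where m2: "\<forall>n\<ge>m2. (H n <+>\<^bsub>R\<^esub> A) \<inter> B = (H m2 <+>\<^bsub>R\<^esub> A) \<inter> B"
    using B(2)[unfolded dcc_below_def, rule_format, of "\<lambda>n. (H n <+>\<^bsub>R\<^esub> A) \<inter> B"] HA(2) decHA by blast
  define m where "m = max m1 m2"
  have "H n = H m" if n: "n \<ge> m" for n
  proof
    show sub: "H n \<subseteq> H m" using lift_Suc_antimono_le[of H m n] dec n by blast
    have eq: "H n \<inter> A = H m \<inter> A" "(H n <+>\<^bsub>R\<^esub> A) \<inter> B = (H m <+>\<^bsub>R\<^esub> A) \<inter> B"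
      using m1[rule_format, of n] m1[rule_format, of m] m2[rule_format, of n] m2[rule_format, of m] n
      by (simp_all add: m_def)
    note c = subsetD[OF right_ideal_carrier[OF A(1)]] subsetD[OF right_ideal_carrier[OF B(1)]]
      subsetD[OF right_ideal_carrier[OF H(1)]]
    show "H m \<subseteq> H n"
    proof
      fix x assume x: "x \<in> H m"
      then obtain a b where ab: "a \<in> A" "b \<in> B" "x = a \<oplus> b" using H(2) by (force simp: mem_sum_iff)
      have "x \<oplus> \<ominus> a = b" using ab c add_minus_cancel_left[of b a] by (simp add: a_minus_def)
      then have "b \<in> H m <+>\<^bsub>R\<^esub> A" using x ab right_ideal_minus[OF A(1)] unfolding mem_sum_iff by metis
      then have "b \<in> H n <+>\<^bsub>R\<^esub> A" using ab eq(2) by blast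
      then obtain h a' where ha: "h \<in> H n" "a' \<in> A" "b = h \<oplus> a'" by (auto simp: mem_sum_iff)
      have "x = h \<oplus> (a \<oplus> a')" using ab ha c by (simp add: a_ac)
      then have "x \<ominus> h = a \<oplus> a'" using ab(1) ha(1,2) c by (simp add: add_minus_cancel_left)
      moreover have "x \<ominus> h \<in> H m" using right_ideal_diff[OF H(1) x] sub ha by blast
      ultimately have "x \<ominus> h \<in> H n" using right_ideal_add[OF A(1) ab(1) ha(2)] eq(1) by auto
      then have "(x \<ominus> h) \<oplus> h \<in> H n" by (rule right_ideal_add[OF H(1) _ ha(1)])
      moreover have "(x \<ominus> h) \<oplus> h = x" using c(3)[OF x] c(3)[OF ha(1)] by algebra
      ultimately show "x \<in> H n" by simp
    qed
  qed
  then show "\<exists>m. \<forall>n\<ge>m. H n = H m" by blast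
qed

text \<open>\<open>pR/pJ\<close> is an image of \<open>R/J\<close>: the right ideals of
  \<open>r\<close> with \<open>p r\<close> in \<open>H n + pJ\<close> contain \<open>J\<close>, so
  \<open>semisimple_dcc\<close> applies, and \<open>pJ\<close> is covered by hypothesis.\<close>

lemma dcc_below_principal:
  assumes J: "two_sided_ideal J R" and ss: "semisimple_modulo R J" and p: "p \<in> carrier R"
    and pJ: "dcc_below R {p \<otimes> j | j. j \<in> J}"
  shows "dcc_below R {p \<otimes> r | r. r \<in> carrier R}"
  unfolding dcc_below_def
proof (intro allI impI, elim conjE)
  fix H :: "nat \<Rightarrow> 'a set"
  let ?A = "{p \<otimes> j | j. j \<in> J}"
  assume H': "\<forall>n. right_ideal (H n) R \<and> H n \<subseteq> {p \<otimes> r | r. r \<in> carrier R}" and dec: "\<forall>n. H (Suc n) \<subseteq> H n"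
  have H: "right_ideal (H n) R" "H n \<subseteq> {p \<otimes> r | r. r \<in> carrier R}" for n using H' by auto
  note Jc = J_carrier[OF J] and Jcl = J_closed[OF J]
  have A: "right_ideal ?A R"
  proof (rule right_idealI)
    show "x \<oplus> y \<in> ?A" if xy: "x \<in> ?A" "y \<in> ?A" for x y
    proof -
      obtain i j where "i \<in> J" "j \<in> J" "x = p \<otimes> i" "y = p \<otimes> j" using xy by auto
      then show ?thesis using p Jc Jcl by (intro CollectI exI[of _ "i \<oplus> j"]) (simp add: r_distr)
    qed
    show "x \<otimes> r \<in> ?A" if r: "r \<in> carrier R" and x: "x \<in> ?A" for x r
    proof -
      obtain i where "i \<in> J" "x = p \<otimes> i" using x by auto
      then show ?thesis using p Jc Jcl r by (intro CollectI exI[of _ "i \<otimes> r"]) (simp add: m_assoc)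
    qed
    show "\<zero> \<in> ?A" using p Jcl by (intro CollectI exI[of _ \<zero>]) simp
  qed (use p Jc in auto)
  note c = subsetD[OF right_ideal_carrier[OF A(1)]] subsetD[OF right_ideal_carrier[OF H(1)]]
  have HA: "right_ideal (H n <+>\<^bsub>R\<^esub> ?A) R" for n by (rule right_ideal_sum[OF H(1) A])
  obtain m1 where m1: "\<forall>n\<ge>m1. H n \<inter> ?A = H m1 \<inter> ?A"
    using pJ[unfolded dcc_below_def, rule_format, of "\<lambda>n. H n \<inter> ?A"] right_ideal_Int[OF H(1) A] dec by blast
  define C where "C n = {r \<in> carrier R. p \<otimes> r \<in> H n <+>\<^bsub>R\<^esub> ?A}" for n
  have "\<exists>m. \<forall>n\<ge>m. C n = C m"
  proof (rule semisimple_dcc[OF J ss])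
    fix n
    show "right_ideal (C n) R"
      using p right_ideal_one_sided[OF HA[of n]]
      by (intro right_idealI) (auto simp: C_def r_distr simp flip: m_assoc)
    show "J \<subseteq> C n"
      using right_ideal_sum_upper(2)[OF H(1) A, of n] Jc by (auto simp: C_def)
    show "C (Suc n) \<subseteq> C n" using dec unfolding C_def subset_iff mem_sum_iff by blast
  qed
  then obtain m2 where m2: "\<forall>n\<ge>m2. C n = C m2" by blast
  define m where "m = max m1 m2"
  have "H n = H m" if n: "n \<ge> m" for n
  proof
    show sub: "H n \<subseteq> H m" using lift_Suc_antimono_le[of H m n] dec n by blast
    have eq: "H n \<inter> ?A = H m \<inter> ?A" "C n = C m"
      using m1[rule_format, of n] m1[rule_format, of m] m2[rule_format, of n] m2[rule_format, of m] n
      by (simp_all add: m_def)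
    show "H m \<subseteq> H n"
    proof
      fix x assume x: "x \<in> H m"
      then obtain r where r: "r \<in> carrier R" "x = p \<otimes> r" using H(2) by blast
      have "x \<in> H m <+>\<^bsub>R\<^esub> ?A" by (rule subsetD[OF right_ideal_sum_upper(1)[OF H(1) A] x])
      then have "r \<in> C n" using r eq(2) by (simp add: C_def)
      then obtain h a where ha: "h \<in> H n" "a \<in> ?A" "x = h \<oplus> a"
        using r unfolding C_def mem_sum_iff by auto
      have "x \<ominus> h = a" using ha(3) c(1)[OF ha(2)] c(2)[OF ha(1)] by (simp add: add_minus_cancel_left)
      moreover have "x \<ominus> h \<in> H m" using right_ideal_diff[OF H(1) x] sub ha by blast
      ultimately have "a \<in> H n" using ha(2) eq(1) by blast
      then show "x \<in> H n" using ha right_ideal_add[OF H(1)] by blast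
    qed
  qed
  then show "\<exists>m. \<forall>n\<ge>m. H n = H m" by blast
qed

lemma dcc_below_finite_span:
  assumes "finite Y" "Y \<subseteq> carrier R" "\<And>y. y \<in> Y \<Longrightarrow> dcc_below R {y \<otimes> r | r. r \<in> carrier R}"
  shows "dcc_below R (span R Y)"
  using assms
proof (induction Y rule: finite_induct)
  case empty
  have "span R {} \<subseteq> {\<zero>}" by (rule right_span_least[OF right_ideal_of_zero]) simp
  moreover have "dcc_below R {\<zero>}"
    unfolding dcc_below_def
  proof (intro allI impI, elim conjE)
    fix H :: "nat \<Rightarrow> 'a set"
    assume H: "\<forall>n. right_ideal (H n) R \<and> H n \<subseteq> {\<zero>}"
    then have "H n = {\<zero>}" for n using right_ideal_zero[of "H n"] by blast
    then show "\<exists>m. \<forall>n\<ge>m. H n = H m" by simp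
  qed
  ultimately show ?case by (rule dcc_below_mono[rotated])
next
  case (insert y Y)
  let ?X = "{y \<otimes> r | r. r \<in> carrier R}"
  have sY: "right_ideal (span R Y) R" using right_ideal_span insert by auto
  have X: "right_ideal ?X R" using right_ideal_principal insert by auto
  have "dcc_below R (span R Y <+> ?X)" using insert by (intro dcc_below_sum sY X) auto
  moreover have "span R (insert y Y) \<subseteq> span R Y <+>\<^bsub>R\<^esub> ?X"
    using span_insert_right[of y Y] insert by (fastforce simp: mem_sum_iff)
  ultimately show ?case by (rule dcc_below_mono)
qed

lemma right_artinian_of_finitely_generated_radical:
  assumes J: "two_sided_ideal J R" and ss: "semisimple_modulo R J" and nil: "right_T_nilpotent R J"
    and F: "finite F" "F \<subseteq> J" "J \<subseteq> span R F"
  shows "right_artinian R"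
proof -
  note Jc = J_carrier[OF J]
  have Fc: "F \<subseteq> carrier R" using F Jc by blast
  obtain m where m: "word_products R F m \<subseteq> {\<zero>}"
    using word_products_vanish[OF F(1,2) two_sided_ideal_carrier[OF J] nil] by blast
  \<comment> \<open>Downward induction from the length at which all words vanish to the empty word
    \<open>\<one>\<close>: for a word \<open>p\<close>, the ideal \<open>pJ\<close> is generated by
    the words \<open>p a\<close> with \<open>a\<close> in \<open>F\<close>, which are one letter
    longer.\<close>
  have "\<forall>p\<in>word_products R F k. dcc_below R {p \<otimes> r | r. r \<in> carrier R}" if "k \<le> m" for k
    using that
  proof (induction k rule: inc_induct)
    case base
    have "dcc_below R (span R {})" by (rule dcc_below_finite_span) auto
    moreover have "{\<zero> \<otimes> r | r. r \<in> carrier R} \<subseteq> span R {}" using right_ideal_zero[OF right_ideal_span, of "{}"] by auto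
    ultimately have "dcc_below R {\<zero> \<otimes> r | r. r \<in> carrier R}" by (rule dcc_below_mono)
    then show ?case using m by blast
  next
    case (step k)
    show ?case
    proof
      fix p assume p: "p \<in> word_products R F k"
      have pc: "p \<in> carrier R" using word_products_closed[OF Fc p] .
      let ?Y = "(\<lambda>a. p \<otimes> a) ` F"
      have Yc: "?Y \<subseteq> carrier R" using pc Fc by auto
      have "dcc_below R (span R ?Y)"
        using F(1) Yc step.IH p by (intro dcc_below_finite_span) auto
      moreover have "{p \<otimes> j | j. j \<in> J} \<subseteq> span R ?Y"
      proof -
        let ?Z = "{x \<in> carrier R. p \<otimes> x \<in> span R ?Y}"
        have "right_ideal ?Z R"
          using pc right_ideal_one_sided[OF right_ideal_span[OF Yc]]
          by (intro right_idealI) (auto simp: r_distr simp flip: m_assoc)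
        moreover have "F \<subseteq> ?Z" using Fc right_span_upper[of ?Y] by auto
        ultimately have "J \<subseteq> ?Z" using F(3) right_span_least by blast
        then show ?thesis by blast
      qed
      ultimately have "dcc_below R {p \<otimes> j | j. j \<in> J}" by (rule dcc_below_mono)
      then show "dcc_below R {p \<otimes> r | r. r \<in> carrier R}" by (rule dcc_below_principal[OF J ss pc])
    qed
  qed
  from this[of 0] have "dcc_below R {\<one> \<otimes> r | r. r \<in> carrier R}" by simp
  moreover have "{\<one> \<otimes> r | r. r \<in> carrier R} = carrier R" by force
  ultimately have dcc: "dcc_below R (carrier R)" by simp
  show ?thesis
    unfolding right_artinian_def artinian_module_def
  proof (intro allI impI, elim conjE)
    fix H assume H: "\<forall>n. right_ideal (H n) R" "\<forall>n::nat. H (Suc n) \<subseteq> H n"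
    then have "\<forall>n. right_ideal (H n) R \<and> H n \<subseteq> carrier R" using right_ideal_carrier by blast
    then show "\<exists>m. \<forall>n\<ge>m. H n = H m" using dcc H(2) unfolding dcc_below_def by blast
  qed
qed

end

subsection \<open>Countably generated annihilators\<close>

context ring
begin

lemma two_sided_ideal_iff_ideal: "two_sided_ideal J R \<longleftrightarrow> ideal J R"
proof
  assume J: "two_sided_ideal J R"
  have "subgroup J (add_monoid R)"
    using J_carrier[OF J] J_closed[OF J] by (intro add.subgroupI) auto
  then show "ideal J R"
    using J_closed[OF J] by (intro idealI ring_axioms) auto
next
  assume "ideal J R"
  then interpret J: ideal J R .
  show "two_sided_ideal J R"
    unfolding two_sided_ideal_def
    using J.Icarr J.zero_closed J.a_closed J.I_r_closed J.I_l_closed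
    by (intro conjI right_idealI left_idealI) auto
qed

lemma
  assumes J: "two_sided_ideal J R"
  shows two_sided_ideal_prod: "two_sided_ideal (J \<cdot> J) R" and ideal_prod_subset: "J \<cdot> J \<subseteq> J"
  using ideal_prod_is_ideal[of J J] ideal_prod_inter[of J J] J by (auto simp: two_sided_ideal_iff_ideal)

end

context self_injective_semilocal
begin

abbreviation J2 where "J2 \<equiv> J \<cdot> J"

lemmas two_sided_J2 = two_sided_ideal_prod[OF J]

lemma J2_mult: "i \<in> J \<Longrightarrow> j \<in> J \<Longrightarrow> i \<otimes> j \<in> J2"
  by (rule ideal_prod.prod)

lemma right_ideal_J2: "right_ideal J2 R"
  using two_sided_J2 by (simp add: two_sided_ideal_def)

text \<open>The right ideals \<open>C n\<close> decrease to \<open>J2\<close>. If none of them were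
  inside \<open>J2\<close>, a multiplier could be assembled piecewise that vanishes on
  \<open>J2\<close> but on no \<open>C n\<close>, whereas each element of \<open>l(J2)\<close> lies
  in one of the spans and so vanishes on some \<open>C n\<close>.\<close>

lemma annihilator_chain_reaches_square:
  assumes x: "\<And>n. x n \<in> carrier R"
    and W: "left_annihilator R J2 = (\<Union>n. span (opposite_ring R) (x ` {..<n::nat}))"
  shows "\<exists>n. J \<inter> right_annihilator R (x ` {..<n}) \<subseteq> J2"
proof (rule ccontr)
  define C where "C n = J \<inter> right_annihilator R (x ` {..<n})" for n
  assume "\<not> ?thesis"
  then have no: "\<exists>t\<in>C n. t \<notin> J2" for n unfolding C_def by blast
  interpret O: ring "opposite_ring R" by (rule ring_opposite)
  have C: "right_ideal (C n) R" for n
    unfolding C_def using x by (intro right_ideal_Int right_ideal_J right_ideal_right_annihilator) auto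
  note Cc = subsetD[OF right_ideal_carrier[OF C]]
  have dec: "C n \<subseteq> C m" if "m \<le> n" for m n
    using that by (auto simp: C_def right_annihilator_def)
  have xW: "x n \<in> left_annihilator R J2" for n
    unfolding W using subsetD[OF O.right_span_upper, of "x n" "x ` {..<Suc n}"] by blast
  have J2C: "J2 \<subseteq> C n" for n
    using xW ideal_prod_subset[OF J] two_sided_ideal_carrier[OF two_sided_J2]
    by (auto simp: C_def right_annihilator_def left_annihilator_def)
  have kill: "w \<otimes> t = \<zero>" if w: "w \<in> span (opposite_ring R) (x ` {..<n})" and t: "t \<in> C n" for w t n
  proof -
    have tc: "t \<in> carrier R" using t Cc by blast
    have "left_ideal (left_annihilator R {t}) R" using tc by (intro left_ideal_left_annihilator) simp
    moreover have "x ` {..<n} \<subseteq> left_annihilator R {t}"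
      using t x by (auto simp: C_def left_annihilator_def right_annihilator_def)
    ultimately have "w \<in> left_annihilator R {t}" using O.right_span_least w by blast
    then show ?thesis by (simp add: left_annihilator_def)
  qed
  \<comment> \<open>An element of all \<open>C n\<close> is killed by \<open>l(J2)\<close>, so the
    double annihilator property applies.\<close>
  have inter: "t \<in> J2" if t: "\<And>n. t \<in> C n" for t
  proof -
    have "t \<in> right_annihilator R (left_annihilator R J2)"
      unfolding right_annihilator_def W using kill t Cc[OF t[of 0]] by auto
    then show ?thesis using right_annihilator_left_annihilator[OF right_ideal_J2] by simp
  qed
  \<comment> \<open>A stage \<open>(T, n, c)\<close>: the multiplier is committed to
    \<open>c\<close> on \<open>T\<close>, and since \<open>T\<close> meets \<open>C n\<close> only
    in \<open>J2\<close>, its values on \<open>C n\<close> modulo \<open>J2\<close> are still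
    free.\<close>
  define P where "P s \<longleftrightarrow> (case s of (T, n, c) \<Rightarrow> right_ideal T R \<and> J2 \<subseteq> T \<and> T \<inter> C n \<subseteq> J2 \<and>
    c \<in> left_annihilator R J2)" for s :: "'a set \<times> nat \<times> 'a"
  define Q where "Q s s' \<longleftrightarrow> (case (s, s') of ((T, n, c), (T', n', c')) \<Rightarrow> n < n' \<and> T \<subseteq> T' \<and>
    (\<forall>t\<in>T. c' \<otimes> t = c \<otimes> t) \<and> (\<exists>t\<in>T' \<inter> C n. c' \<otimes> t \<noteq> \<zero>))" for s s' :: "'a set \<times> nat \<times> 'a"
  have "\<exists>f. \<forall>n. P (f n) \<and> Q (f n) (f (Suc n))"
  proof (rule dependent_nat_choice)
    have "\<zero> \<in> left_annihilator R J2"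
      using two_sided_ideal_carrier[OF two_sided_J2] by (auto simp: left_annihilator_def)
    then show "\<exists>s. P s" by (intro exI[of _ "(J2, 0, \<zero>)"]) (simp add: P_def right_ideal_J2)
    fix s k assume "P s"
    then obtain T n c where s: "s = (T, n, c)" and T: "right_ideal T R" "J2 \<subseteq> T" "T \<inter> C n \<subseteq> J2"
      and c: "c \<in> left_annihilator R J2" by (cases s) (auto simp: P_def)
    note Tc = subsetD[OF right_ideal_carrier[OF T(1)]]
    have cc: "c \<in> carrier R" using c by (simp add: left_annihilator_def)
    obtain t0 where t0: "t0 \<in> C n" "t0 \<notin> J2" using no by blast
    then obtain n' where n': "t0 \<notin> C n'" using inter[of t0] by auto
    have nn': "n < n'" using dec[of n' n] t0(1) n' by (meson not_le_imp_less subsetD)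
    have t0c: "t0 \<in> carrier R" and t0J: "t0 \<in> J" using t0 Cc by (auto simp: C_def)
    \<comment> \<open>\<open>?D\<close> contains \<open>J\<close> because \<open>t0 J\<close> lies
      in \<open>J2\<close>. Passing from \<open>t0\<close> to \<open>t0 (1 - e)\<close> removes the
      part that enters \<open>C n'\<close>, so that \<open>tR\<close> meets \<open>C n'\<close>
      within \<open>J2\<close>.\<close>
    let ?D = "{r \<in> carrier R. t0 \<otimes> r \<in> C n'}"
    have D: "right_ideal ?D R"
      using t0c right_ideal_one_sided[OF C[of n']]
      by (intro right_idealI) (auto simp: r_distr simp flip: m_assoc)
    have JD: "J \<subseteq> ?D" using J2_mult[OF t0J] subsetD[OF J2C] Jc by auto
    obtain e where e: "e \<in> ?D" "e \<in> carrier R" "\<And>d. d \<in> ?D \<Longrightarrow> (\<one> \<ominus> e) \<otimes> d \<in> J" "e \<otimes> (\<one> \<ominus> e) \<in> J"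
      using semisimple_complement[OF D JD] by blast
    define t where "t = t0 \<otimes> (\<one> \<ominus> e)"
    have tc: "t \<in> carrier R" using t0c e(2) by (simp add: t_def)
    have tC: "t \<in> C n" unfolding t_def using right_ideal_mult[OF C _ t0(1)] e(2) by simp
    have tC': "t \<notin> C n'"
    proof
      assume "t \<in> C n'"
      moreover have "t0 \<otimes> e \<in> C n'" using e(1) by simp
      ultimately have "t \<oplus> t0 \<otimes> e \<in> C n'" by (rule right_ideal_add[OF C])
      moreover have "t \<oplus> t0 \<otimes> e = t0" unfolding t_def using t0c e(2) by algebra
      ultimately show False using n' by simp
    qed
    have tr: "t \<otimes> r \<in> J2" if r: "r \<in> carrier R" "t \<otimes> r \<in> C n'" for r
    proof -
      have dr: "(\<one> \<ominus> e) \<otimes> r \<in> carrier R" using e(2) r by simp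
      have "(\<one> \<ominus> e) \<otimes> r \<in> ?D" using r(2) t0c e(2) dr r(1) by (simp add: t_def m_assoc)
      then have "(\<one> \<ominus> e) \<otimes> ((\<one> \<ominus> e) \<otimes> r) \<in> J" by (rule e(3))
      moreover have "e \<otimes> (\<one> \<ominus> e) \<otimes> r \<in> J" using e(4) r(1) Jcl by simp
      ultimately have "(\<one> \<ominus> e) \<otimes> ((\<one> \<ominus> e) \<otimes> r) \<oplus> e \<otimes> (\<one> \<ominus> e) \<otimes> r \<in> J" using Jcl by blast
      moreover have "(\<one> \<ominus> e) \<otimes> ((\<one> \<ominus> e) \<otimes> r) \<oplus> e \<otimes> (\<one> \<ominus> e) \<otimes> r = (\<one> \<ominus> e) \<otimes> r"
        using e(2) r(1) by algebra
      ultimately have "t0 \<otimes> ((\<one> \<ominus> e) \<otimes> r) \<in> J2" using J2_mult[OF t0J] by simp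
      then show ?thesis using t0c e(2) r(1) by (simp add: t_def m_assoc)
    qed
    have "t \<notin> T" using tC tC' T(3) J2C by blast
    then obtain u where u: "u \<in> left_annihilator R T" "u \<otimes> t \<noteq> \<zero>" using right_ideal_separation[OF T(1) tc] by blast
    have uc: "u \<in> carrier R" using u by (simp add: left_annihilator_def)
    \<comment> \<open>\<open>u\<close> vanishes on \<open>T\<close> but not at \<open>t\<close>; it
      is added only if \<open>c\<close> fails to be nonzero at \<open>t\<close>.\<close>
    define c' where "c' = (if c \<otimes> t = \<zero> then c \<oplus> u else c)"
    have c'c: "c' \<in> carrier R" using cc uc by (simp add: c'_def)
    have c't: "c' \<otimes> t \<noteq> \<zero>" using u(2) cc uc tc by (simp add: c'_def l_distr)
    have c'T: "c' \<otimes> v = c \<otimes> v" if "v \<in> T" for v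
      using that u(1) cc uc Tc by (auto simp: c'_def l_distr left_annihilator_def)
    have c'W: "c' \<in> left_annihilator R J2"
      unfolding left_annihilator_def using c'c c'T T(2) c by (auto simp: left_annihilator_def)
    let ?X = "{t \<otimes> r | r. r \<in> carrier R}"
    have X: "right_ideal ?X R" using right_ideal_principal[OF tc] .
    have tX: "t \<in> ?X" using tc by (intro CollectI exI[of _ \<one>]) simp
    let ?T = "T <+>\<^bsub>R\<^esub> ?X"
    have T': "right_ideal ?T R" by (rule right_ideal_sum[OF T(1) X])
    have TT': "T \<subseteq> ?T" "?X \<subseteq> ?T" by (rule right_ideal_sum_upper[OF T(1) X])+
    \<comment> \<open>For \<open>z = v + t r\<close> in \<open>C n'\<close>, first \<open>v\<close>
      falls into \<open>T \<inter> C n\<close>, hence into \<open>J2\<close>; then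
      \<open>t r\<close> falls into \<open>C n'\<close>, hence into \<open>J2\<close>.\<close>
    have "?T \<inter> C n' \<subseteq> J2"
    proof
      fix z assume z: "z \<in> ?T \<inter> C n'"
      then obtain v r where vr: "v \<in> T" "r \<in> carrier R" "z = v \<oplus> t \<otimes> r" by (auto simp: mem_sum_iff)
      have vc: "v \<in> carrier R" and trc: "t \<otimes> r \<in> carrier R" using Tc vr tc by auto
      have "z \<in> C n" using z dec[of n n'] nn' by auto
      moreover have "t \<otimes> r \<in> C n" by (rule right_ideal_mult[OF C vr(2) tC])
      ultimately have "z \<ominus> t \<otimes> r \<in> C n" by (rule right_ideal_diff[OF C])
      then have "v \<in> C n" using vr(3) vc trc by (simp add: add_minus_cancel_right)
      then have vJ2: "v \<in> J2" using T(3) vr(1) by blast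
      then have "v \<in> C n'" using J2C by blast
      moreover have "z \<in> C n'" using z by blast
      ultimately have "z \<ominus> v \<in> C n'" by (intro right_ideal_diff[OF C])
      then have "t \<otimes> r \<in> C n'" using vr(3) vc trc by (simp add: add_minus_cancel_left)
      then have "t \<otimes> r \<in> J2" by (rule tr[OF vr(2)])
      then show "z \<in> J2" using vJ2 vr(3) right_ideal_add[OF right_ideal_J2] by simp
    qed
    then have "P (?T, n', c')" using T' TT'(1) T(2) c'W by (auto simp: P_def)
    moreover have "Q s (?T, n', c')"
      unfolding Q_def s using nn' TT' tX c'T tC c't by auto
    ultimately show "\<exists>s'. P s' \<and> Q s s'" by blast
  qed
  then obtain f where P: "\<And>n. P (f n)" and Q: "\<And>n. Q (f n) (f (Suc n))" by blast
  define T N c where "T k = fst (f k)" and "N k = fst (snd (f k))" and "c k = snd (snd (f k))" for k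
  have fk: "f k = (T k, N k, c k)" for k by (simp add: T_def N_def c_def)
  have T: "right_ideal (T k) R" "J2 \<subseteq> T k" and cW: "c k \<in> left_annihilator R J2" for k
    using P[of k] unfolding fk P_def by auto
  have Nlt: "N k < N (Suc k)" and TS: "T k \<subseteq> T (Suc k)" and cS: "\<And>t. t \<in> T k \<Longrightarrow> c (Suc k) \<otimes> t = c k \<otimes> t"
    and cN: "\<exists>t\<in>T (Suc k) \<inter> C (N k). c (Suc k) \<otimes> t \<noteq> \<zero>" for k
    using Q[of k] unfolding fk Q_def by auto
  have Nk: "k \<le> N k" for k
  proof (induction k)
    case (Suc k)
    then show ?case using Nlt[of k] by simp
  qed simp
  have Tmono: "T k \<subseteq> T l" if "k \<le> l" for k l using lift_Suc_mono_le[of T k l] TS that by blast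
  have ck: "c k \<in> carrier R" for k using cW by (simp add: left_annihilator_def)
  have ceq: "c l \<otimes> t = c k \<otimes> t" if "k \<le> l" "t \<in> T k" for k l t
    using that
  proof (induction l rule: dec_induct)
    case (step l)
    then have "t \<in> T l" using Tmono by blast
    then show ?case using cS step by simp
  qed simp
  note Tc = subsetD[OF right_ideal_carrier[OF T(1)]]
  \<comment> \<open>The multipliers agree on the increasing \<open>T k\<close> and define one
    homomorphism on the union, for which injectivity supplies a single \<open>d\<close>.\<close>
  let ?G = "{(t, c k \<otimes> t) | t k. t \<in> T k}"
  have "\<exists>d\<in>carrier R. \<forall>t y. (t, y) \<in> ?G \<longrightarrow> y = d \<otimes> t"
  proof (rule baer_injectiveD[OF baer])
    show "?G \<subseteq> carrier R \<times> carrier R" using Tc ck by auto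
    show "(\<zero>, \<zero>) \<in> ?G" using right_ideal_zero[OF T(1)] ck[of 0] by (intro CollectI exI[of _ \<zero>] exI[of _ 0]) simp
    show "(t \<oplus> t', y \<oplus> y') \<in> ?G" if ty: "(t, y) \<in> ?G" "(t', y') \<in> ?G" for t y t' y'
    proof -
      obtain k l where k: "t \<in> T k" "y = c k \<otimes> t" and l: "t' \<in> T l" "y' = c l \<otimes> t'" using ty by auto
      define m where "m = max k l"
      have m: "k \<le> m" "l \<le> m" by (auto simp: m_def)
      have tt: "t \<in> T m" "t' \<in> T m" using k l Tmono[OF m(1)] Tmono[OF m(2)] by auto
      have "y \<oplus> y' = c m \<otimes> (t \<oplus> t')"
        using k l ceq[OF m(1) k(1)] ceq[OF m(2) l(1)] Tc[OF tt(1)] Tc[OF tt(2)] ck by (simp add: r_distr)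
      moreover have "t \<oplus> t' \<in> T m" using tt right_ideal_add[OF T(1)] by blast
      ultimately show ?thesis by blast
    qed
    show "(t \<otimes> r, y \<otimes> r) \<in> ?G" if ty: "(t, y) \<in> ?G" and r: "r \<in> carrier R" for t y r
    proof -
      obtain k where k: "t \<in> T k" "y = c k \<otimes> t" using ty by auto
      then have "y \<otimes> r = c k \<otimes> (t \<otimes> r)" "t \<otimes> r \<in> T k"
        using Tc ck r right_ideal_mult[OF T(1) r] by (auto simp: m_assoc)
      then show ?thesis by blast
    qed
    show "y = \<zero>" if "(\<zero>, y) \<in> ?G" for y using that ck by auto
  qed
  then obtain d where d: "d \<in> carrier R" "\<And>t y. (t, y) \<in> ?G \<Longrightarrow> y = d \<otimes> t" by blast
  have dT: "d \<otimes> t = c k \<otimes> t" if "t \<in> T k" for t k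
  proof -
    have "(t, c k \<otimes> t) \<in> ?G" using that by blast
    then have "c k \<otimes> t = d \<otimes> t" by (rule d(2))
    then show ?thesis by simp
  qed
  have "d \<in> left_annihilator R J2"
    using d(1) dT[of _ 0] subsetD[OF T(2)[of 0]] cW[of 0] by (auto simp: left_annihilator_def)
  \<comment> \<open>\<open>d\<close> kills \<open>C m\<close>, and \<open>C (N m)\<close> is
    contained in it as \<open>m \<le> N m\<close>; but stage \<open>Suc m\<close> left a nonzero
    value of \<open>d\<close> on \<open>C (N m)\<close>.\<close>
  then obtain m where m: "d \<in> span (opposite_ring R) (x ` {..<m})" unfolding W by blast
  obtain t where t: "t \<in> T (Suc m)" "t \<in> C (N m)" "c (Suc m) \<otimes> t \<noteq> \<zero>" using cN by blast
  have "t \<in> C m" using dec[OF Nk] t(2) by blast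
  then have "d \<otimes> t = \<zero>" by (rule kill[OF m])
  then show False using dT[OF t(1)] t(3) by simp
qed

text \<open>\<open>l(J2) \<subseteq> l(J \<inter> r(X)) = l(J) + l(r(X)) = S + RX\<close>, by the
  annihilator formulas for intersections and for finite sets.\<close>

lemma annihilator_square_generators:
  assumes X: "finite X" "X \<subseteq> carrier R" and C: "J \<inter> right_annihilator R X \<subseteq> J2"
  shows "left_annihilator R J2 \<subseteq> span (opposite_ring R) (S \<union> X)"
proof
  interpret O: ring "opposite_ring R" by (rule ring_opposite)
  fix w assume "w \<in> left_annihilator R J2"
  then have "w \<in> left_annihilator R (J \<inter> right_annihilator R X)" using C by (auto simp: left_annihilator_def)
  then obtain y z where yz: "y \<in> S" "z \<in> left_annihilator R (right_annihilator R X)" "w = y \<oplus> z"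
    using baer_left_annihilator_Int[OF baer right_ideal_J right_ideal_right_annihilator[OF X(2)]] by blast
  have "z \<in> span (opposite_ring R) X"
    using yz(2) by (intro baer_finite_left_annihilator[OF baer X]) (auto simp: left_annihilator_def right_annihilator_def)
  then have z: "z \<in> span (opposite_ring R) (S \<union> X)" using O.right_span_mono[of X "S \<union> X"] by blast
  have y: "y \<in> span (opposite_ring R) (S \<union> X)" using subsetD[OF O.right_span_upper, of y "S \<union> X"] yz(1) by blast
  have "left_ideal (span (opposite_ring R) (S \<union> X)) R"
    using O.right_ideal_span[of "S \<union> X"] X(2) S_carrier by auto
  then show "w \<in> span (opposite_ring R) (S \<union> X)" using y z yz(3) left_ideal_add by blast
qed

text \<open>Finitely many elements of \<open>J\<close> decide whether an element of
  \<open>S + RX\<close> kills all of \<open>J\<close>. Each new generator \<open>x\<close> is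
  handled by the descending chain condition for left ideals above \<open>J\<close>.\<close>

lemma finite_test_set:
  assumes "finite X" "X \<subseteq> left_annihilator R J2"
  shows "\<exists>F. finite F \<and> F \<subseteq> J \<and>
    (\<forall>w\<in>span (opposite_ring R) (S \<union> X). (\<forall>t\<in>F. w \<otimes> t = \<zero>) \<longrightarrow> w \<in> S)"
  using assms
proof (induction X rule: finite_induct)
  case empty
  interpret O: ring "opposite_ring R" by (rule ring_opposite)
  have "left_ideal S R" using two_sided_S by (simp add: two_sided_ideal_def)
  then have "span (opposite_ring R) S \<subseteq> S" by (intro O.right_span_least) simp_all
  then show ?case by (intro exI[of _ "{}"]) auto
next
  case (insert x X)
  interpret O: ring "opposite_ring R" by (rule ring_opposite)
  have xW: "x \<in> left_annihilator R J2" and XW: "X \<subseteq> left_annihilator R J2" using insert.prems by auto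
  have xc: "x \<in> carrier R" using xW by (simp add: left_annihilator_def)
  obtain F0 where F0: "finite F0" "F0 \<subseteq> J"
    and F0S: "\<forall>w\<in>span (opposite_ring R) (S \<union> X). (\<forall>t\<in>F0. w \<otimes> t = \<zero>) \<longrightarrow> w \<in> S"
    using insert.IH[OF XW] by blast
  define V where "V = span (opposite_ring R) (S \<union> X)"
  have SXc: "S \<union> X \<subseteq> carrier R" using S_carrier XW by (auto simp: left_annihilator_def)
  have V: "left_ideal V R" unfolding V_def using O.right_ideal_span[of "S \<union> X"] SXc by simp
  note Vc = subsetD[OF left_ideal_carrier[OF V]]
  have SV: "S \<subseteq> V" unfolding V_def using O.right_span_upper[of "S \<union> X"] by blast
  have xJ: "x \<otimes> t \<in> S" if t: "t \<in> J" for t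
    using xc Jc t xW J2_mult[OF t] by (auto simp: left_annihilator_def m_assoc)
  \<comment> \<open>The coefficients \<open>a\<close> for which some element of
    \<open>V + a x\<close> vanishes on \<open>F\<close>. These left ideals shrink as
    \<open>F\<close> grows, and they contain \<open>J\<close> because
    \<open>x J \<subseteq> S\<close> and \<open>J S = 0\<close>; so a finite \<open>F\<close>
    attains the smallest.\<close>
  define A where "A F = {a \<in> carrier R. \<exists>w\<in>V. \<forall>t\<in>F. (w \<oplus> a \<otimes> x) \<otimes> t = \<zero>}" for F
  let ?F = "{A (F0 \<union> F) | F. finite F \<and> F \<subseteq> J}"
  have Aideal: "left_ideal (A F) R" if F: "F \<subseteq> J" for F
  proof (rule left_idealI)
    have Fc: "t \<in> carrier R" if "t \<in> F" for t using that F Jc by blast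
    show "A F \<subseteq> carrier R" by (auto simp: A_def)
    show "\<zero> \<in> A F" using left_ideal_zero[OF V] xc Fc by (auto simp: A_def intro!: bexI[of _ \<zero>])
    show "a \<oplus> b \<in> A F" if ab: "a \<in> A F" "b \<in> A F" for a b
    proof -
      obtain v w where vw: "v \<in> V" "\<forall>t\<in>F. (v \<oplus> a \<otimes> x) \<otimes> t = \<zero>" "w \<in> V" "\<forall>t\<in>F. (w \<oplus> b \<otimes> x) \<otimes> t = \<zero>"
        using ab by (auto simp: A_def)
      have c: "a \<in> carrier R" "b \<in> carrier R" using ab by (auto simp: A_def)
      have "((v \<oplus> w) \<oplus> (a \<oplus> b) \<otimes> x) \<otimes> t = \<zero>" if t: "t \<in> F" for t
      proof -
        have "((v \<oplus> w) \<oplus> (a \<oplus> b) \<otimes> x) \<otimes> t = (v \<oplus> a \<otimes> x) \<otimes> t \<oplus> (w \<oplus> b \<otimes> x) \<otimes> t"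
          using c Vc[OF vw(1)] Vc[OF vw(3)] xc Fc[OF t] by algebra
        then show ?thesis using vw t by simp
      qed
      moreover have "v \<oplus> w \<in> V" using vw left_ideal_add[OF V] by blast
      ultimately show ?thesis using c by (auto simp: A_def)
    qed
    show "r \<otimes> a \<in> A F" if r: "r \<in> carrier R" and a: "a \<in> A F" for r a
    proof -
      obtain v where v: "v \<in> V" "\<forall>t\<in>F. (v \<oplus> a \<otimes> x) \<otimes> t = \<zero>" using a by (auto simp: A_def)
      have c: "a \<in> carrier R" using a by (auto simp: A_def)
      have "(r \<otimes> v \<oplus> (r \<otimes> a) \<otimes> x) \<otimes> t = \<zero>" if t: "t \<in> F" for t
      proof -
        have "(r \<otimes> v \<oplus> (r \<otimes> a) \<otimes> x) \<otimes> t = r \<otimes> ((v \<oplus> a \<otimes> x) \<otimes> t)"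
          using c r Vc[OF v(1)] xc Fc[OF t] by algebra
        then show ?thesis using v t r by simp
      qed
      moreover have "r \<otimes> v \<in> V" using v r left_ideal_mult[OF V] by blast
      ultimately show ?thesis using c r by (auto simp: A_def)
    qed
  qed
  have JA: "J \<subseteq> A F" if F: "F \<subseteq> J" for F
  proof
    fix j assume j: "j \<in> J"
    have "(\<zero> \<oplus> j \<otimes> x) \<otimes> t = \<zero>" if t: "t \<in> F" for t
    proof -
      have tJ: "t \<in> J" using t F by blast
      have "(\<zero> \<oplus> j \<otimes> x) \<otimes> t = j \<otimes> (x \<otimes> t)" using Jc[OF j] Jc[OF tJ] xc by (simp add: m_assoc)
      then show ?thesis using J_mult_S[OF j xJ[OF tJ]] by simp
    qed
    then show "j \<in> A F" using j Jc left_ideal_zero[OF V] unfolding A_def by blast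
  qed
  have "\<exists>M\<in>?F. \<forall>Y\<in>?F. Y \<subseteq> M \<longrightarrow> Y = M"
  proof (rule dcc_imp_minimal)
    show "A (F0 \<union> {}) \<in> ?F" by blast
    fix f :: "nat \<Rightarrow> 'a set" assume f: "\<And>n. f n \<in> ?F" "\<And>n. f (Suc n) \<subseteq> f n"
    show "\<exists>m. \<forall>n\<ge>m. f n = f m"
    proof (rule O.semisimple_dcc[of J])
      fix n
      obtain F where F: "f n = A (F0 \<union> F)" "F \<subseteq> J" using f(1)[of n] by blast
      show "left_ideal (f n) R" unfolding F(1) using F(2) F0(2) by (intro Aideal) blast
      show "J \<subseteq> f n" unfolding F(1) using F(2) F0(2) by (intro JA) blast
      show "f (Suc n) \<subseteq> f n" by (rule f(2))
    qed (simp_all add: J semisimple_opposite[OF J ss])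
  qed
  then obtain M where M: "M \<in> ?F" and Mmin: "\<forall>Y\<in>?F. Y \<subseteq> M \<longrightarrow> Y = M" by (rule bexE)
  from M obtain F1 where F1: "finite F1" "F1 \<subseteq> J" "M = A (F0 \<union> F1)" by auto
  let ?F1 = "F0 \<union> F1"
  have Amin: "A (insert t ?F1) = A ?F1" if t: "t \<in> J" for t
  proof (rule Mmin[unfolded F1(3), rule_format])
    show "A (insert t ?F1) \<in> ?F" using F1(1,2) t by (intro CollectI exI[of _ "insert t F1"]) auto
    show "A (insert t ?F1) \<subseteq> A ?F1" unfolding A_def by blast
  qed
  have "w \<in> S" if w: "w \<in> span (opposite_ring R) (S \<union> insert x X)" and kill: "\<And>t. t \<in> ?F1 \<Longrightarrow> w \<otimes> t = \<zero>" for w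
  proof -
    obtain v a where va: "v \<in> V" "a \<in> carrier R" "w = v \<oplus> a \<otimes> x"
      using span_insert_left[OF xc SXc, of w] w unfolding V_def by auto
    have vc: "v \<in> carrier R" using Vc va by blast
    have wc: "w \<in> carrier R" using va vc xc by simp
    have aA: "a \<in> A ?F1" unfolding A_def using va kill by blast
    have "w \<otimes> t = \<zero>" if t: "t \<in> J" for t
    proof -
      have tc: "t \<in> carrier R" using Jc t by blast
      have "a \<in> A (insert t ?F1)" using aA Amin[OF t] by simp
      then obtain v' where v': "v' \<in> V" "\<forall>s\<in>insert t ?F1. (v' \<oplus> a \<otimes> x) \<otimes> s = \<zero>" unfolding A_def by blast
      have v'c: "v' \<in> carrier R" using Vc v' by blast
      have diff: "(v \<ominus> v') \<otimes> s = w \<otimes> s \<ominus> (v' \<oplus> a \<otimes> x) \<otimes> s" if "s \<in> carrier R" for s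
      proof -
        have ax: "a \<otimes> x \<in> carrier R" using va xc by simp
        have "w = (v \<ominus> v') \<oplus> (v' \<oplus> a \<otimes> x)"
          using va vc v'c ax by (simp add: a_minus_def a_assoc r_neg1)
        then have "w \<otimes> s = (v \<ominus> v') \<otimes> s \<oplus> (v' \<oplus> a \<otimes> x) \<otimes> s"
          using that vc v'c ax by (simp add: l_distr)
        then show ?thesis using that vc v'c ax by (simp add: add_minus_cancel_right)
      qed
      \<comment> \<open>\<open>v - v'\<close> is the difference of \<open>w\<close> and
        \<open>v' + a x\<close>, both of which vanish on \<open>F0\<close>, so the induction
        hypothesis applies. The second also vanishes at \<open>t\<close>, which leaves
        \<open>w t = 0\<close>.\<close>
      have "v \<ominus> v' \<in> S"
      proof (rule F0S[rule_format])
        show "v \<ominus> v' \<in> span (opposite_ring R) (S \<union> X)"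
          using left_ideal_diff[OF V va(1) v'(1)] by (simp add: V_def)
        show "(v \<ominus> v') \<otimes> s = \<zero>" if s: "s \<in> F0" for s
        proof -
          have "s \<in> carrier R" using s F0 Jc by blast
          then show ?thesis using diff[of s] kill[of s] v'(2) s by simp
        qed
      qed
      then have "(v \<ominus> v') \<otimes> t = \<zero>" by (rule S_J[OF _ t])
      then have "w \<otimes> t \<ominus> \<zero> = \<zero>" using diff[OF tc] v'(2) by simp
      then show ?thesis using wc tc by simp
    qed
    then show ?thesis using wc by (simp add: left_annihilator_def)
  qed
  then show ?case using F0 F1 by (intro exI[of _ ?F1]) auto
qed

text \<open>The test set \<open>F\<close> generates \<open>J\<close> modulo \<open>J2\<close>
  because right ideals are separated by left multipliers; T-nilpotence removes
  \<open>J2\<close>.\<close>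

lemma radical_finitely_generated:
  assumes nil: "right_T_nilpotent R J"
    and cg: "countably_generated (left_annihilator R J2) (opposite_ring R) (left_regular R)"
  shows "\<exists>F. finite F \<and> F \<subseteq> J \<and> J \<subseteq> span R F"
proof -
  interpret O: ring "opposite_ring R" by (rule ring_opposite)
  obtain X where X: "countable X" "X \<subseteq> carrier R" "left_annihilator R J2 = span (opposite_ring R) X"
    using cg by (auto simp: countably_generated_def left_regular_def)
  \<comment> \<open>\<open>\<zero>\<close> is inserted so that there is something to enumerate even
    for empty \<open>X\<close>; spans are unaffected.\<close>
  define x where "x = from_nat_into (insert \<zero> X)"
  have xr: "range x = insert \<zero> X" unfolding x_def using X(1) by (intro range_from_nat_into) auto
  have xc: "x n \<in> carrier R" for n using xr X(2) rangeI[of x n] by auto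
  let ?L = "\<lambda>n. span (opposite_ring R) (x ` {..<n})"
  have L: "left_ideal (?L n) R" for n using O.right_ideal_span[of "x ` {..<n}"] xc by auto
  have W: "left_annihilator R J2 = (\<Union>n. ?L n)"
  proof
    have "left_ideal (\<Union>n. ?L n) R"
      by (rule O.right_ideal_UN_mono) (auto intro!: monoI O.right_span_mono L)
    moreover have "X \<subseteq> (\<Union>n. ?L n)"
    proof
      fix y assume "y \<in> X"
      then obtain n where "y = x n" using xr by blast
      then have "y \<in> ?L (Suc n)" using subsetD[OF O.right_span_upper, of "x n" "x ` {..<Suc n}"] by simp
      then show "y \<in> (\<Union>n. ?L n)" by blast
    qed
    ultimately show "left_annihilator R J2 \<subseteq> (\<Union>n. ?L n)" unfolding X(3) by (rule O.right_span_least)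
    have lW: "left_ideal (left_annihilator R J2) R"
      using left_ideal_left_annihilator[OF two_sided_ideal_carrier[OF two_sided_J2]] .
    have "range x \<subseteq> left_annihilator R J2"
      unfolding xr using left_ideal_zero[OF lW] O.right_span_upper[of X] X(3) by simp
    then have "?L n \<subseteq> left_annihilator R J2" for n
      by (intro O.right_span_least[OF lW]) auto
    then show "(\<Union>n. ?L n) \<subseteq> left_annihilator R J2" by blast
  qed
  obtain n where n: "J \<inter> right_annihilator R (x ` {..<n}) \<subseteq> J2"
    using annihilator_chain_reaches_square[OF xc W] by blast
  let ?X = "x ` {..<n}"
  have Xc: "finite ?X" "?X \<subseteq> carrier R" using xc by auto
  have "?X \<subseteq> left_annihilator R J2" unfolding W using O.right_span_upper[of ?X] by blast
  then obtain F where F: "finite F" "F \<subseteq> J"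
    and FS: "\<forall>w\<in>span (opposite_ring R) (S \<union> ?X). (\<forall>t\<in>F. w \<otimes> t = \<zero>) \<longrightarrow> w \<in> S"
    using finite_test_set[OF Xc(1)] by blast
  have Fc: "F \<subseteq> carrier R" using F Jc by blast
  have J2c: "J2 \<subseteq> carrier R" by (rule two_sided_ideal_carrier[OF two_sided_J2])
  have T: "right_ideal (span R (F \<union> J2)) R" using Fc J2c by (intro right_ideal_span) auto
  have JT: "J \<subseteq> span R (F \<union> J2)"
  proof
    fix t assume t: "t \<in> J"
    show "t \<in> span R (F \<union> J2)"
    proof (rule ccontr)
      assume "t \<notin> span R (F \<union> J2)"
      then obtain c where c: "c \<in> left_annihilator R (span R (F \<union> J2))" "c \<otimes> t \<noteq> \<zero>"
        using right_ideal_separation[OF T Jc[OF t]] by blast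
      \<comment> \<open>A multiplier killing \<open>F\<close> and \<open>J2\<close> belongs to
        \<open>S + RX\<close> and passes the test, so it lies in \<open>S\<close> and kills
        \<open>t\<close> as well.\<close>
      have "c \<in> left_annihilator R (F \<union> J2)"
        using c(1) right_span_upper[of "F \<union> J2"] by (auto simp: left_annihilator_def)
      then have "c \<in> left_annihilator R J2" "\<And>t. t \<in> F \<Longrightarrow> c \<otimes> t = \<zero>" by (auto simp: left_annihilator_def)
      then have "c \<in> S" using annihilator_square_generators[OF Xc n] FS by blast
      then show False using S_J[OF _ t] c(2) by blast
    qed
  qed
  have "J \<subseteq> span R F"
  proof (rule right_module.T_nilpotent_small[OF right_module_right_regular right_ideal_J nil right_ideal_J])
    show sF: "right_ideal (span R F) R" using right_ideal_span[OF Fc] .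
    let ?Y = "span R F \<union> {a \<odot>\<^bsub>right_regular R\<^esub> y | a y. a \<in> J \<and> y \<in> J}"
    have Y: "right_ideal (span R ?Y) R"
      using right_ideal_carrier[OF sF] Jc by (intro right_ideal_span) auto
    have "F \<subseteq> span R ?Y" using right_span_upper[of F] right_span_upper[of ?Y] by blast
    moreover have "J2 \<subseteq> span R ?Y"
    proof
      fix z assume "z \<in> J2"
      then show "z \<in> span R ?Y"
      proof (induction rule: ideal_prod.induct)
        case (prod i j)
        then have "i \<otimes> j \<in> ?Y" by auto
        then show ?case using right_span_upper[of ?Y] by blast
      qed (rule right_ideal_add[OF Y])
    qed
    ultimately have "span R (F \<union> J2) \<subseteq> span R ?Y" by (intro right_span_least[OF Y]) simp
    then show "J \<subseteq> span R ?Y" using JT by blast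
  qed
  then show ?thesis using F by blast
qed

end

subsection \<open>Strongly ss-injective rings with chain condition\<close>

text \<open>\<open>U\<close> carries no data; it fixes the type over which the test modules
  range.\<close>

locale ss_injective_chain = ring R for R :: "('a, 'b) ring_scheme" (structure) +
  fixes U :: "('a, 'm) universe itself"
  assumes ss_injective: "strongly_right_ss_injective U R"
    and essential_socle: "essential_submodule (socle R (right_regular R)) R (right_regular R)"
    and chain: "(\<And>n. x n \<in> carrier R) \<Longrightarrow>
      \<exists>m. \<forall>n\<ge>m. right_annihilator R {left_product R x n} = right_annihilator R {left_product R x m}"
begin

abbreviation Sr where "Sr \<equiv> socle R (right_regular R)"
abbreviation J where "J \<equiv> jacobson_radical R"

interpretation RR: right_module R "right_regular R" by (rule right_module_right_regular)

lemma right_ideal_socle: "right_ideal Sr R"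
  by (rule RR.submodule_socle)

lemmas Sr_carrier = subsetD[OF right_ideal_carrier[OF right_ideal_socle]]
lemmas Jc = J_carrier[OF two_sided_jacobson]
lemmas Jcl = J_closed[OF two_sided_jacobson]

text \<open>The form in which the chain condition is applied: at some stage the next left factor
  kills nothing new.\<close>

lemma chain_Suc:
  assumes "\<And>n. x n \<in> carrier R"
  shows "\<exists>m. \<forall>b\<in>carrier R. left_product R x (Suc m) \<otimes> b = \<zero> \<longrightarrow> left_product R x m \<otimes> b = \<zero>"
proof -
  obtain m where "\<forall>n\<ge>m. right_annihilator R {left_product R x n} = right_annihilator R {left_product R x m}"
    using chain[of x] assms by blast
  then have "right_annihilator R {left_product R x (Suc m)} = right_annihilator R {left_product R x m}"
    using le_SucI[OF order_refl, of m] by blast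
  then show ?thesis by (auto simp: right_annihilator_def set_eq_iff)
qed

lemma left_multiplication_hom: "a \<in> carrier R \<Longrightarrow> (\<lambda>x. a \<otimes> x) \<in> right_hom R (right_regular R) (right_regular R)"
  by (auto simp: right_hom_iff r_distr m_assoc)

text \<open>Right ideals inside \<open>J\<close> are small in \<open>R\<close>, since
  \<open>1 = k + l'\<close> makes \<open>l' = 1 - k\<close> right invertible. The hypothesis is
  applied to the copy of \<open>R\<close> in the universe.\<close>

lemma small_extension:
  assumes K: "right_ideal K R" "K \<subseteq> J" "K \<subseteq> Sr"
    and f: "f \<in> right_hom R ((right_regular R)\<lparr>carrier := K\<rparr>) (right_regular R)"
  shows "\<exists>c\<in>carrier R. \<forall>k\<in>K. f k = c \<otimes> k"
proof -
  let ?e = "embed_ring :: 'a \<Rightarrow> ('a, 'm) universe"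
  let ?M = "image_module ?e (right_regular R)"
  interpret M: right_module R ?M by (rule right_module_embed_ring)
  note e = right_hom_embed_ring[where 'm = 'm]
  have carrier: "carrier ?M = ?e ` carrier R" by (rule carrier_embed_ring)
  have sK: "submodule (?e ` K) R ?M"
    using submodule_hom_image[OF right_module_right_regular right_module_embed_ring e K(1)] .
  have "?e ` Sr \<subseteq> socle R ?M"
    using inj_embed_ring inj_on_subset[OF _ subset_UNIV] by (intro socle_image[OF right_module_right_regular right_module_embed_ring e]) blast
  then have "?e ` K \<subseteq> socle R ?M" using K(3) by blast
  then have "semisimple_module R (?M\<lparr>carrier := ?e ` K\<rparr>)" by (rule M.semisimple_of_subset_socle[OF sK])
  moreover have "small_submodule (?e ` K) R ?M"
    unfolding small_submodule_def
  proof (intro conjI allI impI)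
    fix L assume L: "submodule L R ?M \<and> L \<noteq> carrier ?M"
    let ?L = "{r \<in> carrier (right_regular R). ?e r \<in> L}"
    have rL: "right_ideal ?L R"
      using submodule_hom_preimage[OF right_module_right_regular right_module_embed_ring e] L by blast
    show "?e ` K <+>\<^bsub>?M\<^esub> L \<noteq> carrier ?M"
    proof
      assume "?e ` K <+>\<^bsub>?M\<^esub> L = carrier ?M"
      then have "?e \<one> \<in> ?e ` K <+>\<^bsub>?M\<^esub> L" using carrier by simp
      then obtain k l where kl: "k \<in> K" "l \<in> L" "?e \<one> = ?e k \<oplus>\<^bsub>?M\<^esub> l" by (auto simp: M.mem_sum_iff)
      obtain l' where l': "l' \<in> carrier R" "l = ?e l'" using kl(2) L M.submodule_carrier carrier by blast
      have kc: "k \<in> carrier R" using kl(1) right_ideal_carrier[OF K(1)] by blast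
      have "?e \<one> = ?e (k \<oplus> l')" using kl(3) l' right_hom_add[OF e, of k l'] kc by simp
      then have "\<one> = k \<oplus> l'" using inj_embed_ring by (rule injD[rotated])
      then have "\<one> \<ominus> k = l'" using kc l' by (simp add: add_minus_cancel_left)
      moreover obtain u where u: "u \<in> carrier R" "(\<one> \<ominus> k) \<otimes> u = \<one>"
        using jacobson_right_inverse kl(1) K(2) by blast
      moreover have "l' \<in> ?L" using l' kl by simp
      ultimately have "\<one> \<in> ?L" using right_ideal_mult[OF rL u(1), of l'] by simp
      then have "?L = carrier R" by (rule right_ideal_eq_carrier[OF rL])
      then have "carrier ?M \<subseteq> L" unfolding carrier by auto
      then show False using L M.submodule_carrier by blast
    qed
  qed (rule sK)
  ultimately have "extends_to R (?e ` K) ?M (right_regular R)"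
    using ss_injective M.right_module_axioms unfolding strongly_right_ss_injective_def by blast
  then show ?thesis by (rule extends_to_embed_ring[OF K(1) f])
qed

text \<open>A simple right ideal outside of \<open>J\<close> is generated by an idempotent.\<close>

lemma idempotent_outside_radical:
  assumes K: "right_ideal K R" "K \<subseteq> Sr" and KJ: "\<not> K \<subseteq> J"
  shows "\<exists>e\<in>K. e \<noteq> \<zero> \<and> e \<otimes> e = e"
proof -
  interpret K: right_module R "(right_regular R)\<lparr>carrier := K\<rparr>" by (rule RR.right_module_restrict[OF K(1)])
  have "\<exists>P. simple_submodule P R (right_regular R) \<and> P \<subseteq> K \<and> \<not> P \<subseteq> J"
  proof (rule ccontr)
    assume no: "\<not> ?thesis"
    have "socle R ((right_regular R)\<lparr>carrier := K\<rparr>) \<subseteq> K \<inter> J"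
    proof (rule K.socle_least)
      show "submodule (K \<inter> J) R ((right_regular R)\<lparr>carrier := K\<rparr>)"
        using right_ideal_Int[OF K(1) right_ideal_jacobson] by (simp add: RR.submodule_restrict_iff[OF K(1)])
      show "P \<subseteq> K \<inter> J" if "simple_submodule P R ((right_regular R)\<lparr>carrier := K\<rparr>)" for P
        using that no by (auto simp: RR.simple_submodule_restrict_iff[OF K(1)])
    qed
    moreover have "socle R ((right_regular R)\<lparr>carrier := K\<rparr>) = K"
      using RR.semisimple_of_subset_socle[OF K] by (simp add: semisimple_module_def)
    ultimately show False using KJ by blast
  qed
  then obtain P where P: "right_ideal P R" "P \<noteq> {\<zero>}" "P \<subseteq> K" "\<not> P \<subseteq> J"
    and Ps: "\<And>H. right_ideal H R \<Longrightarrow> H \<subseteq> P \<Longrightarrow> H = {\<zero>} \<or> H = P"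
    by (auto simp: simple_submodule_def)
  note Pc = subsetD[OF right_ideal_carrier[OF P(1)]]
  obtain I where I: "maximal_right_ideal I R" "\<not> P \<subseteq> I"
    using P(4) Pc by (auto simp: jacobson_radical_def)
  have rI: "right_ideal I R" using I by (simp add: maximal_right_ideal_def)
  have PI: "P \<inter> I = {\<zero>}" using Ps[OF right_ideal_Int[OF P(1) rI]] I(2) by blast
  have "P <+>\<^bsub>R\<^esub> I = I \<or> P <+>\<^bsub>R\<^esub> I = carrier R"
    using I(1) right_ideal_sum[OF P(1) rI] right_ideal_sum_upper(2)[OF P(1) rI] by (simp add: maximal_right_ideal_def)
  then have "\<one> \<in> P <+>\<^bsub>R\<^esub> I" using right_ideal_sum_upper(1)[OF P(1) rI] I(2) by auto
  then obtain e t where et: "e \<in> P" "t \<in> I" "\<one> = e \<oplus> t" by (auto simp: mem_sum_iff)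
  have c: "e \<in> carrier R" "t \<in> carrier R" using et Pc right_ideal_carrier[OF rI] by auto
  have ep: "e \<otimes> p = p" if p: "p \<in> P" for p
  proof -
    have "t = \<one> \<ominus> e" using et(3) c by (simp add: add_minus_cancel_left)
    then have "t \<otimes> p = p \<ominus> e \<otimes> p" using c Pc[OF p] by (simp, algebra)
    moreover have "p \<ominus> e \<otimes> p \<in> P" using p et Pc right_ideal_one_sided[OF P(1)] by simp
    moreover have "t \<otimes> p \<in> I" by (rule right_ideal_mult[OF rI Pc[OF p] et(2)])
    ultimately have "p \<ominus> e \<otimes> p = \<zero>" using PI by auto
    then show ?thesis using c Pc[OF p] by simp
  qed
  moreover have "e \<noteq> \<zero>"
  proof
    assume "e = \<zero>"
    then have "p = \<zero>" if "p \<in> P" for p using ep[OF that] Pc[OF that] by simp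
    then show False using P(2) right_ideal_zero[OF P(1)] by blast
  qed
  ultimately show ?thesis using et(1) P(3) by blast
qed

text \<open>
  Otherwise there would be infinitely many orthogonal idempotents \<open>e\<^sub>n\<close>, contradicting the chain
  condition for the sequence \<open>1 - e\<^sub>n\<close>.
\<close>

lemma idempotent_modulo_radical:
  assumes K: "right_ideal K R" "K \<subseteq> Sr"
  shows "\<exists>g\<in>K. g \<otimes> g = g \<and> (\<forall>k\<in>K. g \<otimes> k = \<zero> \<longrightarrow> k \<in> J)"
proof (rule ccontr)
  assume no: "\<not> ?thesis"
  note Kc = subsetD[OF right_ideal_carrier[OF K(1)]]
  define P where "P g \<longleftrightarrow> g \<in> K \<and> g \<otimes> g = g" for g
  define Q where "Q g g' \<longleftrightarrow> (\<exists>e\<in>K. e \<noteq> \<zero> \<and> e \<otimes> e = e \<and> g \<otimes> e = \<zero> \<and> e \<otimes> g = \<zero> \<and> g' = g \<oplus> e)" for g g'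
  have "\<exists>f. \<forall>n::nat. P (f n) \<and> (Q (f n) (f (Suc n)) \<and> (n = 0 \<longrightarrow> f n = \<zero>))"
  proof -
    have "\<exists>f. \<forall>n::nat. (P (f n) \<and> (n = 0 \<longrightarrow> f n = \<zero>)) \<and> Q (f n) (f (Suc n))"
    proof (rule dependent_nat_choice)
      show "\<exists>g. P g \<and> (0 = 0 \<longrightarrow> g = \<zero>)" using right_ideal_zero[OF K(1)] by (auto simp: P_def)
      fix g and n :: nat assume "P g \<and> (n = 0 \<longrightarrow> g = \<zero>)"
      then have g: "g \<in> K" "g \<otimes> g = g" by (auto simp: P_def)
      have gc: "g \<in> carrier R" using g Kc by blast
      let ?K = "{k \<in> K. g \<otimes> k = \<zero>}"
      have K': "right_ideal ?K R"
        using Kc right_ideal_one_sided[OF K(1)] gc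
        by (intro right_idealI) (auto simp: r_distr simp flip: m_assoc)
      have "\<exists>k\<in>K. g \<otimes> k = \<zero> \<and> k \<notin> J" using no g by blast
      then have "\<not> ?K \<subseteq> J" by blast
      then obtain e where e: "e \<in> K" "g \<otimes> e = \<zero>" "e \<noteq> \<zero>" "e \<otimes> e = e"
        using idempotent_outside_radical[OF K'] K(2) by blast
      have ec: "e \<in> carrier R" using e Kc by blast
      \<comment> \<open>The factor \<open>1 - g\<close> makes \<open>e' g\<close> vanish too, and
        \<open>e' e = e\<close> shows that \<open>e'\<close> is still nonzero.\<close>
      define e' where "e' = e \<ominus> e \<otimes> g"
      have e'K: "e' \<in> K" unfolding e'_def using e g gc right_ideal_one_sided[OF K(1)] by simp
      have e'c: "e' \<in> carrier R" using e'K Kc by blast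
      have ge': "g \<otimes> e' = \<zero>"
      proof -
        have "g \<otimes> e' = g \<otimes> e \<ominus> (g \<otimes> e) \<otimes> g" unfolding e'_def using ec gc by algebra
        then show ?thesis using e(2) gc by simp
      qed
      have e'g: "e' \<otimes> g = \<zero>"
      proof -
        have "e' \<otimes> g = e \<otimes> g \<ominus> e \<otimes> (g \<otimes> g)" unfolding e'_def using ec gc by algebra
        then show ?thesis using g(2) gc ec by simp
      qed
      have e'e: "e' \<otimes> e = e"
      proof -
        have "e' \<otimes> e = e \<otimes> e \<ominus> e \<otimes> (g \<otimes> e)" unfolding e'_def using ec gc by algebra
        then show ?thesis using e ec by (simp add: a_minus_def)
      qed
      have "e' \<otimes> e' = e' \<otimes> e \<ominus> (e' \<otimes> e) \<otimes> g"
        by (subst (2) e'_def) (use ec gc e'c in algebra)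
      then have e'e': "e' \<otimes> e' = e'" unfolding e'e by (simp add: e'_def)
      have e'0: "e' \<noteq> \<zero>" using e'e e(3) ec by auto
      have "(g \<oplus> e') \<otimes> (g \<oplus> e') = (g \<otimes> g \<oplus> g \<otimes> e') \<oplus> (e' \<otimes> g \<oplus> e' \<otimes> e')" using gc e'c by algebra
      then have "(g \<oplus> e') \<otimes> (g \<oplus> e') = g \<oplus> e'" using g(2) ge' e'g e'e' gc e'c by simp
      then have "P (g \<oplus> e')" using g e'K right_ideal_add[OF K(1)] by (simp add: P_def)
      moreover have "Q g (g \<oplus> e')" unfolding Q_def using e'K e'0 e'e' ge' e'g by blast
      ultimately show "\<exists>g'. (P g' \<and> (Suc n = 0 \<longrightarrow> g' = \<zero>)) \<and> Q g g'" by blast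
    qed
    then show ?thesis by blast
  qed
  then obtain f where P: "\<And>n. P (f n)" and Q: "\<And>n. Q (f n) (f (Suc n))" and f0: "f 0 = \<zero>" by blast
  have fc: "f n \<in> carrier R" for n using P[of n] Kc by (auto simp: P_def)
  have "\<forall>n. \<exists>e. e \<in> K \<and> e \<noteq> \<zero> \<and> e \<otimes> e = e \<and> f n \<otimes> e = \<zero> \<and> e \<otimes> f n = \<zero> \<and> f (Suc n) = f n \<oplus> e"
    using Q unfolding Q_def by blast
  then obtain e where e: "\<And>n. e n \<in> K" "\<And>n. e n \<noteq> \<zero>" "\<And>n. e n \<otimes> e n = e n" "\<And>n. f n \<otimes> e n = \<zero>"
    "\<And>n. e n \<otimes> f n = \<zero>" "\<And>n. f (Suc n) = f n \<oplus> e n" by metis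
  have ec: "e n \<in> carrier R" for n using e(1) Kc by blast
  define x where "x n = \<one> \<ominus> e n" for n
  \<comment> \<open>Orthogonality collapses the product. The product at index \<open>n\<close> has
    \<open>n + 1\<close> factors, while \<open>f n\<close> is the sum of \<open>n\<close>
    idempotents.\<close>
  have p: "left_product R x n = \<one> \<ominus> f (Suc n)" for n
  proof (induction n)
    case 0
    then show ?case using e(6)[of 0] f0 ec by (simp add: x_def)
  next
    case (Suc n)
    have "left_product R x (Suc n) = (\<one> \<ominus> f (Suc n)) \<ominus> e (Suc n) \<oplus> e (Suc n) \<otimes> f (Suc n)"
      unfolding left_product.simps Suc x_def using ec[of "Suc n"] fc[of "Suc n"] by algebra
    also have "\<dots> = \<one> \<ominus> f (Suc (Suc n))"
      unfolding e(5) e(6)[of "Suc n"] using ec[of "Suc n"] fc[of "Suc n"] by algebra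
    finally show ?case .
  qed
  obtain m where m: "\<forall>b\<in>carrier R. left_product R x (Suc m) \<otimes> b = \<zero> \<longrightarrow> left_product R x m \<otimes> b = \<zero>"
    using chain_Suc[of x] ec by (auto simp: x_def)
  let ?e = "e (Suc m)" and ?f = "f (Suc m)"
  \<comment> \<open>The idempotent \<open>e (Suc m)\<close> is killed by the product at
    \<open>Suc m\<close> and fixed by the one at \<open>m\<close>.\<close>
  have "left_product R x (Suc m) \<otimes> ?e = ?e \<ominus> (?f \<otimes> ?e \<oplus> ?e \<otimes> ?e)"
    unfolding p e(6)[of "Suc m"] using ec[of "Suc m"] fc[of "Suc m"] by algebra
  also have "\<dots> = \<zero>" using e(3,4)[of "Suc m"] ec by simp
  finally have "left_product R x m \<otimes> ?e = \<zero>" using m ec by blast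
  moreover have "left_product R x m \<otimes> ?e = ?e \<ominus> ?f \<otimes> ?e"
    unfolding p using ec[of "Suc m"] fc[of "Suc m"] by algebra
  ultimately show False using e(2,4)[of "Suc m"] ec[of "Suc m"] by (simp add: a_minus_def)
qed

text \<open>\<open>K\<close> is the sum of \<open>gK\<close> and the kernel of left multiplication
  by \<open>g\<close>, which lies in \<open>J\<close>. On \<open>gK\<close> the map is
  multiplication by \<open>f g\<close>, on the kernel by the \<open>c\<close> of
  \<open>small_extension\<close>.\<close>

lemma socle_extension:
  assumes K: "right_ideal K R" "K \<subseteq> Sr"
    and f: "f \<in> right_hom R ((right_regular R)\<lparr>carrier := K\<rparr>) (right_regular R)"
  shows "\<exists>c\<in>carrier R. \<forall>k\<in>K. f k = c \<otimes> k"
proof -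
  note Kc = subsetD[OF right_ideal_carrier[OF K(1)]]
  have fK: "f k \<in> carrier R" and fadd: "f (k \<oplus> l) = f k \<oplus> f l" and fmult: "r \<in> carrier R \<Longrightarrow> f (k \<otimes> r) = f k \<otimes> r"
    if "k \<in> K" "l \<in> K" for k l r
    using right_hom_closed[OF f] right_hom_add[OF f] right_hom_smult[OF f] that by auto
  obtain g where g: "g \<in> K" "g \<otimes> g = g" "\<forall>k\<in>K. g \<otimes> k = \<zero> \<longrightarrow> k \<in> J"
    using idempotent_modulo_radical[OF K] by blast
  have gc: "g \<in> carrier R" using g Kc by blast
  let ?K = "{k \<in> K. g \<otimes> k = \<zero>}"
  have K': "right_ideal ?K R"
    using Kc right_ideal_one_sided[OF K(1)] gc
    by (intro right_idealI) (auto simp: r_distr simp flip: m_assoc)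
  have "f \<in> right_hom R ((right_regular R)\<lparr>carrier := ?K\<rparr>) (right_regular R)"
    using right_hom_restrict[OF f, of ?K] by simp
  then obtain c where c: "c \<in> carrier R" "\<forall>k\<in>?K. f k = c \<otimes> k"
    using small_extension[OF K'] g(3) K(2) by blast
  have "f k = (f g \<oplus> c \<otimes> (\<one> \<ominus> g)) \<otimes> k" if k: "k \<in> K" for k
  proof -
    have kc: "k \<in> carrier R" using k Kc by blast
    have gk: "g \<otimes> k \<in> K" by (rule right_ideal_mult[OF K(1) kc g(1)])
    have kgk: "k \<ominus> g \<otimes> k \<in> K" by (rule right_ideal_diff[OF K(1) k gk])
    have "g \<otimes> (k \<ominus> g \<otimes> k) = g \<otimes> k \<ominus> (g \<otimes> g) \<otimes> k" using gc kc by algebra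
    then have "k \<ominus> g \<otimes> k \<in> ?K" using kgk g(2) gc kc by simp
    then have "f (k \<ominus> g \<otimes> k) = c \<otimes> (k \<ominus> g \<otimes> k)" using c(2) by blast
    moreover have "f k = f (k \<ominus> g \<otimes> k) \<oplus> f (g \<otimes> k)"
      using fadd[OF kgk gk] minus_add_cancel[of k "g \<otimes> k"] gc kc by simp
    moreover have "f (g \<otimes> k) = f g \<otimes> k" by (rule fmult[OF g(1) g(1) kc])
    moreover have "c \<otimes> (k \<ominus> g \<otimes> k) \<oplus> f g \<otimes> k = (f g \<oplus> c \<otimes> (\<one> \<ominus> g)) \<otimes> k"
      using fK[OF g(1) g(1)] c(1) gc kc by algebra
    ultimately show ?thesis by simp
  qed
  then show ?thesis using fK[OF g(1) g(1)] c(1) gc by (intro bexI[of _ "f g \<oplus> c \<otimes> (\<one> \<ominus> g)"]) auto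
qed

text \<open>Left multiplication by \<open>a\<close> sends a simple right ideal to zero or to an
  isomorphic copy.\<close>

lemma left_ideal_socle:
  assumes a: "a \<in> carrier R" and s: "s \<in> Sr"
  shows "a \<otimes> s \<in> Sr"
proof -
  have "Sr \<subseteq> {x \<in> carrier (right_regular R). a \<otimes> x \<in> Sr}"
  proof (rule RR.socle_least)
    show "right_ideal {x \<in> carrier (right_regular R). a \<otimes> x \<in> Sr} R"
      by (rule submodule_hom_preimage[OF right_module_right_regular right_module_right_regular
            left_multiplication_hom[OF a] right_ideal_socle])
    fix P assume P: "simple_submodule P R (right_regular R)"
    then have rP: "right_ideal P R" and Ps: "\<And>H. right_ideal H R \<Longrightarrow> H \<subseteq> P \<Longrightarrow> H = {\<zero>} \<or> H = P"
      by (auto simp: simple_submodule_def)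
    note Pc = subsetD[OF right_ideal_carrier[OF rP]]
    have "a \<otimes> p \<in> Sr" if p: "p \<in> P" for p
    proof -
      let ?A = "P \<inter> right_annihilator R {a}"
      have "right_ideal ?A R" by (intro right_ideal_Int rP right_ideal_right_annihilator) (simp add: a)
      then consider "?A = P" | "?A = {\<zero>}" using Ps by blast
      then show ?thesis
      proof cases
        case 1
        then have "a \<otimes> p = \<zero>" using p by (auto simp: right_annihilator_def)
        then show ?thesis using right_ideal_zero[OF right_ideal_socle] by simp
      next
        case 2
        have "inj_on (\<lambda>x. a \<otimes> x) P"
        proof (rule inj_onI)
          fix x y assume xy: "x \<in> P" "y \<in> P" "a \<otimes> x = a \<otimes> y"
          have "a \<otimes> (x \<ominus> y) = a \<otimes> x \<ominus> a \<otimes> y" using a Pc[OF xy(1)] Pc[OF xy(2)] by algebra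
          then have "x \<ominus> y \<in> ?A"
            using xy a Pc right_ideal_diff[OF rP] by (simp add: right_annihilator_def)
          then show "x = y" using 2 Pc xy by auto
        qed
        then have "simple_submodule ((\<lambda>x. a \<otimes> x) ` P) R (right_regular R)"
          by (rule simple_submodule_image[OF right_module_right_regular right_module_right_regular
                left_multiplication_hom[OF a] _ P])
        then show ?thesis using RR.simple_subset_socle p by blast
      qed
    qed
    then show "P \<subseteq> {x \<in> carrier (right_regular R). a \<otimes> x \<in> Sr}" using Pc by auto
  qed
  then show ?thesis using s by blast
qed

text \<open>The inverse map from \<open>aB\<close> to \<open>B\<close> is a homomorphism on a right
  ideal inside the socle, hence a left multiplication.\<close>

lemma socle_left_cancel:
  assumes a: "a \<in> carrier R" and B: "right_ideal B R" "B \<subseteq> Sr"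
    and inj: "\<And>b. b \<in> B \<Longrightarrow> a \<otimes> b = \<zero> \<Longrightarrow> b = \<zero>"
  shows "\<exists>c\<in>carrier R. \<forall>b\<in>B. c \<otimes> (a \<otimes> b) = b"
proof -
  note Bc = subsetD[OF right_ideal_carrier[OF B(1)]]
  let ?G = "{(a \<otimes> b, b) | b. b \<in> B}"
  have G: "submodule ?G R (module_sum (right_regular R) (right_regular R))"
  proof (rule submodule_pairsI)
    show "(x \<oplus> x', y \<oplus> y') \<in> ?G" if "(x, y) \<in> ?G" "(x', y') \<in> ?G" for x y x' y'
      using that a Bc right_ideal_add[OF B(1)] by (auto simp: r_distr)
    show "(x \<otimes> r, y \<otimes> r) \<in> ?G" if "(x, y) \<in> ?G" "r \<in> carrier R" for x y r
      using that a Bc right_ideal_mult[OF B(1)] by (auto simp: m_assoc)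
  qed (use a Bc right_ideal_zero[OF B(1)] in auto)
  have fn: "y = \<zero>\<^bsub>right_regular R\<^esub>" if "(\<zero>\<^bsub>right_regular R\<^esub>, y) \<in> ?G" for y using that inj by auto
  note hg = hom_of_graph[OF right_module_right_regular right_module_right_regular G fn]
  obtain f where f: "f \<in> right_hom R ((right_regular R)\<lparr>carrier := fst ` ?G\<rparr>) (right_regular R)"
    "\<forall>x y. (x, y) \<in> ?G \<longrightarrow> f x = y" using hg(2) by blast
  have "fst ` ?G \<subseteq> Sr" using left_ideal_socle[OF a] B(2) by auto
  then obtain c where c: "c \<in> carrier R" "\<forall>k\<in>fst ` ?G. f k = c \<otimes> k"
    using socle_extension[OF hg(1) _ f(1)] by blast
  have "c \<otimes> (a \<otimes> b) = b" if b: "b \<in> B" for b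
  proof -
    have ab: "(a \<otimes> b, b) \<in> ?G" using b by blast
    then have "f (a \<otimes> b) = b" using f(2) by blast
    moreover have "f (a \<otimes> b) = c \<otimes> (a \<otimes> b)" using c(2) ab by force
    ultimately show ?thesis by simp
  qed
  then show ?thesis using c(1) by blast
qed

text \<open>If \<open>a\<close> were injective on a simple \<open>P\<close>, then \<open>c a\<close>
  would be the identity on \<open>P\<close> for some \<open>c\<close>, and the unit
  \<open>1 - c a\<close> would kill \<open>P\<close>.\<close>

lemma jacobson_mult_socle:
  assumes a: "a \<in> J" and s: "s \<in> Sr"
  shows "a \<otimes> s = \<zero>"
proof -
  have ac: "a \<in> carrier R" using a Jc by blast
  have "Sr \<subseteq> right_annihilator R {a}"
  proof (rule RR.socle_least)
    show "right_ideal (right_annihilator R {a}) R" using ac by (intro right_ideal_right_annihilator) simp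
    fix P assume P: "simple_submodule P R (right_regular R)"
    then have rP: "right_ideal P R" and Ps: "\<And>H. right_ideal H R \<Longrightarrow> H \<subseteq> P \<Longrightarrow> H = {\<zero>} \<or> H = P"
      by (auto simp: simple_submodule_def)
    note Pc = subsetD[OF right_ideal_carrier[OF rP]]
    let ?A = "P \<inter> right_annihilator R {a}"
    have "right_ideal ?A R" by (intro right_ideal_Int rP right_ideal_right_annihilator) (simp add: ac)
    then consider "?A = P" | "?A = {\<zero>}" using Ps by blast
    then show "P \<subseteq> right_annihilator R {a}"
    proof cases
      case 2
      have "b = \<zero>" if "b \<in> P" "a \<otimes> b = \<zero>" for b
        using that 2 Pc by (auto simp: right_annihilator_def)
      then obtain c where c: "c \<in> carrier R" "\<forall>b\<in>P. c \<otimes> (a \<otimes> b) = b"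
        using socle_left_cancel[OF ac rP RR.simple_subset_socle[OF P]] by blast
      have "c \<otimes> a \<in> J" using Jcl a c by simp
      then obtain u where u: "u \<in> carrier R" "u \<otimes> (\<one> \<ominus> c \<otimes> a) = \<one>" using jacobson_unit by blast
      have "b \<in> right_annihilator R {a}" if b: "b \<in> P" for b
      proof -
        have bc: "b \<in> carrier R" using Pc b by blast
        have "b = (u \<otimes> (\<one> \<ominus> c \<otimes> a)) \<otimes> b" using u bc by simp
        also have "\<dots> = u \<otimes> (b \<ominus> c \<otimes> (a \<otimes> b))" using u(1) c(1) ac bc by algebra
        also have "\<dots> = \<zero>" using c(2) b bc u(1) by (simp add: a_minus_def r_neg)
        finally show ?thesis using ac by (simp add: right_annihilator_def)
      qed
      then show ?thesis by blast
    qed blast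
  qed
  then show ?thesis using s by (auto simp: right_annihilator_def)
qed

lemma essential_socle_element:
  assumes b: "b \<in> carrier R" "b \<noteq> \<zero>"
  shows "\<exists>r\<in>carrier R. b \<otimes> r \<noteq> \<zero> \<and> b \<otimes> r \<in> Sr"
proof -
  let ?B = "{b \<otimes> r | r. r \<in> carrier R}"
  have B: "right_ideal ?B R" by (rule right_ideal_principal[OF b(1)])
  have "b \<in> ?B" using b by (intro CollectI exI[of _ \<one>]) simp
  then have "?B \<noteq> {\<zero>}" using b(2) by blast
  then have "Sr \<inter> ?B \<noteq> {\<zero>}" using essential_socle B unfolding essential_submodule_def by auto
  moreover have "\<zero> \<in> Sr \<inter> ?B" using right_ideal_zero[OF B] right_ideal_zero[OF right_ideal_socle] by blast
  ultimately show ?thesis by blast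
qed

text \<open>At a stable stage with product \<open>p\<close> nonzero, essentiality gives a nonzero
  \<open>p r\<close> in the socle. The next factor kills it, contrary to stability.\<close>

lemma T_nilpotent_annihilator_socle: "right_T_nilpotent R (left_annihilator R Sr)"
  unfolding right_T_nilpotent_def
proof (intro allI impI)
  fix x :: "nat \<Rightarrow> 'a" assume x: "\<forall>n. x n \<in> left_annihilator R Sr"
  then have xc: "x n \<in> carrier R" for n by (simp add: left_annihilator_def)
  obtain m where m: "\<forall>b\<in>carrier R. left_product R x (Suc m) \<otimes> b = \<zero> \<longrightarrow> left_product R x m \<otimes> b = \<zero>"
    using chain_Suc[of x] xc by blast
  let ?p = "left_product R x m"
  have pc: "?p \<in> carrier R" using left_product_closed[of x] xc by blast
  have "?p = \<zero>"
  proof (rule ccontr)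
    assume "?p \<noteq> \<zero>"
    then obtain r where r: "r \<in> carrier R" "?p \<otimes> r \<noteq> \<zero>" "?p \<otimes> r \<in> Sr"
      using essential_socle_element[OF pc] by blast
    have "left_product R x (Suc m) \<otimes> r = x (Suc m) \<otimes> (?p \<otimes> r)" using xc pc r by (simp add: m_assoc)
    also have "\<dots> = \<zero>" using x r(3) by (simp add: left_annihilator_def)
    finally show False using m r by blast
  qed
  then show "\<exists>n. left_product R x n = \<zero>" by blast
qed

text \<open>By T-nilpotence for constant sequences the elements \<open>x r\<close> with
  \<open>x\<close> in \<open>l(S\<^sub>r)\<close> are nilpotent, so geometric series give the right
  inverses asked for by \<open>jacobsonI\<close>.\<close>

lemma left_annihilator_socle: "left_annihilator R Sr = J"
proof
  show "J \<subseteq> left_annihilator R Sr" using jacobson_mult_socle Jc by (auto simp: left_annihilator_def)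
  show "left_annihilator R Sr \<subseteq> J"
  proof
    fix x assume x: "x \<in> left_annihilator R Sr"
    then have xc: "x \<in> carrier R" by (simp add: left_annihilator_def)
    show "x \<in> J"
    proof (rule jacobsonI[OF xc])
      fix r assume r: "r \<in> carrier R"
      define y where "y = x \<otimes> r"
      have yc: "y \<in> carrier R" using xc r by (simp add: y_def)
      have "y \<in> left_annihilator R Sr"
        using x xc r left_ideal_socle[OF r] Sr_carrier by (auto simp: y_def left_annihilator_def m_assoc)
      then obtain n where n: "left_product R (\<lambda>_. y) n = \<zero>"
        using T_nilpotent_annihilator_socle[unfolded right_T_nilpotent_def, rule_format, of "\<lambda>_. y"] by blast
      \<comment> \<open>The product of the constant sequence at index \<open>k\<close> is the power
        of \<open>y\<close> with exponent \<open>k + 1\<close>, and \<open>u\<close> is a partial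
        sum of the geometric series.\<close>
      have "\<exists>u\<in>carrier R. (\<one> \<ominus> y) \<otimes> u = \<one> \<ominus> left_product R (\<lambda>_. y) k" for k
      proof (induction k)
        case 0
        show ?case using yc by (intro bexI[of _ \<one>]) auto
      next
        case (Suc k)
        then obtain u where u: "u \<in> carrier R" "(\<one> \<ominus> y) \<otimes> u = \<one> \<ominus> left_product R (\<lambda>_. y) k" by blast
        define p where "p = left_product R (\<lambda>_. y) k"
        have pc: "p \<in> carrier R" using left_product_closed[of "\<lambda>_. y"] yc by (simp add: p_def)
        have "(\<one> \<ominus> y) \<otimes> (u \<oplus> p) = (\<one> \<ominus> y) \<otimes> u \<oplus> (p \<ominus> y \<otimes> p)" using yc u(1) pc by algebra
        also have "\<dots> = (\<one> \<ominus> p) \<oplus> (p \<ominus> y \<otimes> p)" using u(2) by (simp add: p_def)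
        also have "\<dots> = \<one> \<ominus> y \<otimes> p" using yc pc by algebra
        finally show ?case using u(1) pc by (intro bexI[of _ "u \<oplus> p"]) (auto simp: p_def)
      qed
      then show "\<exists>u\<in>carrier R. (\<one> \<ominus> x \<otimes> r) \<otimes> u = \<one>" using n by (metis y_def a_minus_def minus_zero one_closed r_zero)
    qed
  qed
qed

lemma T_nilpotent_jacobson: "right_T_nilpotent R J"
  using T_nilpotent_annihilator_socle left_annihilator_socle by simp

lemma mem_jacobsonI: "x \<in> carrier R \<Longrightarrow> (\<And>s. s \<in> Sr \<Longrightarrow> x \<otimes> s = \<zero>) \<Longrightarrow> x \<in> J"
  using left_annihilator_socle by (auto simp: left_annihilator_def)

text \<open>\<open>B\<close> is maximal with \<open>B \<inter> K = 0\<close>. A simple right ideal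
  meeting \<open>K + B\<close> trivially could be added to \<open>B\<close>, so every simple one
  lies in \<open>K + B\<close>.\<close>

lemma socle_complement:
  assumes K: "right_ideal K R"
  shows "\<exists>B. right_ideal B R \<and> B \<inter> K \<subseteq> {\<zero>} \<and> Sr \<subseteq> K <+> B"
proof -
  obtain B where B: "right_ideal B R" "B \<inter> K \<subseteq> {\<zero>}"
    and Bmax: "\<forall>C. right_ideal C R \<longrightarrow> B \<subseteq> C \<longrightarrow> C \<inter> K \<subseteq> {\<zero>} \<longrightarrow> C = B"
    using maximal_right_ideal_exists[OF right_ideal_of_zero Int_lower1[of _ K]] by blast
  note Bc = subsetD[OF right_ideal_carrier[OF B(1)]] and Kc = subsetD[OF right_ideal_carrier[OF K]]
  have KB: "right_ideal (K <+>\<^bsub>R\<^esub> B) R" by (rule right_ideal_sum[OF K B(1)])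
  note up = right_ideal_sum_upper[OF K B(1)]
  have "Sr \<subseteq> K <+>\<^bsub>R\<^esub> B"
  proof (rule RR.socle_least[OF KB])
    fix P assume P: "simple_submodule P R (right_regular R)"
    then have rP: "right_ideal P R" and Ps: "\<And>H. right_ideal H R \<Longrightarrow> H \<subseteq> P \<Longrightarrow> H = {\<zero>} \<or> H = P"
      by (auto simp: simple_submodule_def)
    note Pc = subsetD[OF right_ideal_carrier[OF rP]]
    consider "P \<inter> (K <+>\<^bsub>R\<^esub> B) = P" | "P \<inter> (K <+>\<^bsub>R\<^esub> B) = {\<zero>}"
      using Ps right_ideal_Int[OF rP KB] by blast
    then show "P \<subseteq> K <+>\<^bsub>R\<^esub> B"
    proof cases
      case 2
      have "(B <+>\<^bsub>R\<^esub> P) \<inter> K \<subseteq> {\<zero>}"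
      proof
        fix k assume k: "k \<in> (B <+>\<^bsub>R\<^esub> P) \<inter> K"
        then obtain b p where bp: "b \<in> B" "p \<in> P" "k = b \<oplus> p" by (auto simp: mem_sum_iff)
        have "k \<ominus> b \<in> K <+>\<^bsub>R\<^esub> B"
          using right_ideal_diff[OF KB, of k b] up k bp(1) by blast
        then have "p \<in> K <+>\<^bsub>R\<^esub> B" using bp Bc Pc by (simp add: add_minus_cancel_left)
        then have "p = \<zero>" using 2 bp by blast
        then show "k \<in> {\<zero>}" using k bp Bc B(2) by auto
      qed
      then have "B <+>\<^bsub>R\<^esub> P = B"
        using Bmax[rule_format, OF right_ideal_sum[OF B(1) rP] right_ideal_sum_upper(1)[OF B(1) rP]] by simp
      then show ?thesis using right_ideal_sum_upper(2)[OF B(1) rP] up(2) by simp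
    qed blast
  qed
  then show ?thesis using B by blast
qed

text \<open>On a complement of \<open>r(a)\<close> within the socle, \<open>a\<close> can be
  inverted by some \<open>c\<close>. Then \<open>a c a - a\<close> kills the socle, which by
  \<open>l(S\<^sub>r) = J\<close> is membership in \<open>J\<close>.\<close>

lemma regular_modulo_jacobson:
  assumes a: "a \<in> carrier R"
  shows "\<exists>c\<in>carrier R. ring_cong R J (a \<otimes> c \<otimes> a) a"
proof -
  let ?K = "right_annihilator R {a}"
  have K: "right_ideal ?K R" using a by (intro right_ideal_right_annihilator) simp
  let ?K' = "?K \<inter> Sr"
  obtain B' where B': "right_ideal B' R" "B' \<inter> ?K' \<subseteq> {\<zero>}" "Sr \<subseteq> ?K' <+> B'"
    using socle_complement[OF right_ideal_Int[OF K right_ideal_socle]] by blast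
  note B'c = subsetD[OF right_ideal_carrier[OF B'(1)]]
  have "b = \<zero>" if "b \<in> B' \<inter> Sr" "a \<otimes> b = \<zero>" for b
    using that B'(2) B'c by (auto simp: right_annihilator_def)
  then obtain c where c: "c \<in> carrier R" "\<forall>b\<in>B' \<inter> Sr. c \<otimes> (a \<otimes> b) = b"
    using socle_left_cancel[OF a right_ideal_Int[OF B'(1) right_ideal_socle]] by blast
  have "(a \<otimes> c \<otimes> a \<ominus> a) \<otimes> s = \<zero>" if s: "s \<in> Sr" for s
  proof -
    obtain k b where kb: "k \<in> ?K'" "b \<in> B'" "s = k \<oplus> b" using subsetD[OF B'(3) s] by (auto simp: mem_sum_iff)
    have kc: "k \<in> carrier R" and ak: "a \<otimes> k = \<zero>" using kb by (auto simp: right_annihilator_def)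
    have bc: "b \<in> carrier R" using kb B'c by blast
    have "s \<ominus> k \<in> Sr" using right_ideal_diff[OF right_ideal_socle s] kb by blast
    then have "b \<in> B' \<inter> Sr" using kb kc bc by (simp add: add_minus_cancel_left)
    then have cab: "c \<otimes> (a \<otimes> b) = b" using c by blast
    have "(a \<otimes> c \<otimes> a \<ominus> a) \<otimes> s = (a \<otimes> c \<otimes> (a \<otimes> k) \<ominus> a \<otimes> k) \<oplus> (a \<otimes> (c \<otimes> (a \<otimes> b)) \<ominus> a \<otimes> b)"
      unfolding kb(3) using a c(1) kc bc by algebra
    then show ?thesis unfolding ak cab using a c(1) bc by (simp add: a_minus_def r_neg)
  qed
  then have "a \<otimes> c \<otimes> a \<ominus> a \<in> J" using a c(1) by (intro mem_jacobsonI) auto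
  then show ?thesis using a c(1) by (intro bexI[of _ c]) (auto simp: ring_cong_def)
qed

text \<open>The argument with the sequence \<open>1 - g n\<close> again, now with elements that are
  idempotent and orthogonal only modulo \<open>J\<close>.\<close>

lemma semisimple_modulo_jacobson: "semisimple_modulo R J"
  unfolding semisimple_modulo_def
proof (intro allI impI, rule ccontr)
  note tJ = two_sided_jacobson
  fix C assume C': "right_ideal C R \<and> J \<subseteq> C"
  then have C: "right_ideal C R" "J \<subseteq> C" by auto
  note Cc = subsetD[OF right_ideal_carrier[OF C(1)]]
  assume "\<not> (\<exists>e\<in>C. \<forall>c\<in>C. c \<ominus> e \<otimes> c \<in> J)"
  then have no: "\<exists>c\<in>C. c \<ominus> e \<otimes> c \<notin> J" if "e \<in> C" for e using that by blast
  obtain f g where f0: "f 0 = \<zero>" and fC: "\<And>n. f n \<in> C" and g: "\<And>n. g n \<in> C" "\<And>n. g n \<notin> J"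
    "\<And>n. ring_cong R J (g n \<otimes> g n) (g n)" "\<And>n. ring_cong R J (f n \<otimes> g n) \<zero>"
    "\<And>n. ring_cong R J (g n \<otimes> f n) \<zero>" "\<And>n. f (Suc n) = f n \<oplus> g n"
    using orthogonal_idempotent_sequence[OF tJ regular_modulo_jacobson C(1) no] by blast
  have fc: "f n \<in> carrier R" for n using fC Cc by blast
  have gc: "g n \<in> carrier R" for n using g(1) Cc by blast
  define x where "x n = \<one> \<ominus> g n" for n
  have xc: "x n \<in> carrier R" for n using gc by (simp add: x_def)
  have pc: "left_product R x n \<in> carrier R" for n using left_product_closed[of x] xc by blast
  have p: "ring_cong R J (left_product R x n) (\<one> \<ominus> f (Suc n))" for n
  proof (induction n)
    case 0
    then show ?case using g(6)[of 0] f0 gc ring_cong_refl[OF tJ] by (simp add: x_def)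
  next
    case (Suc n)
    have "ring_cong R J (left_product R x (Suc n)) (x (Suc n) \<otimes> (\<one> \<ominus> f (Suc n)))"
      unfolding left_product.simps by (intro ring_cong_mult[OF tJ ring_cong_refl[OF tJ xc] Suc])
    also have "x (Suc n) \<otimes> (\<one> \<ominus> f (Suc n)) = (\<one> \<ominus> f (Suc n) \<ominus> g (Suc n)) \<oplus> g (Suc n) \<otimes> f (Suc n)"
      unfolding x_def using gc[of "Suc n"] fc[of "Suc n"] by algebra
    also have "ring_cong R J \<dots> ((\<one> \<ominus> f (Suc n) \<ominus> g (Suc n)) \<oplus> \<zero>)"
      using gc fc by (intro ring_cong_add[OF tJ ring_cong_refl[OF tJ] g(5)]) auto
    also (ring_cong_trans[OF tJ]) have "(\<one> \<ominus> f (Suc n) \<ominus> g (Suc n)) \<oplus> \<zero> = \<one> \<ominus> f (Suc (Suc n))"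
      unfolding g(6)[of "Suc n"] using gc[of "Suc n"] fc[of "Suc n"] by algebra
    finally show ?case .
  qed
  obtain m where m: "\<forall>b\<in>carrier R. left_product R x (Suc m) \<otimes> b = \<zero> \<longrightarrow> left_product R x m \<otimes> b = \<zero>"
    using chain_Suc[of x] xc by blast
  let ?g = "g (Suc m)" and ?f = "f (Suc m)" and ?p = "left_product R x m"
  have pg: "ring_cong R J (?p \<otimes> ?g) ?g"
  proof -
    have "ring_cong R J (?p \<otimes> ?g) ((\<one> \<ominus> ?f) \<otimes> ?g)" by (intro ring_cong_mult[OF tJ p ring_cong_refl[OF tJ gc]])
    also have "(\<one> \<ominus> ?f) \<otimes> ?g = ?g \<ominus> ?f \<otimes> ?g" using gc[of "Suc m"] fc[of "Suc m"] by algebra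
    also have "ring_cong R J \<dots> (?g \<ominus> \<zero>)" by (intro ring_cong_diff[OF tJ ring_cong_refl[OF tJ gc] g(4)])
    finally (ring_cong_trans[OF tJ]) show ?thesis using gc by (simp add: a_minus_def)
  qed
  have "ring_cong R J (left_product R x (Suc m) \<otimes> ?g) (x (Suc m) \<otimes> ?g)"
    using ring_cong_mult[OF tJ ring_cong_refl[OF tJ xc[of "Suc m"]] pg] xc pc gc by (simp add: m_assoc)
  also have "x (Suc m) \<otimes> ?g = ?g \<ominus> ?g \<otimes> ?g" unfolding x_def using gc[of "Suc m"] by algebra
  also have "ring_cong R J \<dots> (?g \<ominus> ?g)" by (intro ring_cong_diff[OF tJ ring_cong_refl[OF tJ gc] g(3)])
  also (ring_cong_trans[OF tJ]) have "?g \<ominus> ?g = \<zero>" using gc[of "Suc m"] by simp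
  finally have "left_product R x (Suc m) \<otimes> ?g \<in> J" by (simp add: ring_cong_zero_iff[OF tJ])
  \<comment> \<open>The chain condition concerns equations, not congruences. Multiplying by socle
    elements turns membership in \<open>J\<close> into equations and back.\<close>
  then have *: "left_product R x (Suc m) \<otimes> ?g \<otimes> s = \<zero>" if "s \<in> Sr" for s using jacobson_mult_socle that by blast
  have "?p \<otimes> ?g \<otimes> s = \<zero>" if s: "s \<in> Sr" for s
  proof -
    have sc: "s \<in> carrier R" using s Sr_carrier by blast
    have "left_product R x (Suc m) \<otimes> (?g \<otimes> s) = \<zero>" using *[OF s] pc[of "Suc m"] gc sc by (simp only: m_assoc m_closed)
    then have "?p \<otimes> (?g \<otimes> s) = \<zero>" using m gc sc by blast
    then show ?thesis using pc gc sc by (simp add: m_assoc)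
  qed
  then have "?p \<otimes> ?g \<in> J" using pc gc by (intro mem_jacobsonI) auto
  then have "?g \<in> J" using ring_cong_mem[OF tJ ring_cong_sym[OF tJ pg]] by blast
  then show False using g(2) by blast
qed

end

section \<open>Self-injectivity and right artinianity\<close>

context ss_injective_chain
begin

interpretation RR: right_module R "right_regular R" by (rule right_module_right_regular)

text \<open>\<open>K \<inter> NJ\<close> is semisimple, and it is small by T-nilpotence, so
  \<open>f\<close> restricted to it extends to some \<open>h\<close>. The complement
  \<open>B\<close> of \<open>K\<close> relative to \<open>NJ\<close> carries \<open>h\<close>, while
  \<open>K\<close> keeps \<open>f\<close>.\<close>

lemma socle_hom_extends:
  fixes N :: "('a, ('a, 'm) universe) module"
  assumes N: "right_module R N" and K: "submodule K R N" "K \<subseteq> socle R N"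
  shows "extends_to R K N (right_regular R)"
  unfolding extends_to_def
proof
  interpret N: right_module R N by fact
  note RR = right_module_right_regular
  fix f assume f: "f \<in> right_hom R (N\<lparr>carrier := K\<rparr>) (right_regular R)"
  define NJ where "NJ = submodule_span R N {a \<odot>\<^bsub>N\<^esub> y | a y. a \<in> J \<and> y \<in> carrier N}"
  have genc: "{a \<odot>\<^bsub>N\<^esub> y | a y. a \<in> J \<and> y \<in> carrier N} \<subseteq> carrier N" using Jc N.smult_closed by auto
  have NJ: "submodule NJ R N" unfolding NJ_def by (rule N.submodule_span_submodule[OF genc])
  obtain B where B: "submodule B R N" "NJ \<subseteq> B" "B \<inter> K \<subseteq> NJ" "K <+>\<^bsub>N\<^esub> B = carrier N"
    using N.semisimple_modulo_complement[OF two_sided_jacobson semisimple_modulo_jacobson K(1)]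
    unfolding NJ_def by blast
  note Kc = subsetD[OF N.submodule_carrier[OF K(1)]] and Bc = subsetD[OF N.submodule_carrier[OF B(1)]]
  let ?K = "K \<inter> NJ"
  have sK: "submodule ?K R N" by (rule N.submodule_Int[OF K(1) NJ])
  have "small_submodule ?K R N"
    unfolding small_submodule_def
  proof (intro conjI allI impI)
    fix L assume L: "submodule L R N \<and> L \<noteq> carrier N"
    show "?K <+>\<^bsub>N\<^esub> L \<noteq> carrier N"
    proof
      assume eq: "?K <+>\<^bsub>N\<^esub> L = carrier N"
      let ?Y = "L \<union> {a \<odot>\<^bsub>N\<^esub> y | a y. a \<in> J \<and> y \<in> carrier N}"
      have Lc: "L \<subseteq> carrier N" using L N.submodule_carrier by blast
      have Y: "submodule (submodule_span R N ?Y) R N"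
        using Lc genc by (intro N.submodule_span_submodule) blast
      have "?K <+>\<^bsub>N\<^esub> L \<subseteq> submodule_span R N ?Y"
      proof (rule N.sum_least[OF Y])
        show "?K \<subseteq> submodule_span R N ?Y"
          using N.span_mono[of "{a \<odot>\<^bsub>N\<^esub> y | a y. a \<in> J \<and> y \<in> carrier N}" ?Y] by (auto simp: NJ_def)
        show "L \<subseteq> submodule_span R N ?Y" using N.span_upper[of ?Y] by blast
      qed
      then have "carrier N \<subseteq> L"
        using N.T_nilpotent_small[OF right_ideal_jacobson T_nilpotent_jacobson N.submodule_of_carrier, of L] L eq
        by simp
      then show False using L Lc by blast
    qed
  qed (rule sK)
  moreover have "semisimple_module R (N\<lparr>carrier := ?K\<rparr>)"
    using K(2) by (intro N.semisimple_of_subset_socle[OF sK]) blast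
  ultimately have "extends_to R ?K N (right_regular R)"
    using ss_injective N unfolding strongly_right_ss_injective_def by blast
  moreover have "f \<in> right_hom R (N\<lparr>carrier := ?K\<rparr>) (right_regular R)"
    using right_hom_restrict[OF f, of ?K] by simp
  ultimately obtain h where h: "h \<in> right_hom R N (right_regular R)" "\<forall>x\<in>?K. h x = f x"
    unfolding extends_to_def by blast
  have hc: "h x \<in> carrier R" and hadd: "y \<in> carrier N \<Longrightarrow> h (x \<oplus>\<^bsub>N\<^esub> y) = h x \<oplus> h y"
    and hsm: "r \<in> carrier R \<Longrightarrow> h (r \<odot>\<^bsub>N\<^esub> x) = h x \<otimes> r" if "x \<in> carrier N" for x y r
    using right_hom_closed[OF h(1)] right_hom_add[OF h(1)] right_hom_smult[OF h(1)] that by auto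
  have fc: "f x \<in> carrier R" and fadd: "y \<in> K \<Longrightarrow> f (x \<oplus>\<^bsub>N\<^esub> y) = f x \<oplus> f y"
    and fsm: "r \<in> carrier R \<Longrightarrow> f (r \<odot>\<^bsub>N\<^esub> x) = f x \<otimes> r" if "x \<in> K" for x y r
    using right_hom_closed[OF f] right_hom_add[OF f] right_hom_smult[OF f] that by auto
  have f0: "f \<zero>\<^bsub>N\<^esub> = \<zero>" using right_hom_zero[OF N.right_module_restrict[OF K(1)] RR f] by simp
  have h0: "h \<zero>\<^bsub>N\<^esub> = \<zero>" using right_hom_zero[OF N RR h(1)] by simp
  \<comment> \<open>The relation \<open>k + b \<mapsto> f k + h b\<close> is single-valued because
    \<open>f\<close> and \<open>h\<close> agree on \<open>K \<inter> B\<close>, which lies in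
    \<open>NJ\<close>.\<close>
  let ?G = "{(k \<oplus>\<^bsub>N\<^esub> b, f k \<oplus> h b) | k b. k \<in> K \<and> b \<in> B}"
  interpret S: right_module R "module_sum N (right_regular R)" by (rule right_module_sum[OF N RR])
  have G: "submodule ?G R (module_sum N (right_regular R))"
  proof (rule S.submoduleI)
    show "?G \<subseteq> carrier (module_sum N (right_regular R))" using Kc Bc fc hc by auto
    show "\<zero>\<^bsub>module_sum N (right_regular R)\<^esub> \<in> ?G"
      using N.submodule_zero[OF K(1)] N.submodule_zero[OF B(1)] f0 h0
      by (intro CollectI exI[of _ "\<zero>\<^bsub>N\<^esub>"]) simp
    show "p \<oplus>\<^bsub>module_sum N (right_regular R)\<^esub> q \<in> ?G" if pq: "p \<in> ?G" "q \<in> ?G" for p q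
    proof -
      obtain k b k' b' where e: "k \<in> K" "b \<in> B" "k' \<in> K" "b' \<in> B"
        "p = (k \<oplus>\<^bsub>N\<^esub> b, f k \<oplus> h b)" "q = (k' \<oplus>\<^bsub>N\<^esub> b', f k' \<oplus> h b')"
        using pq by auto
      have "p \<oplus>\<^bsub>module_sum N (right_regular R)\<^esub> q =
          ((k \<oplus>\<^bsub>N\<^esub> k') \<oplus>\<^bsub>N\<^esub> (b \<oplus>\<^bsub>N\<^esub> b'), f (k \<oplus>\<^bsub>N\<^esub> k') \<oplus> h (b \<oplus>\<^bsub>N\<^esub> b'))"
        using e Kc Bc fc hc by (simp add: fadd hadd N.N.a_ac a_ac)
      then show ?thesis using e N.submodule_add[OF K(1)] N.submodule_add[OF B(1)] by blast
    qed
    show "r \<odot>\<^bsub>module_sum N (right_regular R)\<^esub> p \<in> ?G" if r: "r \<in> carrier R" and p: "p \<in> ?G" for r p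
    proof -
      obtain k b where e: "k \<in> K" "b \<in> B" "p = (k \<oplus>\<^bsub>N\<^esub> b, f k \<oplus> h b)" using p by auto
      have "r \<odot>\<^bsub>module_sum N (right_regular R)\<^esub> p =
          (r \<odot>\<^bsub>N\<^esub> k \<oplus>\<^bsub>N\<^esub> r \<odot>\<^bsub>N\<^esub> b, f (r \<odot>\<^bsub>N\<^esub> k) \<oplus> h (r \<odot>\<^bsub>N\<^esub> b))"
        using e Kc Bc fc hc r by (simp add: fsm hsm N.smult_module_add l_distr)
      then show ?thesis using e r N.submodule_smult[OF K(1)] N.submodule_smult[OF B(1)] by blast
    qed
  qed
  have fn: "y = \<zero>\<^bsub>right_regular R\<^esub>" if y: "(\<zero>\<^bsub>N\<^esub>, y) \<in> ?G" for y
  proof -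
    obtain k b where e: "k \<in> K" "b \<in> B" "k \<oplus>\<^bsub>N\<^esub> b = \<zero>\<^bsub>N\<^esub>" "y = f k \<oplus> h b" using y by auto
    have "\<ominus>\<^bsub>N\<^esub> b = k" using e Kc Bc by (intro N.N.minus_equality) auto
    then have "k \<in> B" using N.submodule_minus[OF B(1) e(2)] by simp
    then have "k \<in> ?K" using e(1) B(3) by blast
    then have "f k = h k" using h(2) by simp
    then have "y = h (k \<oplus>\<^bsub>N\<^esub> b)" using e(4) hadd[OF Kc[OF e(1)] Bc[OF e(2)]] by simp
    then show ?thesis using e(3) h0 by simp
  qed
  note hg = hom_of_graph[OF N RR G fn]
  have "fst ` ?G = carrier N"
  proof
    show "fst ` ?G \<subseteq> carrier N" using Kc Bc by auto
    show "carrier N \<subseteq> fst ` ?G"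
    proof
      fix n assume "n \<in> carrier N"
      then have "n \<in> K <+>\<^bsub>N\<^esub> B" using B(4) by simp
      then obtain k b where "k \<in> K" "b \<in> B" "n = k \<oplus>\<^bsub>N\<^esub> b" unfolding N.mem_sum_iff by blast
      then have "(n, f k \<oplus> h b) \<in> ?G" by blast
      then show "n \<in> fst ` ?G" by force
    qed
  qed
  then obtain g where g: "g \<in> right_hom R (N\<lparr>carrier := carrier N\<rparr>) (right_regular R)"
    "\<forall>x y. (x, y) \<in> ?G \<longrightarrow> g x = y" using hg(2) by auto
  have "g k = f k" if k: "k \<in> K" for k
  proof -
    have "(k, f k) \<in> ?G" using k N.submodule_zero[OF B(1)] h0 Kc fc
      by (intro CollectI exI[of _ k] exI[of _ "\<zero>\<^bsub>N\<^esub>"]) simp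
    then show ?thesis using g(2) by blast
  qed
  moreover have "g \<in> right_hom R N (right_regular R)" using g(1) by (simp add: right_hom_iff)
  ultimately show "\<exists>g\<in>right_hom R N (right_regular R). \<forall>x\<in>K. g x = f x" by blast
qed

text \<open>
  The inclusion of the socle extends to the pushout of \<open>R\<close> and \<open>R\<close> along \<open>T\<close>.
  The extension restricts to an automorphism of the first summand, because modulo \<open>J\<close> it is the identity there.
\<close>

lemma baer_injective: "baer_injective R"
  unfolding baer_injective_def
proof (intro allI impI, elim conjE)
  note RR = right_module_right_regular
  note SS = right_module_sum[OF RR RR]
  fix T f assume T: "right_ideal T R" and f: "f \<in> right_hom R ((right_regular R)\<lparr>carrier := T\<rparr>) (right_regular R)"
  note Tc = subsetD[OF right_ideal_carrier[OF T]]
  have fc: "f x \<in> carrier R" and fadd: "y \<in> T \<Longrightarrow> f (x \<oplus> y) = f x \<oplus> f y"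
    and fm: "r \<in> carrier R \<Longrightarrow> f (x \<otimes> r) = f x \<otimes> r" if "x \<in> T" for x y r
    using right_hom_closed[OF f] right_hom_add[OF f] right_hom_smult[OF f] that by auto
  let ?S = "module_sum (right_regular R) (right_regular R)"
  interpret S: right_module R ?S by (rule SS)
  \<comment> \<open>Dividing by \<open>H\<close> identifies \<open>(\<zero>, t)\<close> with
    \<open>(f t, \<zero>)\<close>.\<close>
  define H where "H = {(f t, \<ominus> t) | t. t \<in> T}"
  have H: "submodule H R ?S"
  proof (rule submodule_pairsI)
    show "H \<subseteq> carrier R \<times> carrier R" using fc Tc by (auto simp: H_def)
    have "f (\<zero> \<otimes> \<zero>) = f \<zero> \<otimes> \<zero>" using fm[OF right_ideal_zero[OF T], of \<zero>] by simp
    then have "f \<zero> = \<zero>" using fc[OF right_ideal_zero[OF T]] by simp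
    then show "(\<zero>, \<zero>) \<in> H" using right_ideal_zero[OF T] by (force simp: H_def)
    show "(x \<oplus> x', y \<oplus> y') \<in> H" if xy: "(x, y) \<in> H" "(x', y') \<in> H" for x y x' y'
    proof -
      obtain t t' where t: "t \<in> T" "t' \<in> T" "x = f t" "y = \<ominus> t" "x' = f t'" "y' = \<ominus> t'"
        using xy by (auto simp: H_def)
      then have "x \<oplus> x' = f (t \<oplus> t')" "y \<oplus> y' = \<ominus> (t \<oplus> t')" using Tc by (simp_all add: fadd minus_add)
      then show ?thesis using t right_ideal_add[OF T] by (auto simp: H_def)
    qed
    show "(x \<otimes> r, y \<otimes> r) \<in> H" if xy: "(x, y) \<in> H" and r: "r \<in> carrier R" for x y r
    proof -
      obtain t where t: "t \<in> T" "x = f t" "y = \<ominus> t" using xy by (auto simp: H_def)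
      then have "x \<otimes> r = f (t \<otimes> r)" "y \<otimes> r = \<ominus> (t \<otimes> r)" using Tc r by (simp_all add: fm l_minus)
      then show ?thesis using t right_ideal_mult[OF T r] by (auto simp: H_def)
    qed
  qed
  have minus: "p \<ominus>\<^bsub>?S\<^esub> q = (fst p \<ominus> fst q, snd p \<ominus> snd q)" if "p \<in> carrier ?S" "q \<in> carrier ?S" for p q
    using module_sum_minus[OF RR RR that] by simp
  \<comment> \<open>A pair becomes a subset of \<open>'a \<times> nat\<close> with its components
    tagged \<open>0\<close> and \<open>1\<close>, and a coset becomes a set of such subsets; this
    matches the two levels of \<open>set\<close> in \<open>universe\<close>.\<close>
  define enc where "enc = (\<lambda>(a :: 'a, b :: 'a). {(a, 0 :: nat), (b, 1)})"
  have enc: "inj enc"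
  proof (rule injI)
    fix p q :: "'a \<times> 'a" assume "enc p = enc q"
    moreover have "(fst p, 0) \<in> enc p" "(snd p, 1) \<in> enc p" by (auto simp: enc_def split_beta)
    ultimately have "(fst p, 0) \<in> enc q" "(snd p, 1) \<in> enc q" by simp_all
    then show "p = q" by (auto simp: enc_def split_beta prod_eq_iff)
  qed
  define q :: "'a \<times> 'a \<Rightarrow> ('a, 'm) universe"
    where "q p = Inr (enc ` {p' \<in> carrier ?S. p \<ominus>\<^bsub>?S\<^esub> p' \<in> H})" for p
  have q: "q p = q p' \<longleftrightarrow> p \<ominus>\<^bsub>?S\<^esub> p' \<in> H" if p: "p \<in> carrier ?S" and p': "p' \<in> carrier ?S" for p p'
  proof -
    have "q p = q p' \<longleftrightarrow> {s \<in> carrier ?S. p \<ominus>\<^bsub>?S\<^esub> s \<in> H} = {s \<in> carrier ?S. p' \<ominus>\<^bsub>?S\<^esub> s \<in> H}"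
      unfolding q_def using inj_image_eq_iff[OF enc] by simp
    also have "\<dots> \<longleftrightarrow> p \<ominus>\<^bsub>?S\<^esub> p' \<in> H"
    proof
      assume eq: "{s \<in> carrier ?S. p \<ominus>\<^bsub>?S\<^esub> s \<in> H} = {s \<in> carrier ?S. p' \<ominus>\<^bsub>?S\<^esub> s \<in> H}"
      have "p' \<ominus>\<^bsub>?S\<^esub> p' \<in> H" using p' S.submodule_zero[OF H] minus[OF p' p'] by (auto simp: a_minus_def r_neg)
      then have "p' \<in> {s \<in> carrier ?S. p' \<ominus>\<^bsub>?S\<^esub> s \<in> H}" using p' by blast
      then show "p \<ominus>\<^bsub>?S\<^esub> p' \<in> H" unfolding eq[symmetric] by blast
    next
      assume d: "p \<ominus>\<^bsub>?S\<^esub> p' \<in> H"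
      have "p \<ominus>\<^bsub>?S\<^esub> s \<in> H \<longleftrightarrow> p' \<ominus>\<^bsub>?S\<^esub> s \<in> H" if s: "s \<in> carrier ?S" for s
      proof
        assume "p \<ominus>\<^bsub>?S\<^esub> s \<in> H"
        then have "(p \<ominus>\<^bsub>?S\<^esub> s) \<ominus>\<^bsub>?S\<^esub> (p \<ominus>\<^bsub>?S\<^esub> p') \<in> H" using S.submodule_diff[OF H] d by blast
        moreover have "(p \<ominus>\<^bsub>?S\<^esub> s) \<ominus>\<^bsub>?S\<^esub> (p \<ominus>\<^bsub>?S\<^esub> p') = p' \<ominus>\<^bsub>?S\<^esub> s"
        proof -
          have e: "(a \<ominus> c) \<ominus> (a \<ominus> b) = b \<ominus> c" if "a \<in> carrier R" "b \<in> carrier R" "c \<in> carrier R" for a b c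
            using that by algebra
          show ?thesis using p p' s by (auto simp: minus e)
        qed
        ultimately show "p' \<ominus>\<^bsub>?S\<^esub> s \<in> H" by simp
      next
        assume "p' \<ominus>\<^bsub>?S\<^esub> s \<in> H"
        then have "(p \<ominus>\<^bsub>?S\<^esub> p') \<oplus>\<^bsub>?S\<^esub> (p' \<ominus>\<^bsub>?S\<^esub> s) \<in> H" using S.submodule_add[OF H] d by blast
        moreover have "(p \<ominus>\<^bsub>?S\<^esub> p') \<oplus>\<^bsub>?S\<^esub> (p' \<ominus>\<^bsub>?S\<^esub> s) = p \<ominus>\<^bsub>?S\<^esub> s"
        proof -
          have e: "(a \<ominus> b) \<oplus> (b \<ominus> c) = a \<ominus> c" if "a \<in> carrier R" "b \<in> carrier R" "c \<in> carrier R" for a b c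
            using that by algebra
          show ?thesis using p p' s by (auto simp: minus e)
        qed
        ultimately show "p \<ominus>\<^bsub>?S\<^esub> s \<in> H" by simp
      qed
      then show "{s \<in> carrier ?S. p \<ominus>\<^bsub>?S\<^esub> s \<in> H} = {s \<in> carrier ?S. p' \<ominus>\<^bsub>?S\<^esub> s \<in> H}" by blast
    qed
    finally show ?thesis .
  qed
  let ?M = "image_module q ?S"
  have M: "right_module R ?M" by (rule right_module_image[OF SS H q])
  have qh: "q \<in> right_hom R ?S ?M" by (rule right_hom_image[OF SS H q])
  interpret M: right_module R ?M by (rule M)
  define \<iota> \<kappa> where "\<iota> r = q (r, \<zero>)" and "\<kappa> r = q (\<zero>, r)" for r
  have \<iota>: "\<iota> \<in> right_hom R (right_regular R) ?M" and \<kappa>: "\<kappa> \<in> right_hom R (right_regular R) ?M"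
    using right_hom_closed[OF qh] right_hom_add[OF qh] right_hom_smult[OF qh]
    by (auto simp: right_hom_iff \<iota>_def \<kappa>_def simp flip: right_hom_add[OF qh] right_hom_smult[OF qh])
  have \<iota>inj: "inj_on \<iota> (carrier (right_regular R))"
  proof (rule inj_onI)
    fix r s assume rs: "r \<in> carrier (right_regular R)" "s \<in> carrier (right_regular R)" "\<iota> r = \<iota> s"
    then have "(r \<ominus> s, \<zero> \<ominus> \<zero>) \<in> H" using q[of "(r, \<zero>)" "(s, \<zero>)"] minus[of "(r, \<zero>)" "(s, \<zero>)"] by (simp add: \<iota>_def)
    then obtain t where t: "t \<in> T" "r \<ominus> s = f t" "\<zero> \<ominus> \<zero> = \<ominus> t" by (auto simp: H_def)
    have "\<zero> = \<ominus> t" using t(3) by (simp add: a_minus_def)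
    then have "t = \<zero>" using Tc[OF t(1)] by (metis minus_minus minus_zero)
    then have "r \<ominus> s = f (t \<otimes> \<zero>)" using t(2) by simp
    also have "\<dots> = \<zero>" using fm[OF t(1), of \<zero>] fc[OF t(1)] by simp
    finally show "r = s" using rs by simp
  qed
  have \<kappa>\<iota>: "\<kappa> t = \<iota> (f t)" if t: "t \<in> T" for t
  proof -
    have tc: "t \<in> carrier R" "f t \<in> carrier R" using t Tc fc by auto
    have mt: "\<ominus> t \<in> T" using right_ideal_minus[OF T t] .
    have "f (t \<otimes> (\<ominus> \<one>)) = f t \<otimes> (\<ominus> \<one>)" by (rule fm[OF t]) simp
    then have "f (\<ominus> t) = \<ominus> f t" using tc by (simp add: r_minus)
    then have "(\<zero> \<ominus> f t, t \<ominus> \<zero>) = (f (\<ominus> t), \<ominus> (\<ominus> t))" using tc by (simp add: a_minus_def)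
    then have "(\<zero> \<ominus> f t, t \<ominus> \<zero>) \<in> H" using mt unfolding H_def by blast
    then show ?thesis
      unfolding \<iota>_def \<kappa>_def using q[of "(\<zero>, t)" "(f t, \<zero>)"] minus[of "(\<zero>, t)" "(f t, \<zero>)"] tc by simp
  qed
  let ?K = "\<iota> ` Sr"
  have sK: "submodule ?K R ?M" by (rule submodule_hom_image[OF RR M \<iota> right_ideal_socle])
  have "?K \<subseteq> socle R ?M" by (rule socle_image[OF RR M \<iota> \<iota>inj])
  then have ext: "extends_to R ?K ?M (right_regular R)" by (rule socle_hom_extends[OF M sK])
  define \<psi> where "\<psi> = inv_into Sr \<iota>"
  have \<psi>: "\<psi> (\<iota> s) = s" if "s \<in> Sr" for s
    unfolding \<psi>_def using \<iota>inj inj_on_subset[of \<iota> _ Sr] Sr_carrier that by (intro inv_into_f_f) auto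
  have "\<psi> \<in> right_hom R (?M\<lparr>carrier := ?K\<rparr>) (right_regular R)"
    unfolding right_hom_iff
  proof (intro conjI ballI)
    fix x assume "x \<in> carrier (?M\<lparr>carrier := ?K\<rparr>)"
    then obtain s where s: "s \<in> Sr" "x = \<iota> s" by auto
    show "\<psi> x \<in> carrier (right_regular R)" using s \<psi> Sr_carrier by simp
    show "\<psi> (x \<oplus>\<^bsub>?M\<lparr>carrier := ?K\<rparr>\<^esub> y) = \<psi> x \<oplus>\<^bsub>right_regular R\<^esub> \<psi> y"
      if y: "y \<in> carrier (?M\<lparr>carrier := ?K\<rparr>)" for y
    proof -
      obtain s' where s': "s' \<in> Sr" "y = \<iota> s'" using y by auto
      have "x \<oplus>\<^bsub>?M\<^esub> y = \<iota> (s \<oplus> s')" using right_hom_add[OF \<iota>, of s s'] s s' Sr_carrier by simp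
      then show ?thesis using \<psi> s s' right_ideal_add[OF right_ideal_socle] by simp
    qed
  next
    fix r x assume r: "r \<in> carrier R" and "x \<in> carrier (?M\<lparr>carrier := ?K\<rparr>)"
    then obtain s where s: "s \<in> Sr" "x = \<iota> s" by auto
    have "r \<odot>\<^bsub>?M\<^esub> x = \<iota> (s \<otimes> r)" using right_hom_smult[OF \<iota> r, of s] s Sr_carrier by simp
    then show "\<psi> (r \<odot>\<^bsub>?M\<lparr>carrier := ?K\<rparr>\<^esub> x) = r \<odot>\<^bsub>right_regular R\<^esub> \<psi> x"
      using \<psi> s right_ideal_mult[OF right_ideal_socle r] by simp
  qed
  then obtain h where h: "h \<in> right_hom R ?M (right_regular R)" "\<forall>x\<in>?K. h x = \<psi> x"
    using ext unfolding extends_to_def by blast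
  have cM: "\<iota> r \<in> carrier ?M" "\<kappa> r \<in> carrier ?M" if "r \<in> carrier R" for r
    using right_hom_closed[OF \<iota>] right_hom_closed[OF \<kappa>] that by auto
  have h\<iota>: "h (\<iota> r) = h (\<iota> \<one>) \<otimes> r" and h\<kappa>: "h (\<kappa> r) = h (\<kappa> \<one>) \<otimes> r" if r: "r \<in> carrier R" for r
    using right_hom_of_ring[OF M \<iota> r] right_hom_of_ring[OF M \<kappa> r] right_hom_smult[OF h(1) r] cM by auto
  define u where "u = h (\<iota> \<one>)"
  have uc: "u \<in> carrier R" and kc: "h (\<kappa> \<one>) \<in> carrier R"
    using right_hom_closed[OF h(1)] cM by (auto simp: u_def)
  have "(\<one> \<ominus> u) \<otimes> s = \<zero>" if s: "s \<in> Sr" for s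
  proof -
    have sc: "s \<in> carrier R" using s Sr_carrier by blast
    have "u \<otimes> s = s" using h(2) \<psi>[OF s] s h\<iota>[OF sc] by (simp add: u_def)
    moreover have "(\<one> \<ominus> u) \<otimes> s = s \<ominus> u \<otimes> s" using uc sc by algebra
    ultimately show ?thesis using sc by simp
  qed
  then have "\<one> \<ominus> u \<in> J" using uc by (intro mem_jacobsonI) auto
  then obtain v where v: "v \<in> carrier R" "v \<otimes> (\<one> \<ominus> (\<one> \<ominus> u)) = \<one>" using jacobson_unit by blast
  have "\<one> \<ominus> (\<one> \<ominus> u) = u" using uc by algebra
  then have vu: "v \<otimes> u = \<one>" using v by simp
  \<comment> \<open>Applying \<open>h\<close> to \<open>\<kappa> t = \<iota> (f t)\<close> gives
    \<open>h (\<kappa> \<one>) t = u f(t)\<close>, from which the left inverse \<open>v\<close> of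
    \<open>u\<close> isolates \<open>f t\<close>.\<close>
  have "f t = (v \<otimes> h (\<kappa> \<one>)) \<otimes> t" if t: "t \<in> T" for t
  proof -
    have tc: "t \<in> carrier R" "f t \<in> carrier R" using t Tc fc by auto
    have "u \<otimes> f t = h (\<iota> (f t))" using h\<iota>[OF tc(2)] by (simp add: u_def)
    also have "\<dots> = h (\<kappa> \<one>) \<otimes> t" using \<kappa>\<iota>[OF t] h\<kappa>[OF tc(1)] by simp
    finally have "v \<otimes> (u \<otimes> f t) = v \<otimes> (h (\<kappa> \<one>) \<otimes> t)" by simp
    moreover have "v \<otimes> (u \<otimes> f t) = f t" using v(1) uc tc vu by (simp flip: m_assoc)
    ultimately show ?thesis using v(1) kc tc by (simp add: m_assoc)
  qed
  then show "\<exists>c\<in>carrier R. \<forall>t\<in>T. f t = c \<otimes> t" using v(1) kc by (intro bexI[of _ "v \<otimes> h (\<kappa> \<one>)"]) auto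
qed

text \<open>What remains is essentiality of \<open>l(J)\<close>, which contains the socle: for
  simple \<open>P\<close>, a nonzero \<open>p j\<close> would generate \<open>P\<close>, so
  \<open>p = p j r\<close>, and the unit \<open>1 - j r\<close> would annihilate
  \<open>p\<close>.\<close>

lemma self_injective_semilocal: "self_injective_semilocal R J"
proof
  show "two_sided_ideal J R" by (rule two_sided_jacobson)
  show "semisimple_modulo R J" by (rule semisimple_modulo_jacobson)
  show "baer_injective R" by (rule baer_injective)
  show "\<exists>u\<in>carrier R. (\<one> \<ominus> j) \<otimes> u = \<one> \<and> u \<otimes> (\<one> \<ominus> j) = \<one>" if "j \<in> J" for j
    by (rule jacobson_unit[OF that])
  show "\<exists>r\<in>carrier R. b \<otimes> r \<noteq> \<zero> \<and> b \<otimes> r \<in> left_annihilator R J" if b: "b \<in> carrier R" "b \<noteq> \<zero>" for b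
  proof -
    have "Sr \<subseteq> left_annihilator R J"
    proof (rule RR.socle_least)
      show "right_ideal (left_annihilator R J) R"
        by (rule right_ideal_left_annihilator[OF left_ideal_jacobson])
      fix P assume P: "simple_submodule P R (right_regular R)"
      then have rP: "right_ideal P R" and Ps: "\<And>H. right_ideal H R \<Longrightarrow> H \<subseteq> P \<Longrightarrow> H = {\<zero>} \<or> H = P"
        by (auto simp: simple_submodule_def)
      note Pc = subsetD[OF right_ideal_carrier[OF rP]]
      have "p \<otimes> j = \<zero>" if p: "p \<in> P" and j: "j \<in> J" for p j
      proof (rule ccontr)
        assume pj: "p \<otimes> j \<noteq> \<zero>"
        have jc: "j \<in> carrier R" and pc: "p \<in> carrier R" using Jc j Pc p by auto
        let ?A = "{p \<otimes> j \<otimes> r | r. r \<in> carrier R}"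
        have A: "right_ideal ?A R" using pc jc by (intro right_ideal_principal) simp
        have pjP: "p \<otimes> j \<in> P" by (rule right_ideal_mult[OF rP jc p])
        have "?A \<subseteq> P" using right_ideal_mult[OF rP _ pjP] by auto
        moreover have "p \<otimes> j \<in> ?A" using pc jc by (intro CollectI exI[of _ \<one>]) simp
        ultimately have "?A = P" using Ps[OF A] pj by blast
        then obtain r where r: "r \<in> carrier R" "p = p \<otimes> j \<otimes> r" using p by blast
        have "j \<otimes> r \<in> J" using j r Jcl by simp
        then obtain u where u: "u \<in> carrier R" "(\<one> \<ominus> j \<otimes> r) \<otimes> u = \<one>" using jacobson_unit by blast
        have "p = p \<otimes> ((\<one> \<ominus> j \<otimes> r) \<otimes> u)" using u pc by simp
        also have "\<dots> = (p \<ominus> p \<otimes> j \<otimes> r) \<otimes> u" using pc jc r(1) u(1) by algebra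
        also have "\<dots> = \<zero>" using r pc u(1) by (simp add: a_minus_def r_neg)
        finally show False using pj jc by simp
      qed
      then show "P \<subseteq> left_annihilator R J" using Pc by (auto simp: left_annihilator_def)
    qed
    then show ?thesis using essential_socle_element[OF b] by blast
  qed
qed

lemma right_artinian:
  assumes "countably_generated (left_annihilator R (J \<cdot> J)) (opposite_ring R) (left_regular R)"
  shows "right_artinian R"
proof -
  interpret self_injective_semilocal R J by (rule self_injective_semilocal)
  obtain F where "finite F" "F \<subseteq> J" "J \<subseteq> span R F"
    using radical_finitely_generated[OF T_nilpotent_jacobson assms] by blast
  then show ?thesis
    by (rule right_artinian_of_finitely_generated_radical[OF two_sided_jacobson semisimple_modulo_jacobson T_nilpotent_jacobson])
qed

end

subsection \<open>Artinian rings\<close>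

definition right_noetherian :: "('a, 'b) ring_scheme \<Rightarrow> bool"
  where "right_noetherian R \<longleftrightarrow> (\<forall>I. right_ideal I R \<longrightarrow> (\<exists>F. finite F \<and> F \<subseteq> I \<and> I = span R F))"

lemma right_artinianD:
  assumes "right_artinian R" "\<And>n. right_ideal (H n) R" "\<And>n. H (Suc n) \<subseteq> H n"
  shows "\<exists>m. \<forall>n\<ge>m. H n = H m"
  using assms unfolding right_artinian_def artinian_module_def by blast

lemma right_artinian_minimal:
  assumes "right_artinian R" "A \<in> F" "\<And>I. I \<in> F \<Longrightarrow> right_ideal I R"
  shows "\<exists>M\<in>F. \<forall>X\<in>F. X \<subseteq> M \<longrightarrow> X = M"
  by (rule dcc_imp_minimal[OF assms(2)]) (rule right_artinianD[OF assms(1)], auto intro: assms(3))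

context ring
begin

text \<open>For a right ideal \<open>D\<close> minimal with \<open>C + D = R\<close> the
  intersection \<open>C \<inter> D\<close> lies in \<open>J\<close>. Writing
  \<open>1 = e + d\<close> then gives \<open>c - e c = d c\<close> in
  \<open>C \<inter> D\<close>.\<close>

lemma right_artinian_semisimple_modulo_jacobson:
  assumes art: "right_artinian R"
  shows "semisimple_modulo R (jacobson_radical R)"
  unfolding semisimple_modulo_def
proof (intro allI impI)
  let ?J = "jacobson_radical R"
  fix C assume C': "right_ideal C R \<and> ?J \<subseteq> C"
  then have C: "right_ideal C R" by simp
  note Cc = subsetD[OF right_ideal_carrier[OF C]]
  let ?F = "{D. right_ideal D R \<and> \<one> \<in> C <+>\<^bsub>R\<^esub> D}"
  have "\<one> \<in> C <+>\<^bsub>R\<^esub> carrier R"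
    using subsetD[OF right_ideal_sum_upper(2)[OF C right_ideal_of_carrier] one_closed] .
  then have "carrier R \<in> ?F" using right_ideal_of_carrier by simp
  then have "\<exists>M\<in>?F. \<forall>X\<in>?F. X \<subseteq> M \<longrightarrow> X = M" by (rule right_artinian_minimal[OF art]) simp
  then obtain D where DF: "D \<in> ?F" and Dmin: "\<forall>X\<in>?F. X \<subseteq> D \<longrightarrow> X = D" by (rule bexE)
  from DF have D: "right_ideal D R" "\<one> \<in> C <+>\<^bsub>R\<^esub> D" by auto
  note Dc = subsetD[OF right_ideal_carrier[OF D(1)]]
  have CD: "C \<inter> D \<subseteq> ?J"
  proof
    fix x assume x: "x \<in> C \<inter> D"
    show "x \<in> ?J"
    proof (rule ccontr)
      assume "x \<notin> ?J"
      then obtain I where I: "maximal_right_ideal I R" "x \<notin> I" using x Cc by (auto simp: jacobson_radical_def)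
      have rI: "right_ideal I R" using I by (simp add: maximal_right_ideal_def)
      note Ic = subsetD[OF right_ideal_carrier[OF rI]]
      have xc: "x \<in> carrier R" using x Cc by blast
      let ?X = "{x \<otimes> r | r. r \<in> carrier R}"
      have X: "right_ideal ?X R" by (rule right_ideal_principal[OF xc])
      have xX: "x \<in> ?X" using xc by (intro CollectI exI[of _ \<one>]) simp
      have "?X <+>\<^bsub>R\<^esub> I = I \<or> ?X <+>\<^bsub>R\<^esub> I = carrier R"
        using I(1) right_ideal_sum[OF X rI] right_ideal_sum_upper(2)[OF X rI] by (simp add: maximal_right_ideal_def)
      then have XI: "?X <+>\<^bsub>R\<^esub> I = carrier R" using subsetD[OF right_ideal_sum_upper(1)[OF X rI] xX] I(2) by auto
      obtain c d where cd: "c \<in> C" "d \<in> D" "\<one> = c \<oplus> d" using D(2) by (auto simp: mem_sum_iff)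
      have "d \<in> ?X <+>\<^bsub>R\<^esub> I" using XI Dc cd by simp
      then obtain r t where rt: "r \<in> carrier R" "t \<in> I" "d = x \<otimes> r \<oplus> t" by (auto simp: mem_sum_iff)
      have xr: "x \<otimes> r \<in> C" "x \<otimes> r \<in> D" using x rt right_ideal_mult[OF C] right_ideal_mult[OF D(1)] by auto
      \<comment> \<open>The part \<open>x r\<close> of \<open>d\<close> moves over to
        \<open>C\<close>, which leaves \<open>t\<close> in \<open>D \<inter> I\<close>. Thus
        \<open>D \<inter> I\<close> would be a smaller supplement.\<close>
      have "d \<ominus> x \<otimes> r = t" using rt xc Ic by (simp add: add_minus_cancel_left)
      then have "t \<in> D" using right_ideal_diff[OF D(1) cd(2) xr(2)] by simp
      moreover have "\<one> = (c \<oplus> x \<otimes> r) \<oplus> t" using cd(3) rt xc Cc[OF cd(1)] Ic[OF rt(2)] by (simp add: a_assoc)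
      moreover have "c \<oplus> x \<otimes> r \<in> C" using right_ideal_add[OF C cd(1) xr(1)] .
      ultimately have "\<one> \<in> C <+>\<^bsub>R\<^esub> (D \<inter> I)" using rt(2) unfolding mem_sum_iff by blast
      then have "D \<inter> I = D" using Dmin right_ideal_Int[OF D(1) rI] by blast
      then show False using x I(2) by blast
    qed
  qed
  obtain e d where ed: "e \<in> C" "d \<in> D" "\<one> = e \<oplus> d" using D(2) by (auto simp: mem_sum_iff)
  have "c \<ominus> e \<otimes> c \<in> ?J" if c: "c \<in> C" for c
  proof -
    have cc: "c \<in> carrier R" and ec: "e \<in> carrier R" and dc: "d \<in> carrier R" using c ed Cc Dc by auto
    have "c = (e \<oplus> d) \<otimes> c" using ed(3)[symmetric] cc by simp
    also have "\<dots> = e \<otimes> c \<oplus> d \<otimes> c" using cc ec dc by (simp add: l_distr)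
    finally have "c = e \<otimes> c \<oplus> d \<otimes> c" .
    then have "c \<ominus> e \<otimes> c = d \<otimes> c" using cc ec dc add_minus_cancel_left[of "d \<otimes> c" "e \<otimes> c"] by simp
    moreover have "d \<otimes> c \<in> D" by (rule right_ideal_mult[OF D(1) cc ed(2)])
    moreover have "c \<ominus> e \<otimes> c \<in> C" by (rule right_ideal_diff[OF C c right_ideal_mult[OF C cc ed(1)]])
    ultimately show ?thesis using CD by auto
  qed
  then show "\<exists>e\<in>C. \<forall>c\<in>C. c \<ominus> e \<otimes> c \<in> ?J" using ed(1) by blast
qed

section \<open>Nilpotence of the radical and the Hopkins--Levitzki theorem\<close>

lemma word_products_left:
  assumes J: "J \<subseteq> carrier R"
  shows "a \<in> J \<Longrightarrow> w \<in> word_products R J n \<Longrightarrow> a \<otimes> w \<in> word_products R J (Suc n)"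
proof (induction n arbitrary: w)
  case 0
  then have "a \<otimes> w = \<one> \<otimes> a" using J by auto
  then show ?case using 0 by auto
next
  case (Suc n)
  then obtain x b where xb: "x \<in> word_products R J n" "b \<in> J" "w = x \<otimes> b" by auto
  have "a \<in> carrier R" "b \<in> carrier R" using Suc.prems(1) xb(2) J by auto
  then have "a \<otimes> w = (a \<otimes> x) \<otimes> b" using word_products_closed[OF J xb(1)] by (simp add: xb(3) m_assoc)
  moreover have "a \<otimes> x \<in> word_products R J (Suc n)" using Suc xb by blast
  ultimately show ?case using xb(2) by (subst word_products.simps(2)) blast
qed

text \<open>Words of the opposite ring are words read backwards, so nilpotence of an ideal passes
  between both sides.\<close>

lemma word_products_opposite:
  assumes J: "J \<subseteq> carrier R"
  shows "word_products (opposite_ring R) J n \<subseteq> word_products R J n"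
proof (induction n)
  case (Suc n)
  show ?case
  proof
    fix w assume "w \<in> word_products (opposite_ring R) J (Suc n)"
    then obtain x a where "x \<in> word_products (opposite_ring R) J n" "a \<in> J" "w = a \<otimes> x" by auto
    then show "w \<in> word_products R J (Suc n)" using Suc word_products_left[OF J] by blast
  qed
qed simp

lemma right_T_nilpotent_of_word_products:
  assumes J: "J \<subseteq> carrier R" and m: "word_products R J m \<subseteq> {\<zero>}"
  shows "right_T_nilpotent R J"
  unfolding right_T_nilpotent_def
proof (intro allI impI)
  fix x :: "nat \<Rightarrow> 'a" assume x: "\<forall>n. x n \<in> J"
  have *: "left_product R x n \<in> word_products R J (Suc n)" for n
  proof (induction n)
    case 0
    have "x 0 \<in> carrier R" using x J by blast
    then show ?case using x by (auto intro!: exI[of _ "x 0"])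
  next
    case (Suc n)
    then show ?case
      using word_products_left[OF J, of "x (Suc n)" "left_product R x n" "Suc n"] x
      by (simp del: word_products.simps)
  qed
  obtain y a where y: "y \<in> word_products R J m" "a \<in> J" "left_product R x m = y \<otimes> a" using *[of m] by auto
  then have "y = \<zero>" "a \<in> carrier R" using m J by blast+
  then have "left_product R x m = \<zero>" using y(3) by simp
  then show "\<exists>n. left_product R x n = \<zero>" by blast
qed

lemma right_artinian_nilpotent:
  assumes art: "right_artinian R"
  shows "\<exists>m. word_products R (jacobson_radical R) m \<subseteq> {\<zero>}"
proof (rule ccontr)
  let ?J = "jacobson_radical R"
  let ?W = "word_products R ?J"
  assume no: "\<not> ?thesis"
  note tJ = two_sided_jacobson
  note Jc = two_sided_ideal_carrier[OF tJ]
  note Wc = word_products_closed[OF Jc]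
  have I: "right_ideal (span R (?W n)) R" for n using Wc by (intro right_ideal_span) auto
  have "span R (?W (Suc n)) \<subseteq> span R (?W n)" for n
  proof (rule right_span_least[OF I])
    show "?W (Suc n) \<subseteq> span R (?W n)"
    proof
      fix w assume "w \<in> ?W (Suc n)"
      then obtain x a where "x \<in> ?W n" "a \<in> ?J" "w = x \<otimes> a" by auto
      then show "w \<in> span R (?W n)"
        using right_ideal_mult[OF I, of a x n] right_span_upper[of "?W n"] Jc by auto
    qed
  qed
  then obtain m where m: "\<forall>n\<ge>m. span R (?W n) = span R (?W m)"
    using right_artinianD[OF art, of "\<lambda>n. span R (?W n)"] I by blast
  \<comment> \<open>One step beyond the stable index, so that words of length \<open>M\<close> are
    nonempty and their span \<open>B\<close> lies in \<open>J\<close>.\<close>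
  define M where "M = Suc m"
  define B where "B = span R (?W M)"
  have B: "right_ideal B R" unfolding B_def by (rule I)
  note Bc = subsetD[OF right_ideal_carrier[OF B]]
  have MM: "span R (?W (M + M)) = B" using m[rule_format, of M] m[rule_format, of "M + M"] by (simp add: M_def B_def)
  have WB: "?W M \<subseteq> B" unfolding B_def by (rule right_span_upper)
  have BJ: "B \<subseteq> ?J"
    unfolding B_def
  proof (rule right_span_least[OF right_ideal_jacobson])
    show "?W M \<subseteq> ?J" unfolding M_def using J_closed[OF tJ] Wc by auto
  qed
  \<comment> \<open>A minimal right ideal \<open>K\<close> not killed by \<open>B\<close> would
    equal \<open>kB\<close> for any \<open>k\<close> in it with \<open>kB\<close> nonzero: stability
    of the span under doubling the word length keeps \<open>kB\<close> in the family.\<close>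
  let ?F = "{K. right_ideal K R \<and> (\<exists>k\<in>K. \<exists>w\<in>?W M. k \<otimes> w \<noteq> \<zero>)}"
  obtain w0 where w0: "w0 \<in> ?W M" "w0 \<noteq> \<zero>" using no by blast
  have "\<one> \<otimes> w0 \<noteq> \<zero>" using w0 Wc by simp
  then have "carrier R \<in> ?F" using w0(1) right_ideal_of_carrier one_closed by blast
  then have "\<exists>M\<in>?F. \<forall>X\<in>?F. X \<subseteq> M \<longrightarrow> X = M" by (rule right_artinian_minimal[OF art]) simp
  then obtain K where K: "K \<in> ?F" and Kmin: "\<forall>X\<in>?F. X \<subseteq> K \<longrightarrow> X = K" by (rule bexE)
  have rK: "right_ideal K R" using K by simp
  obtain k w where kw: "k \<in> K" "w \<in> ?W M" "k \<otimes> w \<noteq> \<zero>" using K by blast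
  have kc: "k \<in> carrier R" using kw right_ideal_carrier[OF rK] by blast
  let ?kB = "{k \<otimes> b | b. b \<in> B}"
  have kB: "right_ideal ?kB R"
  proof (rule right_idealI)
    show "?kB \<subseteq> carrier R" using kc Bc by auto
    show "\<zero> \<in> ?kB" using kc right_ideal_zero[OF B] by (intro CollectI exI[of _ \<zero>]) simp
    show "x \<oplus> y \<in> ?kB" if xy: "x \<in> ?kB" "y \<in> ?kB" for x y
    proof -
      obtain a b where "a \<in> B" "b \<in> B" "x = k \<otimes> a" "y = k \<otimes> b" using xy by auto
      then show ?thesis using kc Bc right_ideal_add[OF B] by (intro CollectI exI[of _ "a \<oplus> b"]) (simp add: r_distr)
    qed
    show "x \<otimes> r \<in> ?kB" if r: "r \<in> carrier R" and x: "x \<in> ?kB" for r x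
    proof -
      obtain a where "a \<in> B" "x = k \<otimes> a" using x by auto
      then show ?thesis using kc Bc r right_ideal_mult[OF B r] by (intro CollectI exI[of _ "a \<otimes> r"]) (simp add: m_assoc)
    qed
  qed
  have kBK: "?kB \<subseteq> K" using right_ideal_mult[OF rK _ kw(1)] Bc by blast
  have "\<exists>x\<in>?kB. \<exists>v\<in>?W M. x \<otimes> v \<noteq> \<zero>"
  proof (rule ccontr)
    assume none: "\<not> ?thesis"
    have "?W (M + M) \<subseteq> right_annihilator R {k}"
    proof
      fix z assume z: "z \<in> ?W (M + M)"
      then obtain u v where uv: "u \<in> ?W M" "v \<in> ?W M" "z = u \<otimes> v" using word_products_split[OF Jc] by blast
      have "k \<otimes> u \<in> ?kB" using uv WB by blast
      then have "(k \<otimes> u) \<otimes> v = \<zero>" using none uv by blast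
      then show "z \<in> right_annihilator R {k}" using uv kc Wc by (simp add: right_annihilator_def m_assoc)
    qed
    moreover have "right_ideal (right_annihilator R {k}) R" using kc by (intro right_ideal_right_annihilator) simp
    ultimately have "B \<subseteq> right_annihilator R {k}" using MM right_span_least by blast
    then show False using kw WB by (auto simp: right_annihilator_def)
  qed
  then have "?kB = K" using Kmin kB kBK by blast
  \<comment> \<open>Now \<open>k = k b\<close> with \<open>b\<close> in \<open>J\<close>, so the
    unit \<open>1 - b\<close> kills \<open>k\<close>.\<close>
  then obtain b where b: "b \<in> B" "k = k \<otimes> b" using kw(1) by blast
  obtain u where u: "u \<in> carrier R" "(\<one> \<ominus> b) \<otimes> u = \<one>" using jacobson_unit BJ b(1) by blast
  have bc: "b \<in> carrier R" using b Bc by blast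
  have "k = k \<otimes> ((\<one> \<ominus> b) \<otimes> u)" using u kc by simp
  also have "\<dots> = (k \<ominus> k \<otimes> b) \<otimes> u" using kc bc u(1) by algebra
  also have "\<dots> = \<zero>" using b(2)[symmetric] kc u(1) by (simp add: a_minus_def r_neg)
  finally show False using kw Wc by simp
qed

text \<open>Take \<open>H\<close> minimal without finite generation and \<open>h\<close> in
  \<open>H\<close> outside \<open>HJ\<close>, which exists by the Nakayama argument. A complement
  \<open>B\<close> of \<open>hR\<close> over \<open>HJ\<close> is smaller, hence finitely generated,
  and so is \<open>H = hR + B\<close>. No composition series is involved.\<close>

lemma right_artinian_imp_noetherian:
  assumes art: "right_artinian R"
  shows "right_noetherian R"
  unfolding right_noetherian_def
proof (rule ccontr)
  let ?J = "jacobson_radical R"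
  note tJ = two_sided_jacobson
  let ?fg = "\<lambda>I. \<exists>F. finite F \<and> F \<subseteq> I \<and> I = span R F"
  let ?F = "{I. right_ideal I R \<and> \<not> ?fg I}"
  assume "\<not> (\<forall>I. right_ideal I R \<longrightarrow> ?fg I)"
  then obtain I where "I \<in> ?F" by blast
  then have "\<exists>M\<in>?F. \<forall>X\<in>?F. X \<subseteq> M \<longrightarrow> X = M" by (rule right_artinian_minimal[OF art]) simp
  then obtain H where HF: "H \<in> ?F" and Hmin: "\<forall>X\<in>?F. X \<subseteq> H \<longrightarrow> X = H" by (rule bexE)
  from HF have H: "right_ideal H R" "\<not> ?fg H" by auto
  note Hc = subsetD[OF right_ideal_carrier[OF H(1)]]
  interpret RR: right_module R "right_regular R" by (rule right_module_right_regular)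
  let ?N = "(right_regular R)\<lparr>carrier := H\<rparr>"
  interpret N: right_module R ?N by (rule RR.right_module_restrict[OF H(1)])
  note Niff = RR.submodule_restrict_iff[OF H(1)]
  obtain m where m: "word_products R ?J m \<subseteq> {\<zero>}" using right_artinian_nilpotent[OF art] by blast
  have nil: "right_T_nilpotent R ?J"
    by (rule right_T_nilpotent_of_word_products[OF two_sided_ideal_carrier[OF tJ] m])
  define X where "X = {a \<odot>\<^bsub>?N\<^esub> y | a y. a \<in> ?J \<and> y \<in> carrier ?N}"
  have "\<not> H \<subseteq> submodule_span R ?N X"
  proof
    assume sub: "H \<subseteq> submodule_span R ?N X"
    have "carrier ?N \<subseteq> {\<zero>\<^bsub>?N\<^esub>}"
    proof (rule N.T_nilpotent_small[OF right_ideal_jacobson nil N.submodule_of_carrier N.submodule_of_zero])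
      show "carrier ?N \<subseteq> submodule_span R ?N ({\<zero>\<^bsub>?N\<^esub>} \<union> {a \<odot>\<^bsub>?N\<^esub> y | a y. a \<in> ?J \<and> y \<in> carrier ?N})"
        using sub N.span_mono[of X "{\<zero>\<^bsub>?N\<^esub>} \<union> X"] unfolding X_def by auto
    qed
    then have "H = {\<zero>}" using right_ideal_zero[OF H(1)] by auto
    moreover have "span R {} = {\<zero>}"
      using right_span_least[OF right_ideal_of_zero, of "{}"] right_ideal_zero[OF right_ideal_span, of "{}"] by auto
    ultimately show False using H(2) by blast
  qed
  then obtain h where h: "h \<in> H" "h \<notin> submodule_span R ?N X" by blast
  have hN: "h \<in> carrier ?N" using h by simp
  obtain B where B: "submodule B R ?N" "B \<inter> N.cyclic h \<subseteq> submodule_span R ?N X" "N.cyclic h <+>\<^bsub>?N\<^esub> B = carrier ?N"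
    using N.semisimple_modulo_complement[OF tJ right_artinian_semisimple_modulo_jacobson[OF art] N.submodule_cyclic[OF hN]]
    unfolding X_def by blast
  have rB: "right_ideal B R" "B \<subseteq> H" using B(1) by (auto simp: Niff)
  have "h \<notin> B" using B(2) N.cyclic_self[OF hN] h(2) by blast
  then have "B \<noteq> H" using h by blast
  then have "?fg B" using Hmin rB by blast
  then obtain F where F: "finite F" "F \<subseteq> B" "B = span R F" by blast
  have hF: "insert h F \<subseteq> H" using h F rB by blast
  have s: "right_ideal (span R (insert h F)) R" using hF Hc by (intro right_ideal_span) auto
  have "H \<subseteq> span R (insert h F)"
  proof
    fix x assume "x \<in> H"
    then have "x \<in> N.cyclic h <+>\<^bsub>?N\<^esub> B" using B(3) by simp
    then obtain r b where rb: "r \<in> carrier R" "b \<in> B" "x = h \<otimes> r \<oplus> b" by (auto simp: N.mem_sum_iff N.cyclic_def)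
    have "h \<in> span R (insert h F)" using right_span_upper[of "insert h F"] by blast
    then have "h \<otimes> r \<in> span R (insert h F)" by (rule right_ideal_mult[OF s rb(1)])
    moreover have "b \<in> span R (insert h F)" using right_span_mono[of F "insert h F"] F(3) rb(2) by blast
    ultimately show "x \<in> span R (insert h F)" using rb(3) right_ideal_add[OF s] by simp
  qed
  then have "H = span R (insert h F)" using right_span_least[OF H(1) hF] by blast
  then show False using H(2) F(1) hF by blast
qed

lemma right_noetherian_acc:
  assumes "right_noetherian R" "\<And>n. right_ideal (H n) R" "\<And>n. H n \<subseteq> H (Suc n)"
  shows "\<exists>m::nat. \<forall>n\<ge>m. H n = H m"
proof -
  have mono: "mono H" using assms(3) by (simp add: mono_iff_le_Suc)
  have "right_ideal (\<Union>n. H n) R" by (rule right_ideal_UN_mono[OF assms(2) mono])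
  then have "\<exists>F. finite F \<and> F \<subseteq> (\<Union>n. H n) \<and> (\<Union>n. H n) = span R F"
    using assms(1)[unfolded right_noetherian_def] by simp
  then obtain F where F: "finite F" "F \<subseteq> (\<Union>n. H n)" "(\<Union>n. H n) = span R F" by (elim exE conjE)
  have "\<exists>m. F \<subseteq> H m" using F(1,2)
  proof (induction F rule: finite_induct)
    case (insert x F)
    then obtain m k where "F \<subseteq> H m" "x \<in> H k" by auto
    then have "insert x F \<subseteq> H (max m k)" using monoD[OF mono, of m "max m k"] monoD[OF mono, of k "max m k"] by auto
    then show ?case by blast
  qed simp
  then obtain m where "F \<subseteq> H m" by blast
  then have "(\<Union>n. H n) \<subseteq> H m" unfolding F(3) by (rule right_span_least[OF assms(2)])
  then have "\<forall>n\<ge>m. H n = H m" using monoD[OF mono, of m] by (auto intro!: subset_antisym)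
  then show ?thesis by blast
qed

text \<open>A right ideal without finite generation yields an increasing sequence of finite sets
  whose spans grow strictly, so testing finite generating sets suffices.\<close>

lemma right_noetherianI:
  assumes "\<And>F. (\<And>n::nat. finite (F n)) \<Longrightarrow> (\<And>n. F n \<subseteq> carrier R) \<Longrightarrow> (\<And>n. F n \<subseteq> F (Suc n)) \<Longrightarrow>
    \<exists>n. F (Suc n) \<subseteq> span R (F n)"
  shows "right_noetherian R"
  unfolding right_noetherian_def
proof (intro allI impI, rule ccontr)
  fix I assume I: "right_ideal I R" and no: "\<not> (\<exists>F. finite F \<and> F \<subseteq> I \<and> I = span R F)"
  have "\<exists>F. \<forall>n::nat. (finite (F n) \<and> F n \<subseteq> I) \<and> (F n \<subseteq> F (Suc n) \<and> \<not> F (Suc n) \<subseteq> span R (F n))"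
  proof (rule dependent_nat_choice)
    show "\<exists>F. finite F \<and> F \<subseteq> I" by (intro exI[of _ "{}"]) simp
    fix F and n :: nat assume F: "finite F \<and> F \<subseteq> I"
    then have "span R F \<subseteq> I" using right_span_least[OF I] by blast
    then obtain x where "x \<in> I" "x \<notin> span R F" using no F by blast
    then show "\<exists>F'. (finite F' \<and> F' \<subseteq> I) \<and> (F \<subseteq> F' \<and> \<not> F' \<subseteq> span R F)"
      using F by (intro exI[of _ "insert x F"]) auto
  qed
  then obtain F where F: "\<And>n::nat. finite (F n)" "\<And>n. F n \<subseteq> I" "\<And>n. F n \<subseteq> F (Suc n)"
    "\<And>n. \<not> F (Suc n) \<subseteq> span R (F n)" by blast
  have "F n \<subseteq> carrier R" for n using F(2) right_ideal_carrier[OF I] by blast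
  then show False using assms[of F] F by blast
qed

text \<open>By \<open>rl\<close> the map \<open>T \<mapsto> l(T)\<close> is injective; it reverses
  inclusions and exchanges the two chain conditions.\<close>

lemma right_artinianI_annihilators:
  assumes noeth: "right_noetherian (opposite_ring R)"
    and rl: "\<And>T. right_ideal T R \<Longrightarrow> right_annihilator R (left_annihilator R T) = T"
  shows "right_artinian R"
  unfolding right_artinian_def artinian_module_def
proof (intro allI impI, elim conjE)
  interpret O: ring "opposite_ring R" by (rule ring_opposite)
  fix H assume H: "\<forall>n. right_ideal (H n) R" "\<forall>n::nat. H (Suc n) \<subseteq> H n"
  have "\<exists>m. \<forall>n\<ge>m. left_annihilator R (H n) = left_annihilator R (H m)"
  proof (rule O.right_noetherian_acc[OF noeth])
    show "left_ideal (left_annihilator R (H n)) R" for n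
      using H(1) right_ideal_carrier by (intro left_ideal_left_annihilator) blast
    show "left_annihilator R (H n) \<subseteq> left_annihilator R (H (Suc n))" for n
      using H(2) by (auto simp: left_annihilator_def)
  qed
  then show "\<exists>m. \<forall>n\<ge>m. H n = H m" using rl H(1) by metis
qed

lemma right_noetherianI_annihilators:
  assumes art: "right_artinian (opposite_ring R)"
    and rl: "\<And>T. right_ideal T R \<Longrightarrow> right_annihilator R (left_annihilator R T) = T"
  shows "right_noetherian R"
proof (rule right_noetherianI)
  fix F :: "nat \<Rightarrow> 'a set" assume F: "\<And>n. finite (F n)" "\<And>n. F n \<subseteq> carrier R" "\<And>n. F n \<subseteq> F (Suc n)"
  have s: "right_ideal (span R (F n)) R" for n by (rule right_ideal_span[OF F(2)])
  have "\<exists>m. \<forall>n\<ge>m. left_annihilator R (span R (F n)) = left_annihilator R (span R (F m))"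
  proof (rule right_artinianD[OF art])
    show "left_ideal (left_annihilator R (span R (F n))) R" for n
      by (rule left_ideal_left_annihilator[OF right_ideal_carrier[OF s]])
    show "left_annihilator R (span R (F (Suc n))) \<subseteq> left_annihilator R (span R (F n))" for n
      using right_span_mono[OF F(3)[of n]] unfolding left_annihilator_def by blast
  qed
  then obtain m where "left_annihilator R (span R (F (Suc m))) = left_annihilator R (span R (F m))"
    using le_SucI[OF order_refl] by blast
  then have "span R (F (Suc m)) = span R (F m)" using rl[OF s] by metis
  then show "\<exists>n. F (Suc n) \<subseteq> span R (F n)" using right_span_upper by blast
qed

subsection \<open>The theorem of Ikeda and Nakayama\<close>

text \<open>Induction on the number of generators of \<open>T\<close>: multipliers \<open>c\<close>
  on \<open>A\<close> and \<open>d\<close> on \<open>aR\<close> are corrected by annihilators until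
  they coincide.\<close>

lemma baer_injectiveI_annihilators:
  assumes noeth: "right_noetherian R"
    and rl: "\<And>T. right_ideal T R \<Longrightarrow> right_annihilator R (left_annihilator R T) = T"
    and lr: "\<And>L. left_ideal L R \<Longrightarrow> left_annihilator R (right_annihilator R L) = L"
  shows "baer_injective R"
  unfolding baer_injective_def
proof (intro allI impI, elim conjE)
  interpret O: ring "opposite_ring R" by (rule ring_opposite)
  fix T f assume T: "right_ideal T R" and f: "f \<in> right_hom R ((right_regular R)\<lparr>carrier := T\<rparr>) (right_regular R)"
  note Tc = subsetD[OF right_ideal_carrier[OF T]]
  have fc: "f x \<in> carrier R" and fadd: "y \<in> T \<Longrightarrow> f (x \<oplus> y) = f x \<oplus> f y"
    and fm: "r \<in> carrier R \<Longrightarrow> f (x \<otimes> r) = f x \<otimes> r" if "x \<in> T" for x y r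
    using right_hom_closed[OF f] right_hom_add[OF f] right_hom_smult[OF f] that by auto
  have "f (\<zero> \<otimes> \<zero>) = f \<zero> \<otimes> \<zero>" using fm[OF right_ideal_zero[OF T], of \<zero>] by simp
  then have f0: "f \<zero> = \<zero>" using fc[OF right_ideal_zero[OF T]] by simp
  have *: "\<exists>c\<in>carrier R. \<forall>t\<in>span R F. f t = c \<otimes> t" if "finite F" "F \<subseteq> T" for F
    using that
  proof (induction F rule: finite_induct)
    case empty
    have "span R {} \<subseteq> {\<zero>}" by (rule right_span_least[OF right_ideal_of_zero]) simp
    then show ?case using f0 by (intro bexI[of _ \<zero>]) auto
  next
    case (insert a F)
    have aT: "a \<in> T" and FT: "F \<subseteq> T" using insert.prems by auto
    have ac: "a \<in> carrier R" and Fc: "F \<subseteq> carrier R" using aT FT Tc by auto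
    obtain c where c: "c \<in> carrier R" "\<forall>t\<in>span R F. f t = c \<otimes> t" using insert.IH[OF FT] by blast
    let ?A = "span R F" and ?B = "{a \<otimes> r | r. r \<in> carrier R}" and ?L = "{r \<otimes> a | r. r \<in> carrier R}"
    have A: "right_ideal ?A R" by (rule right_ideal_span[OF Fc])
    have B: "right_ideal ?B R" by (rule right_ideal_principal[OF ac])
    have L: "left_ideal ?L R" by (rule left_ideal_principal[OF ac])
    have AT: "?A \<subseteq> T" by (rule right_span_least[OF T FT])
    have aL: "a \<in> ?L" using ac by (intro CollectI exI[of _ \<one>]) simp
    note Ac = subsetD[OF right_ideal_carrier[OF A]]
    have "f a \<in> left_annihilator R (right_annihilator R ?L)"
    proof -
      have "f a \<otimes> x = \<zero>" if x: "x \<in> right_annihilator R ?L" for x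
      proof -
        have "a \<otimes> x = \<zero>" "x \<in> carrier R" using x aL by (auto simp: right_annihilator_def)
        then show ?thesis using fm[OF aT, of x] f0 by simp
      qed
      then show ?thesis using fc[OF aT] by (simp add: left_annihilator_def)
    qed
    \<comment> \<open>\<open>f a\<close> is killed by \<open>r(Ra)\<close>, and
      \<open>l(r(Ra)) = Ra\<close>.\<close>
    then obtain d where d: "d \<in> carrier R" "f a = d \<otimes> a" using lr[OF L] by auto
    have fB: "f (a \<otimes> r) = d \<otimes> (a \<otimes> r)" if "r \<in> carrier R" for r
      using fm[OF aT that] d that ac by (simp add: m_assoc)
    let ?lA = "left_annihilator R ?A" and ?lB = "left_annihilator R ?B"
    have lA: "left_ideal ?lA R" and lB: "left_ideal ?lB R"
      using left_ideal_left_annihilator right_ideal_carrier[OF A] right_ideal_carrier[OF B] by blast+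
    have sum: "left_ideal (?lA <+>\<^bsub>R\<^esub> ?lB) R" using O.right_ideal_sum[OF lA lB] by simp
    have "?lA \<subseteq> ?lA <+>\<^bsub>R\<^esub> ?lB" "?lB \<subseteq> ?lA <+>\<^bsub>R\<^esub> ?lB" using O.right_ideal_sum_upper[OF lA lB] by simp_all
    \<comment> \<open>\<open>r(l(A) + l(B))\<close> lies in \<open>A \<inter> B\<close> by
      \<open>rl\<close>; taking left annihilators and applying \<open>lr\<close> gives
      \<open>l(A \<inter> B) \<subseteq> l(A) + l(B)\<close>, and \<open>c - d\<close> belongs to
      the former.\<close>
    then have "right_annihilator R (?lA <+>\<^bsub>R\<^esub> ?lB) \<subseteq> right_annihilator R ?lA \<inter> right_annihilator R ?lB"
      unfolding right_annihilator_def by blast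
    then have rAB: "right_annihilator R (?lA <+>\<^bsub>R\<^esub> ?lB) \<subseteq> ?A \<inter> ?B" using rl[OF A] rl[OF B] by simp
    have "(c \<ominus> d) \<otimes> t = \<zero>" if t: "t \<in> ?A \<inter> ?B" for t
    proof -
      have tc: "t \<in> carrier R" using t Ac by blast
      have "c \<otimes> t = d \<otimes> t" using t c(2) fB by auto
      moreover have "(c \<ominus> d) \<otimes> t = c \<otimes> t \<ominus> d \<otimes> t" using c(1) d(1) tc by algebra
      ultimately show ?thesis using d(1) tc by (simp add: a_minus_def r_neg)
    qed
    then have "c \<ominus> d \<in> left_annihilator R (?A \<inter> ?B)" using c(1) d(1) by (simp add: left_annihilator_def)
    moreover have "left_annihilator R (?A \<inter> ?B) \<subseteq> left_annihilator R Z" if "Z \<subseteq> ?A \<inter> ?B" for Z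
      using that unfolding left_annihilator_def by blast
    ultimately have "c \<ominus> d \<in> left_annihilator R (right_annihilator R (?lA <+>\<^bsub>R\<^esub> ?lB))"
      using rAB by blast
    then have "c \<ominus> d \<in> ?lA <+>\<^bsub>R\<^esub> ?lB" using lr[OF sum] by simp
    then obtain y z where yz: "y \<in> ?lA" "z \<in> ?lB" "c \<ominus> d = y \<oplus> z" unfolding mem_sum_iff by blast
    have yzc: "y \<in> carrier R" "z \<in> carrier R" using yz by (auto simp: left_annihilator_def)
    \<comment> \<open>The common multiplier: \<open>c - y\<close> acts like \<open>c\<close> on
      \<open>A\<close>, and \<open>d + z\<close> acts like \<open>d\<close> on
      \<open>aR\<close>.\<close>
    have cyd: "c \<ominus> y = d \<oplus> z"
    proof -
      have "c = (c \<ominus> d) \<oplus> d" using c(1) d(1) by algebra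
      then have "c = y \<oplus> (d \<oplus> z)" using yz(3) yzc d(1) by (simp add: a_ac)
      then show ?thesis using yzc d(1) add_minus_cancel_left[of "d \<oplus> z" y] by simp
    qed
    have "f t = (c \<ominus> y) \<otimes> t" if t: "t \<in> span R (insert a F)" for t
    proof -
      obtain w r where wr: "w \<in> ?A" "r \<in> carrier R" "t = w \<oplus> a \<otimes> r" using span_insert_right[OF ac Fc t] by blast
      have wc: "w \<in> carrier R" using Ac wr by blast
      have arT: "a \<otimes> r \<in> T" by (rule right_ideal_mult[OF T wr(2) aT])
      have yw: "y \<otimes> w = \<zero>" using yz(1) wr(1) by (auto simp: left_annihilator_def)
      have zr: "z \<otimes> (a \<otimes> r) = \<zero>" using yz(2) wr(2) by (auto simp: left_annihilator_def)
      have "(c \<ominus> y) \<otimes> t = (c \<ominus> y) \<otimes> w \<oplus> (d \<oplus> z) \<otimes> (a \<otimes> r)"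
        unfolding wr(3) cyd[symmetric] using c(1) yzc(1) wc ac wr(2) by (simp add: r_distr)
      also have "\<dots> = (c \<otimes> w \<ominus> y \<otimes> w) \<oplus> (d \<otimes> (a \<otimes> r) \<oplus> z \<otimes> (a \<otimes> r))"
        using c(1) d(1) yzc wc ac wr(2) by algebra
      also have "\<dots> = c \<otimes> w \<oplus> d \<otimes> (a \<otimes> r)"
        using yw zr c(1) d(1) wc ac wr(2) by (simp add: a_minus_def)
      also have "\<dots> = f w \<oplus> f (a \<otimes> r)" using c(2) wr(1) fB[OF wr(2)] by simp
      also have "\<dots> = f t" using fadd[OF subsetD[OF AT wr(1)] arT] wr(3) by simp
      finally show ?thesis by simp
    qed
    then show ?case using c(1) yzc by (intro bexI[of _ "c \<ominus> y"]) auto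
  qed
  obtain F where "finite F" "F \<subseteq> T" "T = span R F" using noeth T unfolding right_noetherian_def by blast
  then show "\<exists>c\<in>carrier R. \<forall>t\<in>T. f t = c \<otimes> t" using * by metis
qed

lemma baer_left_annihilator_right_annihilator:
  assumes baer: "baer_injective R" and noeth: "right_noetherian (opposite_ring R)" and L: "left_ideal L R"
  shows "left_annihilator R (right_annihilator R L) = L"
proof
  interpret O: ring "opposite_ring R" by (rule ring_opposite)
  note Lc = subsetD[OF left_ideal_carrier[OF L]]
  show "L \<subseteq> left_annihilator R (right_annihilator R L)"
    using Lc by (auto simp: left_annihilator_def right_annihilator_def)
  obtain F where F: "finite F" "F \<subseteq> L" "L = span (opposite_ring R) F"
    using noeth L unfolding right_noetherian_def by blast
  have Fc: "F \<subseteq> carrier R" using F Lc by blast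
  show "left_annihilator R (right_annihilator R L) \<subseteq> L"
  proof
    fix b assume b: "b \<in> left_annihilator R (right_annihilator R L)"
    have "b \<in> span (opposite_ring R) F"
    proof (rule baer_finite_left_annihilator[OF baer F(1) Fc])
      show "b \<in> carrier R" using b by (simp add: left_annihilator_def)
      fix x assume x: "x \<in> carrier R" "\<And>a. a \<in> F \<Longrightarrow> a \<otimes> x = \<zero>"
      have "left_ideal (left_annihilator R {x}) R" using x(1) by (intro left_ideal_left_annihilator) simp
      moreover have "F \<subseteq> left_annihilator R {x}" using x Fc by (auto simp: left_annihilator_def)
      ultimately have "L \<subseteq> left_annihilator R {x}" unfolding F(3) by (rule O.right_span_least)
      then have "x \<in> right_annihilator R L" using x(1) by (auto simp: left_annihilator_def right_annihilator_def)
      then show "b \<otimes> x = \<zero>" using b by (simp add: left_annihilator_def)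
    qed
    then show "b \<in> L" using F(3) by simp
  qed
qed

text \<open>The right annihilators of growing finite sets stabilise, and a left ideal generated by a
  finite set is determined by its right annihilator.\<close>

lemma baer_right_artinian_imp_left_noetherian:
  assumes baer: "baer_injective R" and art: "right_artinian R"
  shows "right_noetherian (opposite_ring R)"
proof -
  interpret O: ring "opposite_ring R" by (rule ring_opposite)
  show ?thesis
  proof (rule O.right_noetherianI)
    fix F :: "nat \<Rightarrow> 'a set"
    assume F: "\<And>n. finite (F n)" "\<And>n. F n \<subseteq> carrier (opposite_ring R)" "\<And>n. F n \<subseteq> F (Suc n)"
    have Fc: "F n \<subseteq> carrier R" for n using F(2) by simp
    have "\<exists>m. \<forall>n\<ge>m. right_annihilator R (F n) = right_annihilator R (F m)"
    proof (rule right_artinianD[OF art])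
      show "right_ideal (right_annihilator R (F n)) R" for n by (rule right_ideal_right_annihilator[OF Fc])
      show "right_annihilator R (F (Suc n)) \<subseteq> right_annihilator R (F n)" for n
        using F(3)[of n] unfolding right_annihilator_def by blast
    qed
    then obtain m where m: "right_annihilator R (F (Suc m)) = right_annihilator R (F m)"
      using le_SucI[OF order_refl] by blast
    have "b \<in> span (opposite_ring R) (F m)" if b: "b \<in> F (Suc m)" for b
    proof (rule baer_finite_left_annihilator[OF baer F(1) Fc])
      show "b \<in> carrier R" using b Fc by blast
      fix x assume "x \<in> carrier R" "\<And>a. a \<in> F m \<Longrightarrow> a \<otimes> x = \<zero>"
      then have "x \<in> right_annihilator R (F m)" by (simp add: right_annihilator_def)
      then show "b \<otimes> x = \<zero>" using m b by (auto simp: right_annihilator_def)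
    qed
    then show "\<exists>n. F (Suc n) \<subseteq> span (opposite_ring R) (F n)" by blast
  qed
qed

section \<open>Left-right symmetry of artinian self-injective rings, and the theorem\<close>

lemma self_injective_semilocalI:
  assumes baer: "baer_injective R" and J: "two_sided_ideal J R" and ss: "semisimple_modulo R J"
    and unit: "\<And>j. j \<in> J \<Longrightarrow> \<exists>u\<in>carrier R. (\<one> \<ominus> j) \<otimes> u = \<one> \<and> u \<otimes> (\<one> \<ominus> j) = \<one>"
    and m: "word_products R J m \<subseteq> {\<zero>}"
  shows "self_injective_semilocal R J"
proof
  note Jc = two_sided_ideal_carrier[OF J]
  fix b assume b: "b \<in> carrier R" "b \<noteq> \<zero>"
  let ?P = "\<lambda>n. \<forall>w\<in>word_products R J n. b \<otimes> w = \<zero>"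
  \<comment> \<open>The least length at which all words kill \<open>b\<close> from the right. A word
    \<open>w\<close> one letter shorter with \<open>b w\<close> nonzero places \<open>b w\<close> in
    \<open>l(J)\<close>.\<close>
  define k where "k = (LEAST n. ?P n)"
  have "?P m" using m b by auto
  then have k: "?P k" unfolding k_def by (rule LeastI)
  have "k \<noteq> 0" using k b by (cases k) auto
  then obtain n where n: "k = Suc n" by (cases k) auto
  then have "\<not> ?P n" using not_less_Least[of n ?P] by (simp add: k_def)
  then obtain w where w: "w \<in> word_products R J n" "b \<otimes> w \<noteq> \<zero>" by blast
  have wc: "w \<in> carrier R" by (rule word_products_closed[OF Jc w(1)])
  have "b \<otimes> w \<otimes> j = \<zero>" if j: "j \<in> J" for j
  proof -
    have "w \<otimes> j \<in> word_products R J k" using w(1) j n by auto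
    then have "b \<otimes> (w \<otimes> j) = \<zero>" using k by blast
    then show ?thesis using b wc j Jc by (auto simp: m_assoc)
  qed
  then have "b \<otimes> w \<in> left_annihilator R J" using b wc by (simp add: left_annihilator_def)
  then show "\<exists>r\<in>carrier R. b \<otimes> r \<noteq> \<zero> \<and> b \<otimes> r \<in> left_annihilator R J" using wc w(2) by blast
qed (rule assms | assumption)+

text \<open>The property \<open>r(l(T)) = T\<close> comes first because either artinian hypothesis
  yields it. With noetherianity on the left it gives \<open>l(r(L)) = L\<close>, and the two
  dualities supply the remaining conditions.\<close>

lemma baer_artinian_symmetric:
  assumes baer: "baer_injective R" and art: "right_artinian R \<or> right_artinian (opposite_ring R)"
  shows "right_artinian R \<and> right_artinian (opposite_ring R) \<and> right_noetherian R \<and>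
    right_noetherian (opposite_ring R) \<and> baer_injective (opposite_ring R)"
proof -
  interpret O: ring "opposite_ring R" by (rule ring_opposite)
  have "\<exists>J. self_injective_semilocal R J"
    using art
  proof
    assume art: "right_artinian R"
    obtain m where "word_products R (jacobson_radical R) m \<subseteq> {\<zero>}" using right_artinian_nilpotent[OF art] by blast
    then have "self_injective_semilocal R (jacobson_radical R)"
      using jacobson_unit
      by (intro self_injective_semilocalI[OF baer two_sided_jacobson right_artinian_semisimple_modulo_jacobson[OF art]])
    then show ?thesis by blast
  next
    assume art: "right_artinian (opposite_ring R)"
    \<comment> \<open>The radical defined by maximal left ideals. The locale accepts any ideal with
      the stated properties, so no comparison with \<open>jacobson_radical R\<close> is
      made.\<close>
    let ?J = "jacobson_radical (opposite_ring R)"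
    have J: "two_sided_ideal ?J R" using O.two_sided_jacobson by simp
    obtain m where m: "word_products (opposite_ring R) ?J m \<subseteq> {\<zero>}" using O.right_artinian_nilpotent[OF art] by auto
    have "word_products R ?J m \<subseteq> word_products (opposite_ring R) ?J m"
      using O.word_products_opposite[of ?J m] two_sided_ideal_carrier[OF J] by simp
    then have "word_products R ?J m \<subseteq> {\<zero>}" using m by blast
    moreover have "semisimple_modulo R ?J"
      using O.semisimple_opposite[OF O.two_sided_jacobson O.right_artinian_semisimple_modulo_jacobson[OF art]] by simp
    ultimately have "self_injective_semilocal R ?J"
      using O.jacobson_unit by (intro self_injective_semilocalI[OF baer J]) auto
    then show ?thesis by blast
  qed
  then obtain J where "self_injective_semilocal R J" by blast
  then interpret self_injective_semilocal R J .
  note rl = right_annihilator_left_annihilator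
  have noeth: "right_noetherian R \<and> right_noetherian (opposite_ring R)"
    using art
  proof
    assume "right_artinian R"
    then show ?thesis using right_artinian_imp_noetherian baer_right_artinian_imp_left_noetherian[OF baer] by blast
  next
    assume a: "right_artinian (opposite_ring R)"
    then show ?thesis using O.right_artinian_imp_noetherian right_noetherianI_annihilators[OF a rl] by blast
  qed
  note lr = baer_left_annihilator_right_annihilator[OF baer conjunct2[OF noeth]]
  have "right_artinian R" by (rule right_artinianI_annihilators[OF conjunct2[OF noeth] rl])
  moreover have "right_artinian (opposite_ring R)"
    using noeth lr by (intro O.right_artinianI_annihilators) simp_all
  moreover have "baer_injective (opposite_ring R)"
    using noeth lr rl by (intro O.baer_injectiveI_annihilators) simp_all
  ultimately show ?thesis using noeth by blast
qed

lemma right_artinian_essential_socle: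
  assumes art: "right_artinian R"
  shows "essential_submodule (socle R (right_regular R)) R (right_regular R)"
proof -
  interpret RR: right_module R "right_regular R" by (rule right_module_right_regular)
  show ?thesis
    unfolding essential_submodule_def
  proof (intro conjI allI impI)
    show "right_ideal (socle R (right_regular R)) R" by (rule RR.submodule_socle)
    fix L assume L': "right_ideal L R \<and> L \<noteq> {\<zero>\<^bsub>right_regular R\<^esub>}"
    then have L: "right_ideal L R" "L \<noteq> {\<zero>}" by auto
    let ?F = "{H. right_ideal H R \<and> H \<noteq> {\<zero>} \<and> H \<subseteq> L}"
    have "L \<in> ?F" using L by simp
    then have "\<exists>M\<in>?F. \<forall>X\<in>?F. X \<subseteq> M \<longrightarrow> X = M" by (rule right_artinian_minimal[OF art]) simp
    then obtain P where PF: "P \<in> ?F" and Pmin: "\<forall>X\<in>?F. X \<subseteq> P \<longrightarrow> X = P" by (rule bexE)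
    from PF have P: "right_ideal P R" "P \<noteq> {\<zero>}" "P \<subseteq> L" by auto
    have "simple_submodule P R (right_regular R)"
      unfolding simple_submodule_def using P Pmin by auto
    then have "P \<subseteq> socle R (right_regular R)" by (rule RR.simple_subset_socle)
    then show "socle R (right_regular R) \<inter> L \<noteq> {\<zero>\<^bsub>right_regular R\<^esub>}"
      using P right_ideal_zero[OF P(1)] by auto
  qed
qed

lemma right_noetherian_annihilator_chain:
  assumes noeth: "right_noetherian R" and x: "\<And>n. x n \<in> carrier R"
  shows "\<exists>m. \<forall>n\<ge>m. right_annihilator R {left_product R x n} = right_annihilator R {left_product R x m}"
proof (rule right_noetherian_acc[OF noeth])
  have p: "left_product R x n \<in> carrier R" for n by (rule left_product_closed[OF x])
  show "right_ideal (right_annihilator R {left_product R x n}) R" for n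
    using p by (intro right_ideal_right_annihilator) simp
  show "right_annihilator R {left_product R x n} \<subseteq> right_annihilator R {left_product R x (Suc n)}" for n
    using x p by (auto simp: right_annihilator_def m_assoc)
qed

end

theorem theorem5p12:
  fixes R :: "('a, 'b) ring_scheme"
  assumes "ring R"
  shows "quasi_frobenius TYPE(('a, 'm) universe) R \<longleftrightarrow>
    strongly_right_ss_injective TYPE(('a, 'm) universe) R \<and>
    countably_generated (left_annihilator R (jacobson_radical R \<cdot>\<^bsub>R\<^esub> jacobson_radical R))
      (opposite_ring R) (left_regular R) \<and>
    essential_submodule (socle R (right_regular R)) R (right_regular R) \<and>
    (\<forall>x :: nat \<Rightarrow> 'a. (\<forall>n. x n \<in> carrier R) \<longrightarrow>
       (\<exists>m. \<forall>n\<ge>m. right_annihilator R {left_product R x n} =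
                  right_annihilator R {left_product R x m}))"
    (is "?QF \<longleftrightarrow> ?ss \<and> ?cg \<and> ?ess \<and> ?chain")
proof
  interpret R: ring R by fact
  interpret O: ring "opposite_ring R" by (rule R.ring_opposite)
  let ?J2 = "jacobson_radical R \<cdot>\<^bsub>R\<^esub> jacobson_radical R"
  assume QF: ?QF
  then have art: "right_artinian R \<or> right_artinian (opposite_ring R)"
    and "baer_injective R \<or> baer_injective (opposite_ring R)"
    unfolding quasi_frobenius_def using R.injective_imp_baer O.injective_imp_baer by blast+
  \<comment> \<open>If injectivity is only known for the opposite ring, the symmetric statement for
    that ring moves it to \<open>R\<close>.\<close>
  then have *: "baer_injective R \<and> right_artinian R \<and> right_noetherian R \<and> right_noetherian (opposite_ring R)"
    using R.baer_artinian_symmetric O.baer_artinian_symmetric by (metis opposite_ring_simps(6))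
  have ?ss
    unfolding strongly_right_ss_injective_def small_submodule_def using * baer_injective_extends by blast
  moreover have ?cg
  proof -
    have J2: "?J2 \<subseteq> carrier R"
      by (rule R.two_sided_ideal_carrier[OF R.two_sided_ideal_prod[OF R.two_sided_jacobson]])
    then obtain F where F: "finite F" "F \<subseteq> left_annihilator R ?J2" "left_annihilator R ?J2 = span (opposite_ring R) F"
      using * R.left_ideal_left_annihilator unfolding right_noetherian_def by blast
    then show ?thesis
      unfolding countably_generated_def left_regular_def
      by (intro exI[of _ F]) (auto intro: countable_finite simp: left_annihilator_def)
  qed
  moreover have ?ess using R.right_artinian_essential_socle * by blast
  moreover have ?chain using R.right_noetherian_annihilator_chain * by blast
  ultimately show "?ss \<and> ?cg \<and> ?ess \<and> ?chain" by blast
next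
  interpret R: ring R by fact
  assume asm: "?ss \<and> ?cg \<and> ?ess \<and> ?chain"
  interpret ss_injective_chain R "TYPE(('a, 'm) universe)"
    by (intro ss_injective_chain.intro ss_injective_chain_axioms.intro assms) (use asm in blast)+
  have "right_artinian R" using right_artinian asm by blast
  then show ?QF
    unfolding quasi_frobenius_def using baer_imp_injective[OF baer_injective] by blast
qed

end
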